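(* Let $(N,Y)$ be a smooth non-singular flow. (i) If $(N,Y)$ is isometric, i.e. there is a Riemannian metric $g$ on $N$ which is preserved by $Y$ (that is, $\mathcal{L}_Y g = 0$), then the $1$-form $\theta = g\cdot Y$ dual to $Y$ with respect to $g$ is strongly adapted to $(N,Y)$. (ii) More generally, if $(N,Y)$ is geodesible, i.e. there is a Riemannian metric $g$ on $N$ such that the trajectories of $(N,Y)$ are geodesics parameterised by arclength, then the $1$-form $\theta = g\cdot Y$ is strongly adapted to $(N,Y)$. (iii) If $(N,Y)$ is an Anosov flow whose splitting is smooth, i.e. at every point $y\in N$ the tangent space $T_yN$ splits smoothly into the line $\mathbb{R}Y(y)$, the stable bundle $E^+_y$ and the unstable bundle $E^-_y$, then the canonical $1$-form $\theta$ (defined by setting $\theta(y)$ to take the value $1$ at $Y(y)$ and to vanish on $E^+_y$ and $E^-_y$) is strongly adapted to $(N,Y)$. (iv) If $(N,Y)$ is the suspension of some diffeomorphism $\Phi\colon M\to M$ of a compact manifold $M$, i.e. $N$ is the manifold formed from $M\times[0,1]$ by identifying $(y,1)$ with $(\Phi(y),0)$, with vector field $Y=(0,1)$ in the coordinate patch $M\times[0,1)$, then the $1$-form $\theta$ defined on the coordinate patch $M\times[0,1)$ by $\theta=dt$ (where $t$ is the second coordinate of $M\times[0,1)$) is strongly adapted to $(N,Y)$. (v) The product system $(M\times(\mathbb{R}/\mathbb{Z}),(X,1))$ of an arbitrary smooth flow $(M,X)$ with the circle shift $(\mathbb{R}/\mathbb{Z},1)$ is non-singular and has $dt$ as a strongly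 adapted $1$-form, where $t$ is the second coordinate on the coordinate patch $M\times[0,1)$.
   Context: All vector fields, differential forms and Riemannian metrics are smooth. A smooth flow is a pair $(N,Y)$ of a smooth manifold $N$ and a vector field $Y$ on $N$; it is non-singular if $Y$ is nowhere vanishing. Trajectories are solutions of $\partial_t u=Y(u)$. $\mathcal{L}_Y$ denotes the Lie derivative along $Y$. A $1$-form $\theta$ on $N$ is strongly adapted to a non-singular smooth flow $(N,Y)$ if $\theta(Y)$ is strictly positive everywhere and $\mathcal{L}_Y\theta$ is an exact $1$-form, i.e. $\mathcal{L}_Y\theta=dL$ for some smooth $L\colon N\to\mathbb{R}$. For a Riemannian metric $g$, $g\cdot Y$ denotes the $1$-form $Z\mapsto g(Y,Z)$. In (iii), "stable bundle" and "unstable bundle" have their usual meaning for Anosov flows: $E^+$ and $E^-$ are subbundles of $TN$ invariant under the derivative of the flow maps $e^{tY}$, with vectors in $E^+$ (respectively $E^-$) uniformly exponentially contracted in forward (respectively backward) time with respect to some Riemannian metric. In (v), the circle shift $(\mathbb{R}/\mathbb{Z},1)$ is the flow on $\mathbb{R}/\mathbb{Z}$ with constant unit vector field. *)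

theory Defs
  imports "HOL-Analysis.Analysis"
begin

section \<open>Smooth functions on open subsets of normed spaces\<close>

text \<open>
  For open \<open>S\<close> in a finite-dimensional space, \<open>k_times_diff_on k S f\<close> says that \<open>f\<close> is of class
  \<open>C\<^sup>k\<close> on \<open>S\<close>: all directional derivatives of order at most \<open>k\<close> exist and are continuous.
\<close>

primrec k_times_diff_on ::
  "nat \<Rightarrow> 'a::real_normed_vector set \<Rightarrow> ('a \<Rightarrow> 'b::real_normed_vector) \<Rightarrow> bool" where
  "k_times_diff_on 0 S f \<longleftrightarrow> continuous_on S f"
| "k_times_diff_on (Suc k) S f \<longleftrightarrow>
     (\<forall>x\<in>S. f differentiable (at x)) \<and>
     (\<forall>v. k_times_diff_on k S (\<lambda>x. frechet_derivative f (at x) v))"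

definition smooth_on ::
  "'a::real_normed_vector set \<Rightarrow> ('a \<Rightarrow> 'b::real_normed_vector) \<Rightarrow> bool" where
  "smooth_on S f \<longleftrightarrow> (\<forall>k. k_times_diff_on k S f)"


section \<open>Smooth manifolds\<close>

text \<open>
  A chart is a domain together with a coordinate map, whose values outside the domain are
  irrelevant.  The point set of a manifold is the underlying set \<open>topspace\<close> of its topology.
\<close>

type_synonym ('a, 'e) chart = "'a set \<times> ('a \<Rightarrow> 'e)"

abbreviation cdom :: "('a, 'e) chart \<Rightarrow> 'a set" where "cdom \<equiv> fst"
abbreviation cmap :: "('a, 'e) chart \<Rightarrow> 'a \<Rightarrow> 'e" where "cmap \<equiv> snd"

definition cimg :: "('a, 'e) chart \<Rightarrow> 'e set" where
  "cimg c = cmap c ` cdom c"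

definition cinv :: "('a, 'e) chart \<Rightarrow> 'e \<Rightarrow> 'a" where
  "cinv c = inv_into (cdom c) (cmap c)"

record ('a, 'e) manifold =
  mtop :: "'a topology"
  atlas :: "('a, 'e) chart set"

abbreviation points :: "('a, 'e) manifold \<Rightarrow> 'a set" where
  "points N \<equiv> topspace (mtop N)"

text \<open>
  The model space is an arbitrary finite-dimensional normed space rather than a type of class
  \<open>euclidean_space\<close>, because the latter class excludes dimension zero.
\<close>

definition smooth_manifold :: "('a, 'e::real_normed_vector) manifold \<Rightarrow> bool" where
  "smooth_manifold N \<longleftrightarrow>
     (\<exists>B::'e set. finite B \<and> span B = UNIV) \<and>
     Hausdorff_space (mtop N) \<and> second_countable (mtop N) \<and>
     points N = (\<Union>c\<in>atlas N. cdom c) \<and>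
     (\<forall>c\<in>atlas N. openin (mtop N) (cdom c) \<and> open (cimg c) \<and>
        homeomorphic_map (subtopology (mtop N) (cdom c)) (top_of_set (cimg c)) (cmap c)) \<and>
     (\<forall>c\<in>atlas N. \<forall>d\<in>atlas N. smooth_on (cmap c ` (cdom c \<inter> cdom d)) (cmap d \<circ> cinv c))"

definition chart_around :: "('a, 'e) manifold \<Rightarrow> ('a, 'e) chart \<Rightarrow> 'a \<Rightarrow> bool" where
  "chart_around N c p \<longleftrightarrow> c \<in> atlas N \<and> p \<in> cdom c"

definition chart_at :: "('a, 'e) manifold \<Rightarrow> 'a \<Rightarrow> ('a, 'e) chart" where
  "chart_at N p = (SOME c. chart_around N c p)"

definition smooth_fun :: "('a, 'e::real_normed_vector) manifold \<Rightarrow> ('a \<Rightarrow> real) \<Rightarrow> bool" where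
  "smooth_fun N f \<longleftrightarrow> (\<forall>c\<in>atlas N. smooth_on (cimg c) (f \<circ> cinv c))"

definition smooth_map ::
  "('a, 'e::real_normed_vector) manifold \<Rightarrow> ('b, 'f::real_normed_vector) manifold
     \<Rightarrow> ('a \<Rightarrow> 'b) \<Rightarrow> bool" where
  "smooth_map M N F \<longleftrightarrow>
     continuous_map (mtop M) (mtop N) F \<and>
     (\<forall>c\<in>atlas M. \<forall>d\<in>atlas N.
        smooth_on (cmap c ` {p \<in> cdom c. F p \<in> cdom d}) (cmap d \<circ> F \<circ> cinv c))"

definition diffeomorphism ::
  "('a, 'e::real_normed_vector) manifold \<Rightarrow> ('b, 'f::real_normed_vector) manifold
     \<Rightarrow> ('a \<Rightarrow> 'b) \<Rightarrow> bool" where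
  "diffeomorphism M N F \<longleftrightarrow>
     bij_betw F (points M) (points N) \<and> smooth_map M N F \<and>
     smooth_map N M (inv_into (points M) F)"

definition prod_chart :: "('a, 'e) chart \<Rightarrow> ('b, 'f) chart \<Rightarrow> ('a \<times> 'b, 'e \<times> 'f) chart" where
  "prod_chart c d = (cdom c \<times> cdom d, map_prod (cmap c) (cmap d))"

definition prod_manifold ::
  "('a, 'e) manifold \<Rightarrow> ('b, 'f) manifold \<Rightarrow> ('a \<times> 'b, 'e \<times> 'f) manifold" where
  "prod_manifold M N =
     \<lparr>mtop = prod_topology (mtop M) (mtop N),
      atlas = {prod_chart c d |c d. c \<in> atlas M \<and> d \<in> atlas N}\<rparr>"

definition real_line :: "(real, real) manifold" where
  "real_line = \<lparr>mtop = euclideanreal, atlas = {(UNIV, id)}\<rparr>"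

definition quotient_topology :: "'a topology \<Rightarrow> ('a \<Rightarrow> 'b) \<Rightarrow> 'b topology" where
  "quotient_topology X q =
     topology (\<lambda>U. U \<subseteq> q ` topspace X \<and> openin X {x \<in> topspace X. q x \<in> U})"

lemma openin_quotient_topology:
  "openin (quotient_topology X q) U \<longleftrightarrow>
     U \<subseteq> q ` topspace X \<and> openin X {x \<in> topspace X. q x \<in> U}"
proof -
  have "istopology (\<lambda>U. U \<subseteq> q ` topspace X \<and> openin X {x \<in> topspace X. q x \<in> U})"
    unfolding istopology_def
  proof (intro conjI allI impI)
    fix S T
    assume S: "S \<subseteq> q ` topspace X \<and> openin X {x \<in> topspace X. q x \<in> S}"
      and T: "T \<subseteq> q ` topspace X \<and> openin X {x \<in> topspace X. q x \<in> T}"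
    show "S \<inter> T \<subseteq> q ` topspace X" using S by blast
    have "{x \<in> topspace X. q x \<in> S \<inter> T} =
        {x \<in> topspace X. q x \<in> S} \<inter> {x \<in> topspace X. q x \<in> T}" by blast
    then show "openin X {x \<in> topspace X. q x \<in> S \<inter> T}" using S T by auto
  next
    fix K
    assume K: "\<forall>S\<in>K. S \<subseteq> q ` topspace X \<and> openin X {x \<in> topspace X. q x \<in> S}"
    show "\<Union>K \<subseteq> q ` topspace X" using K by blast
    have "{x \<in> topspace X. q x \<in> \<Union>K} = (\<Union>S\<in>K. {x \<in> topspace X. q x \<in> S})" by blast
    then show "openin X {x \<in> topspace X. q x \<in> \<Union>K}" using K by auto
  qed
  then show ?thesis unfolding quotient_topology_def by (simp add: topology_inverse')
qed


section \<open>Tangent vectors\<close>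

text \<open>
  A tangent vector at \<open>p\<close> is given by its components in all charts around \<open>p\<close>, subject to the
  transformation law under changes of charts.  Components in charts that are not around \<open>p\<close> are
  set to zero, so that vectors with the same components are equal.
\<close>

type_synonym ('a, 'e) tangent = "('a, 'e) chart \<Rightarrow> 'e"

definition tangent_space ::
  "('a, 'e::real_normed_vector) manifold \<Rightarrow> 'a \<Rightarrow> ('a, 'e) tangent set" where
  "tangent_space N p =
     {v. (\<forall>c. \<not> chart_around N c p \<longrightarrow> v c = 0) \<and>
         (\<forall>c d. chart_around N c p \<and> chart_around N d p \<longrightarrow>
            v d = frechet_derivative (cmap d \<circ> cinv c) (at (cmap c p)) (v c))}"

text \<open>The tangent vector at \<open>p\<close> whose component in the chart \<open>c\<close> is \<open>v\<close>:\<close>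

definition tangent_of ::
  "('a, 'e::real_normed_vector) manifold \<Rightarrow> ('a, 'e) chart \<Rightarrow> 'a \<Rightarrow> 'e \<Rightarrow> ('a, 'e) tangent" where
  "tangent_of N c p v =
     (\<lambda>d. if chart_around N d p
          then frechet_derivative (cmap d \<circ> cinv c) (at (cmap c p)) v else 0)"

definition tangent_map ::
  "('a, 'e::real_normed_vector) manifold \<Rightarrow> ('b, 'f::real_normed_vector) manifold
     \<Rightarrow> ('a \<Rightarrow> 'b) \<Rightarrow> 'a \<Rightarrow> ('a, 'e) tangent \<Rightarrow> ('b, 'f) tangent" where
  "tangent_map M N F p v =
     (let c = chart_at M p in
      (\<lambda>d. if chart_around N d (F p)
           then frechet_derivative (cmap d \<circ> F \<circ> cinv c) (at (cmap c p)) (v c) else 0))"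

definition differential ::
  "('a, 'e::real_normed_vector) manifold \<Rightarrow> ('a \<Rightarrow> real) \<Rightarrow> 'a \<Rightarrow> ('a, 'e) tangent \<Rightarrow> real" where
  "differential N f p v =
     (let c = chart_at N p in frechet_derivative (f \<circ> cinv c) (at (cmap c p)) (v c))"


section \<open>Vector fields, 1-forms and Riemannian metrics\<close>

type_synonym ('a, 'e) field = "'a \<Rightarrow> ('a, 'e) tangent"
type_synonym ('a, 'e) form = "'a \<Rightarrow> ('a, 'e) tangent \<Rightarrow> real"
type_synonym ('a, 'e) metric = "'a \<Rightarrow> ('a, 'e) tangent \<Rightarrow> ('a, 'e) tangent \<Rightarrow> real"

text \<open>Coordinate expressions in a chart \<open>c\<close>; the argument \<open>x\<close> ranges over \<open>cimg c\<close>.\<close>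

definition field_in :: "('a, 'e) field \<Rightarrow> ('a, 'e) chart \<Rightarrow> 'e \<Rightarrow> 'e" where
  "field_in Y c x = Y (cinv c x) c"

definition form_in ::
  "('a, 'e::real_normed_vector) manifold \<Rightarrow> ('a, 'e) form \<Rightarrow> ('a, 'e) chart \<Rightarrow> 'e \<Rightarrow> 'e \<Rightarrow> real" where
  "form_in N \<theta> c x v = \<theta> (cinv c x) (tangent_of N c (cinv c x) v)"

definition metric_in ::
  "('a, 'e::real_normed_vector) manifold \<Rightarrow> ('a, 'e) metric \<Rightarrow> ('a, 'e) chart
     \<Rightarrow> 'e \<Rightarrow> 'e \<Rightarrow> 'e \<Rightarrow> real" where
  "metric_in N g c x v w =
     g (cinv c x) (tangent_of N c (cinv c x) v) (tangent_of N c (cinv c x) w)"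

definition vector_field ::
  "('a, 'e::real_normed_vector) manifold \<Rightarrow> ('a, 'e) field \<Rightarrow> bool" where
  "vector_field N Y \<longleftrightarrow>
     (\<forall>p\<in>points N. Y p \<in> tangent_space N p) \<and>
     (\<forall>c\<in>atlas N. smooth_on (cimg c) (field_in Y c))"

definition one_form ::
  "('a, 'e::real_normed_vector) manifold \<Rightarrow> ('a, 'e) form \<Rightarrow> bool" where
  "one_form N \<theta> \<longleftrightarrow>
     (\<forall>c\<in>atlas N. (\<forall>x\<in>cimg c. linear (form_in N \<theta> c x)) \<and>
        (\<forall>v. smooth_on (cimg c) (\<lambda>x. form_in N \<theta> c x v)))"

definition riemannian_metric ::
  "('a, 'e::real_normed_vector) manifold \<Rightarrow> ('a, 'e) metric \<Rightarrow> bool" where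
  "riemannian_metric N g \<longleftrightarrow>
     (\<forall>p\<in>points N. \<forall>v\<in>tangent_space N p.
        (\<forall>w\<in>tangent_space N p. g p v w = g p w v) \<and> (v \<noteq> (\<lambda>_. 0) \<longrightarrow> g p v v > 0)) \<and>
     (\<forall>c\<in>atlas N.
        (\<forall>x\<in>cimg c. \<forall>v. linear (metric_in N g c x v) \<and> linear (\<lambda>w. metric_in N g c x w v)) \<and>
        (\<forall>v w. smooth_on (cimg c) (\<lambda>x. metric_in N g c x v w)))"

definition dual_form :: "('a, 'e) metric \<Rightarrow> ('a, 'e) field \<Rightarrow> ('a, 'e) form" where
  "dual_form g Y = (\<lambda>p v. g p (Y p) v)"

definition smooth_flow ::
  "('a, 'e::real_normed_vector) manifold \<Rightarrow> ('a, 'e) field \<Rightarrow> bool" where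
  "smooth_flow N Y \<longleftrightarrow> smooth_manifold N \<and> vector_field N Y"

definition nonsingular_flow ::
  "('a, 'e::real_normed_vector) manifold \<Rightarrow> ('a, 'e) field \<Rightarrow> bool" where
  "nonsingular_flow N Y \<longleftrightarrow> smooth_flow N Y \<and> (\<forall>p\<in>points N. Y p \<noteq> (\<lambda>_. 0))"

text \<open>
  Lie derivatives along \<open>Y\<close> in local coordinates:
  \<open>(L\<^sub>Y \<theta>)\<^sub>i = Y\<^sup>j \<partial>\<^sub>j \<theta>\<^sub>i + \<theta>\<^sub>j \<partial>\<^sub>i Y\<^sup>j\<close> and
  \<open>(L\<^sub>Y g)\<^sub>i\<^sub>k = Y\<^sup>j \<partial>\<^sub>j g\<^sub>i\<^sub>k + g\<^sub>j\<^sub>k \<partial>\<^sub>i Y\<^sup>j + g\<^sub>i\<^sub>j \<partial>\<^sub>k Y\<^sup>j\<close>.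
  The values do not depend on the chart used to compute them.
\<close>

definition lie_form ::
  "('a, 'e::real_normed_vector) manifold \<Rightarrow> ('a, 'e) field \<Rightarrow> ('a, 'e) form \<Rightarrow> ('a, 'e) form" where
  "lie_form N Y \<theta> p v =
     (let c = chart_at N p; x = cmap c p; A = form_in N \<theta> c; Z = field_in Y c in
      frechet_derivative (\<lambda>y. A y (v c)) (at x) (Z x)
      + A x (frechet_derivative Z (at x) (v c)))"

definition lie_metric ::
  "('a, 'e::real_normed_vector) manifold \<Rightarrow> ('a, 'e) field \<Rightarrow> ('a, 'e) metric \<Rightarrow> ('a, 'e) metric" where
  "lie_metric N Y g p v w =
     (let c = chart_at N p; x = cmap c p; G = metric_in N g c; Z = field_in Y c in
      frechet_derivative (\<lambda>y. G y (v c) (w c)) (at x) (Z x)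
      + G x (frechet_derivative Z (at x) (v c)) (w c)
      + G x (v c) (frechet_derivative Z (at x) (w c)))"

definition strongly_adapted ::
  "('a, 'e::real_normed_vector) manifold \<Rightarrow> ('a, 'e) field \<Rightarrow> ('a, 'e) form \<Rightarrow> bool" where
  "strongly_adapted N Y \<theta> \<longleftrightarrow>
     one_form N \<theta> \<and> (\<forall>p\<in>points N. \<theta> p (Y p) > 0) \<and>
     (\<exists>L. smooth_fun N L \<and>
        (\<forall>p\<in>points N. \<forall>v\<in>tangent_space N p. lie_form N Y \<theta> p v = differential N L p v))"

definition preserves_metric ::
  "('a, 'e::real_normed_vector) manifold \<Rightarrow> ('a, 'e) field \<Rightarrow> ('a, 'e) metric \<Rightarrow> bool" where
  "preserves_metric N Y g \<longleftrightarrow>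
     (\<forall>p\<in>points N. \<forall>v\<in>tangent_space N p. \<forall>w\<in>tangent_space N p. lie_metric N Y g p v w = 0)"


section \<open>Trajectories and geodesics\<close>

definition trajectory ::
  "('a, 'e::real_normed_vector) manifold \<Rightarrow> ('a, 'e) field \<Rightarrow> real set \<Rightarrow> (real \<Rightarrow> 'a) \<Rightarrow> bool" where
  "trajectory N Y I u \<longleftrightarrow>
     open I \<and> is_interval I \<and> continuous_map (top_of_set I) (mtop N) u \<and>
     (\<forall>t\<in>I. \<forall>c. chart_around N c (u t) \<longrightarrow>
        ((cmap c \<circ> u) has_vector_derivative Y (u t) c) (at t))"

text \<open>
  The vector \<open>\<Gamma>(v,w)\<close> with components \<open>\<Gamma>\<^sup>k\<^sub>i\<^sub>j v\<^sup>i w\<^sup>j\<close>, where \<open>\<Gamma>\<^sup>k\<^sub>i\<^sub>j\<close> are the Christoffel symbols of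
  the Levi-Civita connection:
  \<open>g\<^sub>k\<^sub>l \<Gamma>\<^sup>k\<^sub>i\<^sub>j = (\<partial>\<^sub>i g\<^sub>j\<^sub>l + \<partial>\<^sub>j g\<^sub>i\<^sub>l - \<partial>\<^sub>l g\<^sub>i\<^sub>j) / 2\<close>.
\<close>

definition christoffel ::
  "('a, 'e::real_normed_vector) manifold \<Rightarrow> ('a, 'e) metric \<Rightarrow> ('a, 'e) chart
     \<Rightarrow> 'e \<Rightarrow> 'e \<Rightarrow> 'e \<Rightarrow> 'e" where
  "christoffel N g c x v w =
     (let G = metric_in N g c in
      THE a. \<forall>z. G x a z =
        (frechet_derivative (\<lambda>y. G y w z) (at x) v
         + frechet_derivative (\<lambda>y. G y v z) (at x) w
         - frechet_derivative (\<lambda>y. G y v w) (at x) z) / 2)"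

text \<open>In each chart, \<open>a\<close> below is the coordinate velocity of \<open>u\<close>.\<close>

definition geodesic ::
  "('a, 'e::real_normed_vector) manifold \<Rightarrow> ('a, 'e) metric \<Rightarrow> real set \<Rightarrow> (real \<Rightarrow> 'a) \<Rightarrow> bool" where
  "geodesic N g I u \<longleftrightarrow>
     open I \<and> is_interval I \<and> continuous_map (top_of_set I) (mtop N) u \<and>
     (\<forall>c\<in>atlas N. \<exists>a. \<forall>t\<in>I. u t \<in> cdom c \<longrightarrow>
        ((cmap c \<circ> u) has_vector_derivative a t) (at t) \<and>
        (a has_vector_derivative - christoffel N g c (cmap c (u t)) (a t) (a t)) (at t))"

definition velocity ::
  "('a, 'e::real_normed_vector) manifold \<Rightarrow> (real \<Rightarrow> 'a) \<Rightarrow> real \<Rightarrow> ('a, 'e) tangent" where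
  "velocity N u t =
     (\<lambda>c. if chart_around N c (u t) then vector_derivative (cmap c \<circ> u) (at t) else 0)"

definition arclength_parameterised ::
  "('a, 'e::real_normed_vector) manifold \<Rightarrow> ('a, 'e) metric \<Rightarrow> real set \<Rightarrow> (real \<Rightarrow> 'a) \<Rightarrow> bool" where
  "arclength_parameterised N g I u \<longleftrightarrow>
     (\<forall>t\<in>I. sqrt (g (u t) (velocity N u t) (velocity N u t)) = 1)"

definition geodesible_with ::
  "('a, 'e::real_normed_vector) manifold \<Rightarrow> ('a, 'e) field \<Rightarrow> ('a, 'e) metric \<Rightarrow> bool" where
  "geodesible_with N Y g \<longleftrightarrow>
     (\<forall>I u. trajectory N Y I u \<longrightarrow> geodesic N g I u \<and> arclength_parameterised N g I u)"


section \<open>Anosov flows with smooth splitting\<close>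

text \<open>The global flow \<open>\<Psi> t = e\<^sup>t\<^sup>Y\<close>; its existence is the completeness of \<open>Y\<close>.\<close>

definition flow_maps ::
  "('a, 'e::real_normed_vector) manifold \<Rightarrow> ('a, 'e) field \<Rightarrow> (real \<Rightarrow> 'a \<Rightarrow> 'a) \<Rightarrow> bool" where
  "flow_maps N Y \<Psi> \<longleftrightarrow>
     smooth_map (prod_manifold real_line N) N (\<lambda>(t, p). \<Psi> t p) \<and>
     (\<forall>p\<in>points N. \<Psi> 0 p = p \<and> trajectory N Y UNIV (\<lambda>t. \<Psi> t p))"

text \<open>Smooth subbundles of the tangent bundle: locally spanned by a smooth frame \<open>b 0, \<dots>, b (k-1)\<close>.\<close>

definition smooth_subbundle ::
  "('a, 'e::real_normed_vector) manifold \<Rightarrow> ('a \<Rightarrow> ('a, 'e) tangent set) \<Rightarrow> bool" where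
  "smooth_subbundle N E \<longleftrightarrow>
     (\<forall>p\<in>points N. E p \<subseteq> tangent_space N p \<and>
        (\<exists>c W k. \<exists>b :: nat \<Rightarrow> 'e \<Rightarrow> 'e.
           chart_around N c p \<and> open W \<and> cmap c p \<in> W \<and> W \<subseteq> cimg c \<and>
           (\<forall>i<k. smooth_on W (b i)) \<and>
           (\<forall>x\<in>W. inj_on (\<lambda>i. b i x) {..<k} \<and> independent ((\<lambda>i. b i x) ` {..<k}) \<and>
              (\<lambda>v. v c) ` E (cinv c x) = span ((\<lambda>i. b i x) ` {..<k}))))"

definition splitting ::
  "('a, 'e::real_normed_vector) manifold \<Rightarrow> ('a, 'e) field \<Rightarrow> ('a \<Rightarrow> ('a, 'e) tangent set)
     \<Rightarrow> ('a \<Rightarrow> ('a, 'e) tangent set) \<Rightarrow> bool" where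
  "splitting N Y Ep Em \<longleftrightarrow>
     (\<forall>p\<in>points N. \<forall>v\<in>tangent_space N p.
        \<exists>!(a, v1, v2). v1 \<in> Ep p \<and> v2 \<in> Em p \<and> v = (\<lambda>c. a *\<^sub>R Y p c + v1 c + v2 c))"

definition smooth_anosov_splitting ::
  "('a, 'e::real_normed_vector) manifold \<Rightarrow> ('a, 'e) field \<Rightarrow> ('a \<Rightarrow> ('a, 'e) tangent set)
     \<Rightarrow> ('a \<Rightarrow> ('a, 'e) tangent set) \<Rightarrow> bool" where
  "smooth_anosov_splitting N Y Ep Em \<longleftrightarrow>
     smooth_subbundle N Ep \<and> smooth_subbundle N Em \<and> splitting N Y Ep Em \<and>
     (\<exists>\<Psi>. flow_maps N Y \<Psi> \<and>
        (\<forall>t. \<forall>p\<in>points N.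
           tangent_map N N (\<Psi> t) p ` Ep p = Ep (\<Psi> t p) \<and>
           tangent_map N N (\<Psi> t) p ` Em p = Em (\<Psi> t p)) \<and>
        (\<exists>g C r. riemannian_metric N g \<and> C > 0 \<and> r > 0 \<and>
           (\<forall>p\<in>points N. \<forall>t\<ge>0.
              (\<forall>v\<in>Ep p. let w = tangent_map N N (\<Psi> t) p v in
                 sqrt (g (\<Psi> t p) w w) \<le> C * exp (- r * t) * sqrt (g p v v)) \<and>
              (\<forall>v\<in>Em p. let w = tangent_map N N (\<Psi> (- t)) p v in
                 sqrt (g (\<Psi> (- t) p) w w) \<le> C * exp (- r * t) * sqrt (g p v v)))))"

text \<open>
  The linear functional with value \<open>1\<close> at \<open>Y p\<close> that vanishes on \<open>Ep p\<close> and \<open>Em p\<close> picks out the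
  coefficient of \<open>Y p\<close> in the splitting.
\<close>

definition canonical_form ::
  "('a, 'e::real_normed_vector) field \<Rightarrow> ('a \<Rightarrow> ('a, 'e) tangent set)
     \<Rightarrow> ('a \<Rightarrow> ('a, 'e) tangent set) \<Rightarrow> ('a, 'e) form" where
  "canonical_form Y Ep Em =
     (\<lambda>p v. THE a. \<exists>v1\<in>Ep p. \<exists>v2\<in>Em p. v = (\<lambda>c. a *\<^sub>R Y p c + v1 c + v2 c))"


section \<open>Suspensions and products with the circle\<close>

text \<open>Vector field with the same components \<open>k\<close> in all charts:\<close>

definition const_field :: "('a, 'e::real_normed_vector) manifold \<Rightarrow> 'e \<Rightarrow> ('a, 'e) field" where
  "const_field N k = (\<lambda>p c. if chart_around N c p then k else 0)"

text \<open>
  The form \<open>dt\<close> on a manifold modelled on \<open>'m \<times> real\<close> in whose charts the last coordinate is \<open>t\<close> up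
  to locally constant summands.
\<close>

definition dt_form :: "('a, 'm::real_normed_vector \<times> real) manifold \<Rightarrow> ('a, 'm \<times> real) form" where
  "dt_form N = (\<lambda>p v. snd (v (chart_at N p)))"

definition susp_space :: "('b, 'm) manifold \<Rightarrow> ('b \<times> real) set" where
  "susp_space M = points M \<times> {0..1}"

text \<open>The equivalence relation on \<open>M \<times> [0,1]\<close> generated by \<open>(y,1) \<sim> (\<Phi> y,0)\<close>, for injective \<open>\<Phi>\<close>:\<close>

definition susp_rel :: "('b, 'm) manifold \<Rightarrow> ('b \<Rightarrow> 'b) \<Rightarrow> (('b \<times> real) \<times> ('b \<times> real)) set" where
  "susp_rel M \<Phi> =
     {((y, s), (z, t)) \<in> susp_space M \<times> susp_space M.
        (y, s) = (z, t) \<or> (s = 1 \<and> t = 0 \<and> z = \<Phi> y) \<or> (s = 0 \<and> t = 1 \<and> y = \<Phi> z)}"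

definition susp_proj :: "('b, 'm) manifold \<Rightarrow> ('b \<Rightarrow> 'b) \<Rightarrow> 'b \<times> real \<Rightarrow> ('b \<times> real) set" where
  "susp_proj M \<Phi> x = susp_rel M \<Phi> `` {x}"

text \<open>
  Each chart \<open>c\<close> of \<open>M\<close> gives two charts of the suspension.  The first one is \<open>(y,t) \<mapsto> (c y, t)\<close> for
  \<open>0 < t < 1\<close>.  The second one covers the seam: it is \<open>(y,t) \<mapsto> (c y, t)\<close> for \<open>0 \<le> t < 1/2\<close> and
  \<open>(y,t) \<mapsto> (c (\<Phi> y), t - 1)\<close> for \<open>1/2 < t \<le> 1\<close>, which agree on identified points.  Points of the
  suspension are equivalence classes, on each of which the coordinate functions are constant.
\<close>

definition susp_chart_inner ::
  "('b, 'm) manifold \<Rightarrow> ('b \<Rightarrow> 'b) \<Rightarrow> ('b, 'm) chart \<Rightarrow> (('b \<times> real) set, 'm \<times> real) chart" where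
  "susp_chart_inner M \<Phi> c =
     (susp_proj M \<Phi> ` (cdom c \<times> {0<..<1}),
      \<lambda>z. the_elem ((\<lambda>(y, t). (cmap c y, t)) ` z))"

definition susp_chart_seam ::
  "('b, 'm) manifold \<Rightarrow> ('b \<Rightarrow> 'b) \<Rightarrow> ('b, 'm) chart \<Rightarrow> (('b \<times> real) set, 'm \<times> real) chart" where
  "susp_chart_seam M \<Phi> c =
     (susp_proj M \<Phi> ` (cdom c \<times> {0..<1/2} \<union> {y \<in> points M. \<Phi> y \<in> cdom c} \<times> {1/2<..1}),
      \<lambda>z. the_elem ((\<lambda>(y, t). if t < 1/2 then (cmap c y, t) else (cmap c (\<Phi> y), t - 1)) ` z))"

definition suspension ::
  "('b, 'm) manifold \<Rightarrow> ('b \<Rightarrow> 'b) \<Rightarrow> (('b \<times> real) set, 'm \<times> real) manifold" where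
  "suspension M \<Phi> =
     \<lparr>mtop = quotient_topology
               (subtopology (prod_topology (mtop M) euclideanreal) (susp_space M)) (susp_proj M \<Phi>),
      atlas = susp_chart_inner M \<Phi> ` atlas M \<union> susp_chart_seam M \<Phi> ` atlas M\<rparr>"

text \<open>
  In the coordinate patch \<open>M \<times> [0,1)\<close> the coordinates \<open>(c y, t)\<close> are those of the inner chart for
  \<open>t > 0\<close> and of the seam chart for small \<open>t \<ge> 0\<close>; all changes of charts preserve \<open>(0,1)\<close> and \<open>dt\<close>.
\<close>

definition suspension_field ::
  "('b, 'm::real_normed_vector) manifold \<Rightarrow> ('b \<Rightarrow> 'b) \<Rightarrow> (('b \<times> real) set, 'm \<times> real) field" where
  "suspension_field M \<Phi> = const_field (suspension M \<Phi>) (0, 1)"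

text \<open>The circle \<open>\<real>/\<int>\<close>, with the local inverses of the projection from \<open>\<real>\<close> as charts:\<close>

definition circle_proj :: "real \<Rightarrow> real set" where
  "circle_proj s = {t. t - s \<in> \<int>}"

definition circle :: "(real set, real) manifold" where
  "circle =
     \<lparr>mtop = quotient_topology euclideanreal circle_proj,
      atlas = {(circle_proj ` {a<..<a + 1}, \<lambda>z. the_elem (z \<inter> {a<..<a + 1})) |a. True}\<rparr>"

definition prod_field ::
  "('a, 'e::real_normed_vector) manifold \<Rightarrow> ('b, 'f::real_normed_vector) manifold
     \<Rightarrow> ('a, 'e) field \<Rightarrow> ('b, 'f) field \<Rightarrow> ('a \<times> 'b, 'e \<times> 'f) field" where
  "prod_field M N X Z =
     (\<lambda>(p, q). let c = chart_at M p; d = chart_at N q in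
        tangent_of (prod_manifold M N) (prod_chart c d) (p, q) (X p c, Z q d))"

end

theory Submission
  imports Defs
begin

text \<open>
  In all five cases \<open>L\<^sub>Y \<theta> = 0\<close>, so that \<open>L = 0\<close> serves as primitive.  For \<open>\<theta> = g \<cdot> Y\<close> one has
  \<open>L\<^sub>Y \<theta> = (L\<^sub>Y g)(Y, \<cdot>)\<close>, which settles the isometric case; in the geodesible case the geodesic
  equation, applied to a trajectory through each point, together with the derivative of
  \<open>g(Y, Y) = 1\<close> gives the same conclusion.  For an Anosov splitting, \<open>L\<^sub>Y \<theta>\<close> vanishes on \<open>Y\<close> because
  \<open>\<theta>(Y) = 1\<close>, and on \<open>E\<^sup>+\<close> and \<open>E\<^sup>-\<close> because the flow preserves these bundles, which \<open>\<theta>\<close> annihilates;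
  smoothness of \<open>\<theta>\<close> follows by projecting \<open>Y\<close> orthogonally, in a chart, off the span of a local frame
  of \<open>E\<^sup>+ \<oplus> E\<^sup>-\<close>.  On suspensions and products with the circle the changes of charts preserve \<open>dt\<close>, and
  \<open>dt(Y) = 1\<close>.
\<close>

section \<open>Calculus of smooth functions\<close>

text \<open>The geodesible hypothesis says nothing about \<open>Y\<close> at a point until a
  trajectory through that point exists. Local solvability of smooth differential equations is
  therefore part of the argument; it comes from a contraction on bounded continuous curves.
  Smoothness is defined through derivatives in fixed directions, and forms and metrics are smooth
  for fixed vectors. Every expression with a moving vector is therefore expanded in a basis, which
  is why \<open>N\<close> is modelled on a Euclidean space. The base \<open>M\<close> of a
  suspension or product may have dimension zero, which that class excludes; there the changes of
  charts split into a map on \<open>M\<close> and a translation of time, and such products of maps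
  can be differentiated factor by factor without a basis. The suspension is the image of two maps
  with complementary virtues. The map \<open>proj\<close> from the closed cylinder is closed, which
  together with compactness yields the Hausdorff property, but it is not open at the seam. The map
  \<open>wrap\<close> from the open strip is open and injective on short time intervals, which
  yields the charts and a countable base.\<close>

abbreviation fderiv ::
  "('a::real_normed_vector \<Rightarrow> 'b::real_normed_vector) \<Rightarrow> 'a \<Rightarrow> 'a \<Rightarrow> 'b" where
  "fderiv f x \<equiv> frechet_derivative f (at x)"

lemma has_frechet_derivative:
  "f differentiable (at x) \<Longrightarrow> (f has_derivative fderiv f x) (at x)"
  by (simp add: frechet_derivative_works)

lemma frechet_derivative_eqI:
  "(f has_derivative D) (at x) \<Longrightarrow> fderiv f x = D"
  by (rule frechet_derivative_at[symmetric])

text \<open>\<open>frechet_derivative\<close> is a choice among all derivatives. Functions that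
  agree near \<open>x\<close> have the same derivatives there, so the choices coincide even if no
  derivative exists.\<close>

lemma frechet_derivative_cong_open:
  assumes "open S" "x \<in> S" "\<And>y. y \<in> S \<Longrightarrow> f y = g y"
  shows "fderiv f x = fderiv g x"
proof -
  have "(f has_derivative D) (at x) \<longleftrightarrow> (g has_derivative D) (at x)" for D
    using has_derivative_transform_within_open assms by metis
  then show ?thesis by (simp add: frechet_derivative_def)
qed

lemma differentiable_cong_open:
  assumes "open S" "x \<in> S" "\<And>y. y \<in> S \<Longrightarrow> f y = g y" "f differentiable (at x)"
  shows "g differentiable (at x)"
  using has_derivative_transform_within_open assms unfolding differentiable_def by metis

lemma k_times_diff_on_cong:
  assumes "open S"
  shows "(\<And>y. y \<in> S \<Longrightarrow> f y = g y) \<Longrightarrow> k_times_diff_on k S f \<Longrightarrow> k_times_diff_on k S g"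
proof (induction k arbitrary: f g)
  case 0
  then show ?case by (metis continuous_on_cong k_times_diff_on.simps(1))
next
  case (Suc k)
  have "k_times_diff_on k S (\<lambda>x. fderiv g x v)" for v
  proof (rule Suc.IH)
    show "fderiv f y v = fderiv g y v" if "y \<in> S" for y
      using frechet_derivative_cong_open[OF assms that Suc.prems(1)] by simp
  qed (use Suc.prems in auto)
  then show ?case
    using Suc.prems differentiable_cong_open[OF assms] by (metis k_times_diff_on.simps(2))
qed

lemma smooth_on_cong:
  assumes "open S" "\<And>y. y \<in> S \<Longrightarrow> f y = g y" "smooth_on S f"
  shows "smooth_on S g"
  using assms k_times_diff_on_cong unfolding smooth_on_def by blast

lemma k_times_diff_on_subset:
  "T \<subseteq> S \<Longrightarrow> k_times_diff_on k S f \<Longrightarrow> k_times_diff_on k T f"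
  by (induction k arbitrary: f) (auto intro: continuous_on_subset)

lemma smooth_on_subset: "T \<subseteq> S \<Longrightarrow> smooth_on S f \<Longrightarrow> smooth_on T f"
  unfolding smooth_on_def using k_times_diff_on_subset by blast

lemma k_times_diff_on_local:
  assumes "\<And>x. x \<in> S \<Longrightarrow> \<exists>U. open U \<and> x \<in> U \<and> k_times_diff_on k U f"
  shows "k_times_diff_on k S f"
  using assms
proof (induction k arbitrary: f)
  case 0
  show ?case
    by (simp add: continuous_on_eq_continuous_within)
      (metis 0 continuous_at_imp_continuous_at_within continuous_on_eq_continuous_at
        k_times_diff_on.simps(1))
next
  case (Suc k)
  show ?case
  proof (simp, intro conjI ballI allI)
    show "f differentiable (at x)" if "x \<in> S" for x
      using Suc.prems[OF that] by auto
    show "k_times_diff_on k S (\<lambda>x. fderiv f x v)" for v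
      by (rule Suc.IH) (metis Suc.prems k_times_diff_on.simps(2))
  qed
qed

lemma smooth_on_local:
  assumes "\<And>x. x \<in> S \<Longrightarrow> \<exists>U. open U \<and> x \<in> U \<and> smooth_on U f"
  shows "smooth_on S f"
  unfolding smooth_on_def
  by (intro allI k_times_diff_on_local) (metis assms smooth_on_def)

text \<open>The recursive clause passes from \<open>f\<close> to its directional derivatives, so
  lowering the order is an induction of its own; at the bottom it is the continuity of
  differentiable functions.\<close>

lemma k_times_diff_on_SucD: "k_times_diff_on (Suc k) S f \<Longrightarrow> k_times_diff_on k S f"
proof (induction k arbitrary: f)
  case 0
  then show ?case
    by (simp add: continuous_at_imp_continuous_on differentiable_imp_continuous_within)
next
  case (Suc k)
  then show ?case by (metis k_times_diff_on.simps(2))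
qed

lemma k_times_diff_on_const: "k_times_diff_on k S (\<lambda>x. c)"
  by (induction k arbitrary: c) auto

lemma k_times_diff_on_add:
  assumes "open S"
  shows "k_times_diff_on k S f \<Longrightarrow> k_times_diff_on k S g \<Longrightarrow> k_times_diff_on k S (\<lambda>x. f x + g x)"
proof (induction k arbitrary: f g)
  case 0
  then show ?case by (simp add: continuous_on_add)
next
  case (Suc k)
  have D: "((\<lambda>x. f x + g x) has_derivative
      (\<lambda>v. fderiv f x v + fderiv g x v)) (at x)"
    if "x \<in> S" for x
    using Suc.prems that by (intro has_derivative_add has_frechet_derivative) auto
  have "k_times_diff_on k S (\<lambda>x. fderiv (\<lambda>x. f x + g x) x v)" for v
    by (rule k_times_diff_on_cong[OF assms _ Suc.IH[of "\<lambda>x. fderiv f x v" "\<lambda>x. fderiv g x v"]])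
      (use Suc.prems frechet_derivative_eqI[OF D] in auto)
  then show ?case using D by (auto simp: differentiable_def)
qed

text \<open>The product rule yields two terms of the same shape, each with one factor
  differentiated. The other factor is lowered from class \<open>Suc k\<close> to class
  \<open>k\<close>, so the induction hypothesis covers both terms.\<close>

lemma k_times_diff_on_bilinear:
  assumes "bounded_bilinear B" "open S"
  shows "k_times_diff_on k S f \<Longrightarrow> k_times_diff_on k S g \<Longrightarrow> k_times_diff_on k S (\<lambda>x. B (f x) (g x))"
proof (induction k arbitrary: f g)
  case 0
  then show ?case using bounded_bilinear.continuous_on[OF assms(1)] by auto
next
  case (Suc k)
  have D: "((\<lambda>x. B (f x) (g x)) has_derivative
      (\<lambda>v. B (f x) (fderiv g x v) + B (fderiv f x v) (g x))) (at x)"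
    if "x \<in> S" for x
    using Suc.prems that
    by (intro bounded_bilinear.FDERIV[OF assms(1)] has_frechet_derivative) auto
  have "k_times_diff_on k S (\<lambda>x. fderiv (\<lambda>x. B (f x) (g x)) x v)" for v
  proof (rule k_times_diff_on_cong[OF assms(2)])
    show "k_times_diff_on k S (\<lambda>x. B (f x) (fderiv g x v)
        + B (fderiv f x v) (g x))"
      using Suc.prems k_times_diff_on_SucD[OF Suc.prems(1)] k_times_diff_on_SucD[OF Suc.prems(2)]
      by (intro k_times_diff_on_add[OF assms(2)] Suc.IH) simp_all
  qed (simp add: frechet_derivative_eqI[OF D])
  then show ?case using D by (auto simp: differentiable_def)
qed

lemma k_times_diff_on_sum:
  assumes "open S" "\<And>i. i \<in> I \<Longrightarrow> k_times_diff_on k S (f i)"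
  shows "k_times_diff_on k S (\<lambda>x. \<Sum>i\<in>I. f i x)"
  using assms(2)
  by (induction I rule: infinite_finite_induct)
    (simp_all add: k_times_diff_on_const k_times_diff_on_add assms(1))

text \<open>The chain rule evaluates the derivative of \<open>f\<close> on a vector that moves with
  \<open>x\<close>, while the induction hypothesis covers fixed directions. Expanding the moving
  vector in the basis of the intermediate space gives fixed directions with coefficients of class
  \<open>k\<close>.\<close>

lemma k_times_diff_on_compose:
  fixes g :: "'a::real_normed_vector \<Rightarrow> 'e::euclidean_space"
  assumes "open S" "open T" "g ` S \<subseteq> T"
  shows "k_times_diff_on k S g \<Longrightarrow> k_times_diff_on k T f \<Longrightarrow> k_times_diff_on k S (\<lambda>x. f (g x))"
proof (induction k arbitrary: f)
  case 0
  then show ?case using continuous_on_compose2[OF _ _ assms(3)] by simp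
next
  case (Suc k)
  have D: "((\<lambda>x. f (g x)) has_derivative
      (\<lambda>v. fderiv f (g x) (fderiv g x v))) (at x)"
    if "x \<in> S" for x
    using Suc.prems that assms(3)
    by (intro has_derivative_compose[of g _ x UNIV f] has_frechet_derivative) auto
  have lin: "linear (fderiv f (g x))" if "x \<in> S" for x
    using Suc.prems(2) assms(3) that linear_frechet_derivative[of f "at (g x)"]
    by (simp add: image_subset_iff)
  have "k_times_diff_on k S (\<lambda>x. fderiv (\<lambda>x. f (g x)) x v)" for v
  proof (rule k_times_diff_on_cong[OF assms(1)])
    have *: "k_times_diff_on k S (\<lambda>x. fderiv f (g x) b)" for b
      using Suc.IH[of "\<lambda>y. fderiv f y b"] Suc.prems k_times_diff_on_SucD by auto
    show "k_times_diff_on k S (\<lambda>x. \<Sum>b\<in>Basis. (fderiv g x v \<bullet> b) *\<^sub>R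
        fderiv f (g x) b)"
      using Suc.prems *
      by (intro k_times_diff_on_sum k_times_diff_on_bilinear[OF bounded_bilinear_scaleR] assms
          k_times_diff_on_bilinear[OF bounded_bilinear_inner] k_times_diff_on_const) auto
    show "(\<Sum>b\<in>Basis. (fderiv g x v \<bullet> b) *\<^sub>R fderiv f (g x) b)
        = fderiv (\<lambda>x. f (g x)) x v" if "x \<in> S" for x
    proof -
      have "fderiv (\<lambda>x. f (g x)) x v =
          fderiv f (g x) (\<Sum>b\<in>Basis. (fderiv g x v \<bullet> b) *\<^sub>R b)"
        by (simp add: frechet_derivative_eqI[OF D[OF that]] euclidean_representation)
      then show ?thesis
        by (simp add: linear_sum[OF lin[OF that]] linear_scale[OF lin[OF that]])
    qed
  qed
  then show ?case using D by (auto simp: differentiable_def)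
qed

lemma k_times_diff_on_inverse:
  fixes f :: "'a::real_normed_vector \<Rightarrow> real"
  assumes "open S" "\<And>x. x \<in> S \<Longrightarrow> f x \<noteq> 0"
  shows "k_times_diff_on k S f \<Longrightarrow> k_times_diff_on k S (\<lambda>x. inverse (f x))"
proof (induction k)
  case 0
  then show ?case using assms by (simp add: continuous_on_inverse)
next
  case (Suc k)
  have D: "((\<lambda>x. inverse (f x)) has_derivative
      (\<lambda>v. (- 1) * (inverse (f x) * fderiv f x v * inverse (f x)))) (at x)"
    if "x \<in> S" for x
    using Deriv.has_derivative_inverse[of f x, OF assms(2)[OF that] has_frechet_derivative]
      Suc.prems that by auto
  have "k_times_diff_on k S (\<lambda>x. fderiv (\<lambda>x. inverse (f x)) x v)" for v
  proof (rule k_times_diff_on_cong[OF assms(1)])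
    show "k_times_diff_on k S
        (\<lambda>x. (- 1) * (inverse (f x) * fderiv f x v * inverse (f x)))"
      using Suc.prems Suc.IH[OF k_times_diff_on_SucD[OF Suc.prems]]
      by (intro k_times_diff_on_bilinear[OF bounded_bilinear_mult] assms(1) k_times_diff_on_const)
        simp_all
  qed (simp add: frechet_derivative_eqI[OF D])
  then show ?case using D by (auto simp: differentiable_def)
qed

lemma smooth_on_const: "smooth_on S (\<lambda>x. c)"
  unfolding smooth_on_def by (simp add: k_times_diff_on_const)

lemma smooth_on_bilinear:
  "bounded_bilinear B \<Longrightarrow> open S \<Longrightarrow> smooth_on S f \<Longrightarrow> smooth_on S g \<Longrightarrow>
    smooth_on S (\<lambda>x. B (f x) (g x))"
  unfolding smooth_on_def by (simp add: k_times_diff_on_bilinear)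

lemma smooth_on_add:
  "open S \<Longrightarrow> smooth_on S f \<Longrightarrow> smooth_on S g \<Longrightarrow> smooth_on S (\<lambda>x. f x + g x)"
  unfolding smooth_on_def by (simp add: k_times_diff_on_add)

lemma smooth_on_diff:
  "open S \<Longrightarrow> smooth_on S f \<Longrightarrow> smooth_on S g \<Longrightarrow> smooth_on S (\<lambda>x. f x - g x)"
  using smooth_on_add[of S f "\<lambda>x. (- 1) *\<^sub>R g x"]
    smooth_on_bilinear[OF bounded_bilinear_scaleR _ smooth_on_const, of S g "- 1"] by simp

lemma smooth_on_sum:
  "open S \<Longrightarrow> (\<And>i. i \<in> I \<Longrightarrow> smooth_on S (f i)) \<Longrightarrow> smooth_on S (\<lambda>x. \<Sum>i\<in>I. f i x)"
  unfolding smooth_on_def by (simp add: k_times_diff_on_sum)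

lemmas smooth_on_scaleR = smooth_on_bilinear[OF bounded_bilinear_scaleR]
lemmas smooth_on_mult = smooth_on_bilinear[OF bounded_bilinear_mult]
lemmas smooth_on_inner = smooth_on_bilinear[OF bounded_bilinear_inner]

lemma smooth_on_compose:
  fixes g :: "'a::real_normed_vector \<Rightarrow> 'e::euclidean_space"
  shows "open S \<Longrightarrow> open T \<Longrightarrow> g ` S \<subseteq> T \<Longrightarrow> smooth_on S g \<Longrightarrow> smooth_on T f \<Longrightarrow>
    smooth_on S (\<lambda>x. f (g x))"
  unfolding smooth_on_def by (simp add: k_times_diff_on_compose)

lemma smooth_on_inverse:
  fixes f :: "'a::real_normed_vector \<Rightarrow> real"
  shows "open S \<Longrightarrow> (\<And>x. x \<in> S \<Longrightarrow> f x \<noteq> 0) \<Longrightarrow> smooth_on S f \<Longrightarrow> smooth_on S (\<lambda>x. inverse (f x))"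
  unfolding smooth_on_def by (simp add: k_times_diff_on_inverse)

lemma smooth_on_ident: "smooth_on S (\<lambda>x. x)"
proof -
  have "k_times_diff_on k S (\<lambda>x. x)" for k
    by (cases k) (auto simp: k_times_diff_on_const)
  then show ?thesis by (simp add: smooth_on_def)
qed

lemma smooth_on_differentiable: "smooth_on S f \<Longrightarrow> x \<in> S \<Longrightarrow> f differentiable (at x)"
  by (metis k_times_diff_on.simps(2) smooth_on_def)

lemma smooth_on_imp_continuous_on: "smooth_on S f \<Longrightarrow> continuous_on S f"
  by (metis k_times_diff_on.simps(1) smooth_on_def)

lemma smooth_on_has_derivative:
  "smooth_on S f \<Longrightarrow> x \<in> S \<Longrightarrow> (f has_derivative fderiv f x) (at x)"
  by (simp add: has_frechet_derivative smooth_on_differentiable)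

lemma smooth_on_linear_derivative:
  "smooth_on S f \<Longrightarrow> x \<in> S \<Longrightarrow> linear (fderiv f x)"
  using has_derivative_linear smooth_on_has_derivative by blast

lemma smooth_on_frechet_derivative:
  "smooth_on S f \<Longrightarrow> smooth_on S (\<lambda>x. fderiv f x v)"
  by (metis k_times_diff_on.simps(2) smooth_on_def)

section \<open>Linear maps depending smoothly on a parameter\<close>

lemma linear_euclidean_expand:
  fixes v :: "'e::euclidean_space"
  assumes "linear f"
  shows "f v = (\<Sum>b\<in>Basis. (v \<bullet> b) *\<^sub>R f b)"
proof -
  have "f v = f (\<Sum>b\<in>Basis. (v \<bullet> b) *\<^sub>R b)"
    by (simp add: euclidean_representation)
  then show ?thesis
    by (simp add: linear_sum[OF assms] linear_scale[OF assms])
qed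

text \<open>Coordinate expressions of forms and metrics are smooth for each constant vector by
  definition; the basis expansion extends this to a smoothly moving vector.\<close>

lemma smooth_on_linear_apply:
  fixes w :: "'a::real_normed_vector \<Rightarrow> 'e::euclidean_space"
  assumes "open S" "\<And>x. x \<in> S \<Longrightarrow> linear (A x)" "\<And>v. smooth_on S (\<lambda>x. A x v)" "smooth_on S w"
  shows "smooth_on S (\<lambda>x. A x (w x))"
proof (rule smooth_on_cong[OF assms(1)])
  show "smooth_on S (\<lambda>x. \<Sum>b\<in>Basis. (w x \<bullet> b) *\<^sub>R A x b)"
    by (intro smooth_on_sum smooth_on_scaleR smooth_on_inner smooth_on_const assms)
qed (simp add: linear_euclidean_expand[OF assms(2), symmetric])

lemma fderiv_linear_apply:
  fixes v :: "'e::euclidean_space"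
  assumes "open S" "x \<in> S" "\<And>x. x \<in> S \<Longrightarrow> linear (A x)" "\<And>v. smooth_on S (\<lambda>x. A x v)"
  shows "fderiv (\<lambda>y. A y v) x = (\<lambda>u. \<Sum>b\<in>Basis. (v \<bullet> b) *\<^sub>R fderiv (\<lambda>y. A y b) x u)"
proof (rule frechet_derivative_eqI, rule has_derivative_transform_within_open[OF _ assms(1,2)])
  show "((\<lambda>y. \<Sum>b\<in>Basis. (v \<bullet> b) *\<^sub>R A y b) has_derivative
      (\<lambda>u. \<Sum>b\<in>Basis. (v \<bullet> b) *\<^sub>R fderiv (\<lambda>y. A y b) x u)) (at x)"
    by (intro has_derivative_sum bounded_linear.has_derivative[OF bounded_linear_scaleR_right]
        smooth_on_has_derivative[OF assms(4,2)])
qed (simp add: linear_euclidean_expand[OF assms(3), symmetric])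

lemma linear_fderiv_parameter:
  fixes A :: "'a::real_normed_vector \<Rightarrow> 'e::euclidean_space \<Rightarrow> 'b::real_normed_vector"
  assumes "open S" "x \<in> S" "\<And>x. x \<in> S \<Longrightarrow> linear (A x)" "\<And>v. smooth_on S (\<lambda>x. A x v)"
  shows "linear (\<lambda>v. fderiv (\<lambda>y. A y v) x u)"
  by (subst fderiv_linear_apply[OF assms])
    (auto intro!: linear_compose_sum linearI simp: inner_add_left scaleR_add_left)

text \<open>The product rule for the pairing of \<open>A\<close> with \<open>w\<close>: one term
  freezes the vector at \<open>w x\<close>, the other freezes the map at \<open>A x\<close>. The
  coordinate computations in the isometric, geodesible and Anosov cases rest on it.\<close>

lemma has_derivative_linear_apply:
  fixes w :: "'a::real_normed_vector \<Rightarrow> 'e::euclidean_space"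
  assumes "open S" "x \<in> S" "\<And>x. x \<in> S \<Longrightarrow> linear (A x)" "\<And>v. smooth_on S (\<lambda>x. A x v)"
    "(w has_derivative w') (at x)"
  shows "((\<lambda>x. A x (w x)) has_derivative (\<lambda>v. fderiv (\<lambda>y. A y (w x)) x v + A x (w' v))) (at x)"
proof -
  have "((\<lambda>y. \<Sum>b\<in>Basis. (w y \<bullet> b) *\<^sub>R A y b) has_derivative
      (\<lambda>v. \<Sum>b\<in>Basis. (w x \<bullet> b) *\<^sub>R fderiv (\<lambda>y. A y b) x v + (w' v \<bullet> b) *\<^sub>R A x b))
      (at x)"
    by (intro has_derivative_sum has_derivative_scaleR has_derivative_inner_left assms
        smooth_on_has_derivative[OF assms(4,2)])
  then have "((\<lambda>x. A x (w x)) has_derivative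
      (\<lambda>v. \<Sum>b\<in>Basis. (w x \<bullet> b) *\<^sub>R fderiv (\<lambda>y. A y b) x v + (w' v \<bullet> b) *\<^sub>R A x b))
      (at x)"
  proof (rule has_derivative_transform_within_open[OF _ assms(1,2)])
    show "(\<Sum>b\<in>Basis. (w y \<bullet> b) *\<^sub>R A y b) = A y (w y)" if "y \<in> S" for y
      by (rule linear_euclidean_expand[OF assms(3)[OF that], symmetric])
  qed
  moreover have D: "fderiv (\<lambda>y. A y (w x)) x = (\<lambda>u. \<Sum>b\<in>Basis. (w x \<bullet> b) *\<^sub>R fderiv (\<lambda>y. A y b) x u)"
    by (rule fderiv_linear_apply[OF assms(1-4)])
  have "(\<Sum>b\<in>Basis. (w x \<bullet> b) *\<^sub>R fderiv (\<lambda>y. A y b) x v + (w' v \<bullet> b) *\<^sub>R A x b)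
      = fderiv (\<lambda>y. A y (w x)) x v + A x (w' v)" for v
    unfolding sum.distrib D
    by (subst linear_euclidean_expand[OF assms(3)[OF assms(2)], of "w' v"]) (rule refl)
  ultimately show ?thesis by simp
qed

text \<open>Independence of a frame is expressed below by
  \<open>b i x \<notin> span (frame b i x)\<close>: each vector avoids the span of its predecessors.
  This form passes to initial segments, as an induction on the number of vectors requires, and it
  includes distinctness of the vectors.\<close>

abbreviation frame :: "(nat \<Rightarrow> 'a \<Rightarrow> 'b) \<Rightarrow> nat \<Rightarrow> 'a \<Rightarrow> 'b set" where
  "frame b n x \<equiv> (\<lambda>i. b i x) ` {..<n}"

text \<open>The Gram--Schmidt process, carried out smoothly in the parameter \<open>x\<close>.\<close>

lemma smooth_orthogonal_component:
  fixes b :: "nat \<Rightarrow> 'a::real_normed_vector \<Rightarrow> 'e::euclidean_space"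
  assumes "open S" "\<And>i. i < n \<Longrightarrow> smooth_on S (b i)"
    "\<And>i x. i < n \<Longrightarrow> x \<in> S \<Longrightarrow> b i x \<notin> span (frame b i x)"
    "smooth_on S z"
  shows "\<exists>w. smooth_on S w \<and>
    (\<forall>x\<in>S. (\<forall>i<n. w x \<bullet> b i x = 0) \<and> z x - w x \<in> span (frame b n x))"
  using assms(2-4)
proof (induction n arbitrary: z)
  case 0
  then show ?case by (auto intro!: exI[of _ z])
next
  case (Suc n)
  obtain w where w: "smooth_on S w" "\<And>x i. x \<in> S \<Longrightarrow> i < n \<Longrightarrow> w x \<bullet> b i x = 0"
    "\<And>x. x \<in> S \<Longrightarrow> z x - w x \<in> span (frame b n x)"
    using Suc.IH[of z] Suc.prems by (metis less_Suc_eq)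
  \<comment> \<open>The induction hypothesis is used a second time, with \<open>b n\<close> in place
    of \<open>z\<close>: \<open>c\<close> is the part of \<open>b n\<close> orthogonal to its
    predecessors.\<close>
  obtain c where c: "smooth_on S c" "\<And>x i. x \<in> S \<Longrightarrow> i < n \<Longrightarrow> c x \<bullet> b i x = 0"
    "\<And>x. x \<in> S \<Longrightarrow> b n x - c x \<in> span (frame b n x)"
    using Suc.IH[of "b n"] Suc.prems by (metis less_Suc_eq)
  \<comment> \<open>If \<open>c x\<close> were zero, \<open>b n x\<close> would lie in the span of
    its predecessors.\<close>
  have c0: "c x \<bullet> c x \<noteq> 0" if "x \<in> S" for x
    using c(3)[OF that] Suc.prems(2)[of n x] that by auto
  define w' where "w' x = w x - ((w x \<bullet> c x) * inverse (c x \<bullet> c x)) *\<^sub>R c x" for x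
  have "smooth_on S w'"
    unfolding w'_def
    by (intro smooth_on_diff smooth_on_scaleR smooth_on_mult smooth_on_inverse smooth_on_inner
        assms(1) w c c0)
  moreover have "w' x \<bullet> b i x = 0" if "x \<in> S" "i < Suc n" for x i
  proof (cases "i < n")
    case True
    then show ?thesis using w c that by (simp add: w'_def inner_diff_left)
  next
    case False
    then have [simp]: "i = n" using that by simp
    \<comment> \<open>Orthogonality to \<open>b n\<close> splits into orthogonality to
      \<open>c\<close> and to the span of the predecessors, which contains
      \<open>b n x - c x\<close>.\<close>
    have "w' x \<bullet> y = 0" if "y \<in> span (frame b n x)" for y
      using that
    proof (induction rule: span_induct_alt)
      case (step r y z)
      then show ?case using w c \<open>x \<in> S\<close> by (auto simp: w'_def inner_diff_left inner_add_right)
    qed simp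
    then have "w' x \<bullet> (b n x - c x) = 0" using c that by blast
    moreover have "w' x \<bullet> c x = 0" using c0[OF that(1)] by (simp add: w'_def inner_diff_left)
    ultimately show ?thesis by (simp add: inner_diff_right)
  qed
  moreover have "z x - w' x \<in> span (frame b (Suc n) x)" if "x \<in> S" for x
  proof -
    have sub: "span (frame b n x) \<subseteq> span (frame b (Suc n) x)"
      by (intro span_mono) auto
    have "b n x \<in> span (frame b (Suc n) x)" by (intro span_base) auto
    then have "c x \<in> span (frame b (Suc n) x)"
      using c(3)[OF that] sub span_diff[of "b n x" _ "b n x - c x"] by auto
    then have "(z x - w x) + ((w x \<bullet> c x) * inverse (c x \<bullet> c x)) *\<^sub>R c x
        \<in> span (frame b (Suc n) x)"
      using w(3)[OF that] sub by (intro span_add span_scale) auto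
    then show ?thesis by (simp add: w'_def algebra_simps)
  qed
  ultimately show ?case by blast
qed

text \<open>A directional derivative of \<open>map_prod f g\<close> is again a
  \<open>map_prod\<close> of directional derivatives of the factors, so the induction closes without
  any basis and holds in arbitrary normed spaces.\<close>

lemma smooth_on_map_prod:
  assumes "open S" "open T" "smooth_on S f" "smooth_on T g"
  shows "smooth_on (S \<times> T) (map_prod f g)"
proof -
  have "k_times_diff_on k (S \<times> T) (map_prod f g)"
    if "k_times_diff_on k S f" "k_times_diff_on k T g" for k
    using that
  proof (induction k arbitrary: f g)
    case 0
    then show ?case
      by (auto simp: map_prod_def split_def
          intro!: continuous_on_Pair continuous_on_compose2[OF _ continuous_on_fst]
            continuous_on_compose2[OF _ continuous_on_snd] continuous_on_id)
  next
    case (Suc k)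
    have D: "(map_prod f g has_derivative
        map_prod (fderiv f (fst p)) (fderiv g (snd p))) (at p)"
      if "p \<in> S \<times> T" for p
    proof -
      have f: "(f has_derivative fderiv f (fst p)) (at (fst p))"
        and g: "(g has_derivative fderiv g (snd p)) (at (snd p))"
        using Suc.prems that by (auto intro!: has_frechet_derivative)
      show ?thesis
        using has_derivative_Pair[OF has_derivative_compose[OF has_derivative_fst[OF has_derivative_ident] f]
            has_derivative_compose[OF has_derivative_snd[OF has_derivative_ident] g]]
        by (simp add: map_prod_def split_def)
    qed
    have "k_times_diff_on k (S \<times> T) (\<lambda>p. fderiv (map_prod f g) p v)" for v
    proof (rule k_times_diff_on_cong[OF open_Times[OF assms(1,2)] _ Suc.IH])
      show "k_times_diff_on k S (\<lambda>x. fderiv f x (fst v))"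
        "k_times_diff_on k T (\<lambda>x. fderiv g x (snd v))"
        using Suc.prems by auto
      show "map_prod (\<lambda>x. fderiv f x (fst v)) (\<lambda>x. fderiv g x (snd v)) p
          = fderiv (map_prod f g) p v" if "p \<in> S \<times> T" for p
        unfolding frechet_derivative_eqI[OF D[OF that]] by (simp add: map_prod_def split_def)
    qed
    then show ?case using D unfolding differentiable_def k_times_diff_on.simps by blast
  qed
  then show ?thesis using assms by (simp add: smooth_on_def)
qed

text \<open>The mean value theorem is applied twice, to the increment in direction \<open>v\<close>
  as a function of the step along \<open>u\<close>, and to the derivative in direction
  \<open>u\<close> as a function of the step along \<open>v\<close>. The second difference on the
  left is symmetric in \<open>u\<close> and \<open>v\<close>, whereas the right side prefers an
  order of differentiation. The bound on \<open>h\<close> keeps the parallelogram inside the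
  ball.\<close>

lemma second_difference_mean_value:
  fixes f :: "'a::real_normed_vector \<Rightarrow> real"
  assumes "\<And>y. y \<in> ball x r \<Longrightarrow> f differentiable (at y)"
    "\<And>y. y \<in> ball x r \<Longrightarrow> (\<lambda>y. fderiv f y u) differentiable (at y)"
    "h > 0" "h * (norm u + norm v) < r"
  shows "\<exists>y\<in>ball x r. f (x + h *\<^sub>R u + h *\<^sub>R v) - f (x + h *\<^sub>R u) - (f (x + h *\<^sub>R v) - f x)
    = h * (h * fderiv (\<lambda>y. fderiv f y u) y v)"
proof -
  let ?D = "\<lambda>y. fderiv f y"
  have inb: "x + s *\<^sub>R u + t *\<^sub>R v \<in> ball x r" if "0 \<le> s" "s \<le> h" "0 \<le> t" "t \<le> h" for s t
  proof -
    have "norm (s *\<^sub>R u + t *\<^sub>R v) \<le> s * norm u + t * norm v"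
      using that norm_triangle_ineq[of "s *\<^sub>R u" "t *\<^sub>R v"] by simp
    also have "\<dots> \<le> h * norm u + h * norm v"
      using that by (intro add_mono mult_right_mono) auto
    also have "\<dots> < r" using assms(4) by (simp add: algebra_simps)
    finally show ?thesis
      by (simp add: dist_norm norm_minus_commute algebra_simps)
  qed
  have "((\<lambda>s. f (x + s *\<^sub>R u + h *\<^sub>R v) - f (x + s *\<^sub>R u)) has_field_derivative
      ?D (x + s *\<^sub>R u + h *\<^sub>R v) u - ?D (x + s *\<^sub>R u) u) (at s)" if "0 \<le> s" "s \<le> h" for s
  proof -
    have 1: "(f has_derivative ?D (x + s *\<^sub>R u + h *\<^sub>R v)) (at (x + s *\<^sub>R u + h *\<^sub>R v))"
      and 2: "(f has_derivative ?D (x + s *\<^sub>R u)) (at (x + s *\<^sub>R u))"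
      using inb[of s h] inb[of s 0] that assms(1,3) by (auto intro!: has_frechet_derivative)
    have "((\<lambda>s. f (x + s *\<^sub>R u + h *\<^sub>R v) - f (x + s *\<^sub>R u)) has_derivative
        (\<lambda>t. ?D (x + s *\<^sub>R u + h *\<^sub>R v) (t *\<^sub>R u) - ?D (x + s *\<^sub>R u) (t *\<^sub>R u))) (at s)"
      by (intro has_derivative_diff
          has_derivative_compose[where f = "\<lambda>s. x + s *\<^sub>R u + h *\<^sub>R v" and f' = "\<lambda>t. t *\<^sub>R u", OF _ 1]
          has_derivative_compose[where f = "\<lambda>s. x + s *\<^sub>R u" and f' = "\<lambda>t. t *\<^sub>R u", OF _ 2])
        (auto intro!: derivative_eq_intros)
    then show ?thesis
      unfolding has_field_derivative_def
      by (rule has_derivative_eq_rhs)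
        (simp add: fun_eq_iff linear_scale[OF has_derivative_linear[OF 1]]
          linear_scale[OF has_derivative_linear[OF 2]] right_diff_distrib mult.commute)
  qed
  then obtain s where s: "0 < s" "s < h"
    "f (x + h *\<^sub>R u + h *\<^sub>R v) - f (x + h *\<^sub>R u) - (f (x + h *\<^sub>R v) - f x)
      = h * (?D (x + s *\<^sub>R u + h *\<^sub>R v) u - ?D (x + s *\<^sub>R u) u)"
    using MVT2[OF assms(3), of "\<lambda>s. f (x + s *\<^sub>R u + h *\<^sub>R v) - f (x + s *\<^sub>R u)"
        "\<lambda>s. ?D (x + s *\<^sub>R u + h *\<^sub>R v) u - ?D (x + s *\<^sub>R u) u"] by auto
  let ?E = "\<lambda>t. fderiv (\<lambda>y. ?D y u) (x + s *\<^sub>R u + t *\<^sub>R v)"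
  have "((\<lambda>t. ?D (x + s *\<^sub>R u + t *\<^sub>R v) u) has_field_derivative ?E t v) (at t)"
    if "0 \<le> t" "t \<le> h" for t
  proof -
    have 1: "((\<lambda>y. ?D y u) has_derivative ?E t) (at (x + s *\<^sub>R u + t *\<^sub>R v))"
      using inb[of s t] that s assms(2) by (auto intro!: has_frechet_derivative)
    have "((\<lambda>t. ?D (x + s *\<^sub>R u + t *\<^sub>R v) u) has_derivative (\<lambda>r. ?E t (r *\<^sub>R v))) (at t)"
      by (rule has_derivative_compose[where f = "\<lambda>t. x + s *\<^sub>R u + t *\<^sub>R v" and f' = "\<lambda>r. r *\<^sub>R v", OF _ 1])
        (auto intro!: derivative_eq_intros)
    then show ?thesis
      unfolding has_field_derivative_def
      by (rule has_derivative_eq_rhs)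
        (simp add: fun_eq_iff linear_scale[OF has_derivative_linear[OF 1]] mult.commute)
  qed
  then obtain t where t: "0 < t" "t < h"
    "?D (x + s *\<^sub>R u + h *\<^sub>R v) u - ?D (x + s *\<^sub>R u) u = h * ?E t v"
    using MVT2[OF assms(3), of "\<lambda>t. ?D (x + s *\<^sub>R u + t *\<^sub>R v) u" "\<lambda>t. ?E t v"] by auto
  show ?thesis
    using s t inb[of s t] by (intro bexI[of _ "x + s *\<^sub>R u + t *\<^sub>R v"]) auto
qed

text \<open>The same second difference equals \<open>h * h\<close> times either mixed derivative,
  each taken at some point near \<open>x\<close>. Continuity of both mixed derivatives brings the
  two points back to \<open>x\<close>.\<close>

lemma second_derivative_symmetric_real:
  fixes f :: "'a::real_normed_vector \<Rightarrow> real"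
  assumes "open S" "smooth_on S f" "x \<in> S"
  shows "fderiv (\<lambda>y. fderiv f y u) x v =
    fderiv (\<lambda>y. fderiv f y v) x u"
proof -
  let ?F = "\<lambda>u v y. fderiv (\<lambda>y. fderiv f y u) y v"
  have cont: "continuous (at x) (?F u v)" for u v
    using smooth_on_imp_continuous_on[OF smooth_on_frechet_derivative[OF
          smooth_on_frechet_derivative[OF assms(2)]]] assms(1,3)
    by (simp add: continuous_on_eq_continuous_at)
  have "\<bar>?F u v x - ?F v u x\<bar> < e" if e: "e > 0" for e
  proof -
    obtain d1 where d1: "d1 > 0" "\<And>y. dist y x < d1 \<Longrightarrow> dist (?F u v y) (?F u v x) < e / 2"
      using cont[of u v, unfolded continuous_at_eps_delta, rule_format, OF half_gt_zero[OF e]]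
      by blast
    obtain d2 where d2: "d2 > 0" "\<And>y. dist y x < d2 \<Longrightarrow> dist (?F v u y) (?F v u x) < e / 2"
      using cont[of v u, unfolded continuous_at_eps_delta, rule_format, OF half_gt_zero[OF e]]
      by blast
    obtain d3 where d3: "d3 > 0" "ball x d3 \<subseteq> S" using assms openE by blast
    define r where "r = min d1 (min d2 d3)"
    \<comment> \<open>The summand 1 keeps the denominator positive when \<open>u\<close> and
      \<open>v\<close> both vanish.\<close>
    define h where "h = r / (norm u + norm v + 1)"
    have r: "r > 0" using d1 d2 d3 by (simp add: r_def)
    have pos: "norm u + norm v + 1 > 0" by (smt (verit) norm_ge_zero)
    have h: "h > 0" "h * (norm u + norm v) < r" "h * (norm v + norm u) < r"
      using r pos by (auto simp: h_def field_simps)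
    have df: "f differentiable (at y)" "(\<lambda>y. fderiv f y w) differentiable (at y)"
      if "y \<in> ball x r" for y w
      using that d3 assms(2) r_def
      by (auto intro!: smooth_on_differentiable smooth_on_frechet_derivative simp: subset_iff)
    obtain y1 where y1: "y1 \<in> ball x r"
      "f (x + h *\<^sub>R u + h *\<^sub>R v) - f (x + h *\<^sub>R u) - (f (x + h *\<^sub>R v) - f x) = h * (h * ?F u v y1)"
      using second_difference_mean_value[OF df h(1,2)] by blast
    obtain y2 where y2: "y2 \<in> ball x r"
      "f (x + h *\<^sub>R v + h *\<^sub>R u) - f (x + h *\<^sub>R v) - (f (x + h *\<^sub>R u) - f x) = h * (h * ?F v u y2)"
      using second_difference_mean_value[OF df h(1,3)] by blast
    have "h * (h * ?F u v y1) = h * (h * ?F v u y2)"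
      using y1(2) y2(2) by (simp add: algebra_simps)
    then have "?F u v y1 = ?F v u y2" using h by simp
    moreover have "dist (?F u v y1) (?F u v x) < e / 2"
      by (rule d1) (use y1 in \<open>simp add: r_def dist_commute\<close>)
    moreover have "dist (?F v u y2) (?F v u x) < e / 2"
      by (rule d2) (use y2 in \<open>simp add: r_def dist_commute\<close>)
    ultimately show ?thesis unfolding dist_real_def by arith
  qed
  then have "?F u v x - ?F v u x = 0" by (intro dense_eq0_I) (simp add: less_imp_le)
  then show ?thesis by simp
qed

text \<open>The mean value theorem needs real values, so the vector-valued case is obtained
  component by component.\<close>

lemma second_derivative_symmetric:
  fixes f :: "'a::real_normed_vector \<Rightarrow> 'e::euclidean_space"
  assumes "open S" "smooth_on S f" "x \<in> S"
  shows "fderiv (\<lambda>y. fderiv f y u) x v =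
    fderiv (\<lambda>y. fderiv f y v) x u"
proof (rule euclidean_eqI)
  fix b :: 'e
  have inner: "fderiv (\<lambda>y. g y \<bullet> b) y w = fderiv g y w \<bullet> b"
    if "smooth_on S g" "y \<in> S" for g :: "'a \<Rightarrow> 'e" and y w
    by (simp add: frechet_derivative_eqI[OF has_derivative_inner_left[OF
          smooth_on_has_derivative[OF that]]])
  have "fderiv (\<lambda>y. fderiv f y u) x v \<bullet> b
      = fderiv (\<lambda>y. fderiv (\<lambda>y. f y \<bullet> b) y u) x v" for u v
    using inner[OF smooth_on_frechet_derivative[OF assms(2)] assms(3)]
      frechet_derivative_cong_open[OF assms(1,3), of "\<lambda>y. fderiv (\<lambda>y. f y \<bullet> b) y u"
        "\<lambda>y. fderiv f y u \<bullet> b"] inner[OF assms(2)] by simp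
  then show "fderiv (\<lambda>y. fderiv f y u) x v \<bullet> b =
    fderiv (\<lambda>y. fderiv f y v) x u \<bullet> b"
    using second_derivative_symmetric_real[OF assms(1) _ assms(3), of "\<lambda>y. f y \<bullet> b"]
      smooth_on_inner[OF assms(1,2) smooth_on_const] by simp
qed

text \<open>The Picard operator acts on bounded continuous functions on all of \<open>\<real>\<close>: time is frozen outside
  \<open>[-d, d]\<close>.\<close>

lemma lipschitz_local_solution:
  fixes f :: "'e::euclidean_space \<Rightarrow> 'e"
  assumes L: "\<And>x y. norm (f x - f y) \<le> L * norm (x - y)" "L \<ge> 0"
    and M: "\<And>x. norm (f x) \<le> M"
    and d: "d > 0" "4 * d * L < 1"
  shows "\<exists>u. u 0 = x0 \<and> (\<forall>t\<in>{-d<..<d}. norm (u t - x0) \<le> 4 * d * M \<and>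
    (u has_vector_derivative f (u t)) (at t))"
proof -
  have contf: "continuous_on UNIV f"
    unfolding continuous_on_iff
  proof (intro ballI allI impI)
    fix x :: 'e and e :: real assume "e > 0"
    show "\<exists>d>0. \<forall>x'\<in>UNIV. dist x' x < d \<longrightarrow> dist (f x') (f x) < e"
    proof (intro exI[of _ "e / (L + 1)"] conjI ballI impI)
      show "e / (L + 1) > 0" using \<open>e > 0\<close> L by simp
      fix x' assume "dist x' x < e / (L + 1)"
      then have "(L + 1) * norm (x' - x) < e" using L by (simp add: dist_norm field_simps)
      moreover have "L * norm (x' - x) \<le> (L + 1) * norm (x' - x)"
        by (intro mult_right_mono) auto
      ultimately show "dist (f x') (f x) < e" using L(1)[of x' x] by (simp add: dist_norm)
    qed
  qed
  have cont: "continuous_on T (\<lambda>s. f (apply_bcontfun u s))" for u :: "real \<Rightarrow>\<^sub>C 'e" and T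
    by (intro continuous_on_compose2[OF contf] continuous_on_subset[OF continuous_on_apply_bcontfun])
      auto
  define c where "c t = max (- d) (min d t)" for t
  have c: "c t \<in> {-d..d}" for t using d by (auto simp: c_def)
  \<comment> \<open>The integral starts at \<open>-d\<close> so that one closed interval serves all
    times of both signs; subtracting \<open>J u 0\<close> in \<open>P\<close> moves the initial time
    to 0. Each of the two integrals runs over a length of at most \<open>2 * d\<close>, whence the
    factor \<open>4 * d\<close> in the contraction constant and in the bound on the
    displacement.\<close>
  define J where "J u t = integral {-d..t} (\<lambda>s. f (apply_bcontfun u s))" for u :: "real \<Rightarrow>\<^sub>C 'e" and t
  define P where "P u t = x0 + (J u (c t) - J u 0)" for u t
  have Jdiff: "norm (J u t - J w t) \<le> 2 * d * (L * dist u w)" if "t \<in> {-d..d}" for u w t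
  proof -
    have "norm (J u t - J w t)
        = norm (integral {-d..t} (\<lambda>s. f (apply_bcontfun u s) - f (apply_bcontfun w s)))"
      unfolding J_def by (subst integral_diff) (auto intro!: integrable_continuous_interval cont)
    also have "\<dots> \<le> (L * dist u w) * (t - (- d))"
    proof (rule integral_bound)
      show "norm (f (apply_bcontfun u s) - f (apply_bcontfun w s)) \<le> L * dist u w" for s
        using L(1)[of "apply_bcontfun u s" "apply_bcontfun w s"] dist_fun_lt_imp_dist_val_lt
          mult_left_mono[OF dist_bounded[of u s w] L(2)] by (simp add: dist_norm)
    qed (use that in \<open>auto intro!: continuous_intros cont\<close>)
    also have "\<dots> \<le> (L * dist u w) * (2 * d)"
      using that L by (intro mult_left_mono) auto
    finally show ?thesis by (simp add: ac_simps)
  qed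
  have Jbound: "norm (J u t) \<le> 2 * d * M" if "t \<in> {-d..d}" for u t
  proof -
    have "norm (J u t) \<le> M * (t - (- d))"
      unfolding J_def by (rule integral_bound) (use that M in \<open>auto intro!: cont\<close>)
    also have "\<dots> \<le> M * (2 * d)"
      using that order_trans[OF norm_ge_zero M] by (intro mult_left_mono) auto
    finally show ?thesis by (simp add: ac_simps)
  qed
  have Jderiv: "(J u has_vector_derivative f (apply_bcontfun u t)) (at t within {-d..d})"
    if "t \<in> {-d..d}" for u t
    unfolding J_def by (rule integral_has_vector_derivative[OF cont that])
  have Pbound: "norm (P u t - x0) \<le> 4 * d * M" for u t
    using norm_triangle_ineq4[of "J u (c t)" "J u 0"] Jbound[OF c, of u t] Jbound[of 0 u] d
    by (simp add: P_def)
  have Pb: "P u \<in> bcontfun" for u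
  proof -
    have "continuous_on {-d..d} (J u)"
      using Jderiv has_vector_derivative_continuous continuous_on_eq_continuous_within by blast
    then have "continuous_on UNIV (\<lambda>t. J u (c t))"
      by (rule continuous_on_compose2) (use c in \<open>auto simp: c_def intro!: continuous_intros\<close>)
    then have "continuous_on UNIV (P u)"
      unfolding P_def by (intro continuous_intros)
    moreover have "bounded (range (P u))"
      unfolding bounded_def using Pbound
      by (intro exI[of _ x0] exI[of _ "4 * d * M"]) (auto simp: dist_norm norm_minus_commute)
    ultimately show ?thesis by (simp add: bcontfun_def)
  qed
  have "\<exists>!u. Bcontfun (P u) = u"
  proof (rule banach_fix_type)
    show "0 \<le> 4 * d * L" "4 * d * L < 1" using d L by auto
    show "\<forall>u w. dist (Bcontfun (P u)) (Bcontfun (P w)) \<le> 4 * d * L * dist u w"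
    proof (intro allI dist_bound)
      fix u w t
      have "norm (P u t - P w t) = norm ((J u (c t) - J w (c t)) - (J u 0 - J w 0))"
        by (simp add: P_def algebra_simps)
      also have "\<dots> \<le> 4 * d * L * dist u w"
        using norm_triangle_ineq4[of "J u (c t) - J w (c t)" "J u 0 - J w 0"]
          Jdiff[OF c, of u t w] Jdiff[of 0 u w] d by simp
      finally show "dist (apply_bcontfun (Bcontfun (P u)) t) (apply_bcontfun (Bcontfun (P w)) t)
          \<le> 4 * d * L * dist u w"
        by (simp add: Bcontfun_inverse[OF Pb] dist_norm)
    qed
  qed
  then obtain u where "Bcontfun (P u) = u" by blast
  then have u: "apply_bcontfun u = P u" by (metis Bcontfun_inverse Pb)
  show ?thesis
  proof (intro exI[of _ "apply_bcontfun u"] conjI ballI)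
    show "apply_bcontfun u 0 = x0" using d by (simp add: u P_def c_def)
    fix t assume t: "t \<in> {-d<..<d}"
    show "norm (apply_bcontfun u t - x0) \<le> 4 * d * M" using Pbound u by simp
    have "(J u has_vector_derivative f (apply_bcontfun u t)) (at t)"
      using Jderiv[of t u] at_within_interior[of t "{-d..d}"] t by simp
    then have "((\<lambda>s. x0 + (J u s - J u 0)) has_vector_derivative f (apply_bcontfun u t)) (at t)"
      by (auto intro!: derivative_eq_intros)
    then show "(apply_bcontfun u has_vector_derivative f (apply_bcontfun u t)) (at t)"
    proof (rule has_vector_derivative_transform_within_open[of _ _ _ "{-d<..<d}"])
      show "x0 + (J u s - J u 0) = apply_bcontfun u s" if "s \<in> {-d<..<d}" for s
        using that by (simp add: u P_def c_def)
    qed (use t in auto)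
  qed
qed

text \<open>A smooth \<open>f\<close> is Lipschitz and bounded on a closed ball around
  \<open>x0\<close>. Precomposing with the nearest-point projection onto the ball makes it so on the
  whole space, and for short times the solution stays in the ball, where the modified equation is
  the original one.\<close>

lemma smooth_local_solution:
  fixes f :: "'e::euclidean_space \<Rightarrow> 'e"
  assumes "open S" "x0 \<in> S" "smooth_on S f"
  shows "\<exists>d>0. \<exists>u. u 0 = x0 \<and>
    (\<forall>t\<in>{-d<..<d}. u t \<in> S \<and> (u has_vector_derivative f (u t)) (at t))"
proof -
  obtain r where r: "r > 0" "cball x0 r \<subseteq> S" using assms open_contains_cball by blast
  have cpt: "compact (cball x0 r)" by simp
  \<comment> \<open>The sum of the norms of the partial derivatives dominates the operator norm of
    the derivative, and its continuity is immediate from the definition of smoothness.\<close>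
  have "continuous_on (cball x0 r) (\<lambda>x. \<Sum>b\<in>Basis. norm (fderiv f x b))"
    using r by (intro continuous_intros continuous_on_subset[OF smooth_on_imp_continuous_on[OF
            smooth_on_frechet_derivative[OF assms(3)]]])
  from compact_imp_bounded[OF compact_continuous_image[OF this cpt]]
  obtain L where L: "\<And>x. x \<in> cball x0 r \<Longrightarrow> (\<Sum>b\<in>Basis. norm (fderiv f x b)) \<le> L"
    unfolding bounded_iff by (metis abs_le_D1 imageI real_norm_def)
  have L0: "L \<ge> 0" using L[of x0] r sum_nonneg[of Basis "\<lambda>b. norm (fderiv f x0 b)"]
    by fastforce
  have cf: "continuous_on (cball x0 r) f"
    using r continuous_on_subset[OF smooth_on_imp_continuous_on[OF assms(3)]] by blast
  from compact_imp_bounded[OF compact_continuous_image[OF this cpt]]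
  obtain M where M: "\<And>x. x \<in> cball x0 r \<Longrightarrow> norm (f x) \<le> M"
    unfolding bounded_iff by blast
  have lip: "norm (f x - f y) \<le> L * norm (x - y)" if "x \<in> cball x0 r" "y \<in> cball x0 r" for x y
  proof (rule differentiable_bound[OF convex_cball _ _ that])
    show "(f has_derivative fderiv f z) (at z within cball x0 r)"
      if "z \<in> cball x0 r" for z
      using that r smooth_on_has_derivative[OF assms(3)] has_derivative_at_withinI by blast
    show "onorm (fderiv f z) \<le> L" if z: "z \<in> cball x0 r" for z
    proof (rule onorm_le)
      fix v
      have lin: "linear (fderiv f z)"
        using z r smooth_on_linear_derivative[OF assms(3)] by blast
      have "norm (fderiv f z v)
          \<le> (\<Sum>b\<in>Basis. norm ((v \<bullet> b) *\<^sub>R fderiv f z b))"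
        by (subst linear_euclidean_expand[OF lin]) (rule norm_sum)
      also have "\<dots> \<le> (\<Sum>b\<in>Basis. norm v * norm (fderiv f z b))"
        by (intro sum_mono) (simp add: Basis_le_norm mult_right_mono)
      also have "\<dots> \<le> L * norm v"
        using mult_left_mono[OF L[OF z] norm_ge_zero[of v]]
        by (simp add: sum_distrib_left[symmetric] mult.commute)
      finally show "norm (fderiv f z v) \<le> L * norm v" .
    qed
  qed
  define g where "g = f \<circ> closest_point (cball x0 r)"
  have cp: "closest_point (cball x0 r) x \<in> cball x0 r" for x
    using r by (intro closest_point_in_set) auto
  have g: "norm (g x - g y) \<le> L * norm (x - y)" for x y
  proof -
    have "norm (g x - g y) \<le> L * dist (closest_point (cball x0 r) x) (closest_point (cball x0 r) y)"
      using lip[OF cp cp] by (simp add: g_def dist_norm)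
    also have "\<dots> \<le> L * dist x y"
      using r L0 by (intro mult_left_mono closest_point_lipschitz) auto
    finally show ?thesis by (simp add: dist_norm)
  qed
  have M0: "M \<ge> 0" using M[of x0] r order_trans[OF norm_ge_zero] by auto
  \<comment> \<open>The first bound makes the Picard operator a contraction, the second keeps the
    solution in the ball of radius \<open>r\<close>. Adding 1 to \<open>L\<close> and
    \<open>M\<close> avoids division by zero.\<close>
  define d where "d = min (1 / (4 * (L + 1))) (r / (4 * (M + 1)))"
  have d: "d > 0" "4 * d * L < 1" "4 * d * M \<le> r"
  proof -
    show "d > 0" using r L0 M0 by (simp add: d_def)
    have "d \<le> 1 / (4 * (L + 1))" "d \<le> r / (4 * (M + 1))"
      by (auto simp: d_def)
    then have "d * (4 * (L + 1)) \<le> 1" "d * (4 * (M + 1)) \<le> r"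
      using L0 M0 pos_le_divide_eq[of "4 * (L + 1)" d 1] pos_le_divide_eq[of "4 * (M + 1)" d r]
      by auto
    then show "4 * d * L < 1" "4 * d * M \<le> r" using \<open>d > 0\<close> by (auto simp: algebra_simps)
  qed
  obtain u where u: "u 0 = x0" "\<And>t. t \<in> {-d<..<d} \<Longrightarrow> norm (u t - x0) \<le> 4 * d * M"
    "\<And>t. t \<in> {-d<..<d} \<Longrightarrow> (u has_vector_derivative g (u t)) (at t)"
    using lipschitz_local_solution[of g L M d x0] g L0 M cp d by (auto simp: g_def)
  have ub: "u t \<in> cball x0 r" if "t \<in> {-d<..<d}" for t
    using u(2)[OF that] d by (simp add: dist_norm norm_minus_commute)
  show ?thesis
  proof (intro exI[of _ d] exI[of _ u] conjI ballI)
    fix t assume t: "t \<in> {-d<..<d}"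
    show "u t \<in> S" using ub[OF t] r by blast
    show "(u has_vector_derivative f (u t)) (at t)"
      using u(3)[OF t] closest_point_self[OF ub[OF t]] by (simp add: g_def)
  qed (use u d in auto)
qed

section \<open>Charts and tangent vectors\<close>

locale smooth_mfd =
  fixes N :: "('a, 'e::real_normed_vector) manifold"
  assumes smooth_manifold: "smooth_manifold N"
begin

lemma openin_cdom: "c \<in> atlas N \<Longrightarrow> openin (mtop N) (cdom c)"
  and open_cimg: "c \<in> atlas N \<Longrightarrow> open (cimg c)"
  and homeomorphic_cmap: "c \<in> atlas N \<Longrightarrow>
    homeomorphic_map (subtopology (mtop N) (cdom c)) (top_of_set (cimg c)) (cmap c)"
  and smooth_transition: "c \<in> atlas N \<Longrightarrow> d \<in> atlas N \<Longrightarrow>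
    smooth_on (cmap c ` (cdom c \<inter> cdom d)) (cmap d \<circ> cinv c)"
  using smooth_manifold unfolding smooth_manifold_def by blast+

lemma cdom_subset: "c \<in> atlas N \<Longrightarrow> cdom c \<subseteq> points N"
  using openin_cdom openin_subset by blast

lemma chart_around_points: "chart_around N c p \<Longrightarrow> p \<in> points N"
  using cdom_subset[of c] by (auto simp: chart_around_def)

lemma chart_around_atlas: "chart_around N c p \<Longrightarrow> c \<in> atlas N"
  by (simp add: chart_around_def)

lemma chart_at: "p \<in> points N \<Longrightarrow> chart_around N (chart_at N p) p"
  unfolding chart_at_def
  by (rule someI_ex) (use smooth_manifold in \<open>auto simp: smooth_manifold_def chart_around_def\<close>)

lemma inj_on_cmap: "c \<in> atlas N \<Longrightarrow> inj_on (cmap c) (cdom c)"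
  using homeomorphic_imp_injective_map[OF homeomorphic_cmap] cdom_subset
  by (simp add: Int_absorb1)

lemma cinv_cmap: "chart_around N c p \<Longrightarrow> cinv c (cmap c p) = p"
  using inj_on_cmap by (simp add: chart_around_def cinv_def)

lemma cmap_in_cimg: "chart_around N c p \<Longrightarrow> cmap c p \<in> cimg c"
  by (simp add: chart_around_def cimg_def)

lemma cmap_cinv: "x \<in> cimg c \<Longrightarrow> cmap c (cinv c x) = x"
  by (simp add: cinv_def cimg_def f_inv_into_f)

lemma chart_around_cinv: "c \<in> atlas N \<Longrightarrow> x \<in> cimg c \<Longrightarrow> chart_around N c (cinv c x)"
  by (simp add: chart_around_def cinv_def cimg_def inv_into_into)

lemma open_cmap_image:
  assumes "c \<in> atlas N" "openin (mtop N) U" "U \<subseteq> cdom c"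
  shows "open (cmap c ` U)"
proof -
  have "openin (subtopology (mtop N) (cdom c)) U"
    using assms by (metis inf.absorb2 inf_commute openin_subtopology_Int)
  then have "openin (top_of_set (cimg c)) (cmap c ` U)"
    using homeomorphic_imp_open_map[OF homeomorphic_cmap[OF assms(1)]] by (simp add: open_map_def)
  then show ?thesis using open_cimg[OF assms(1)] by (simp add: openin_open_eq)
qed

lemma open_overlap: "c \<in> atlas N \<Longrightarrow> d \<in> atlas N \<Longrightarrow> open (cmap c ` (cdom c \<inter> cdom d))"
  using open_cmap_image openin_cdom by blast

lemma cinv_image_overlap:
  assumes "c \<in> atlas N"
  shows "x \<in> cmap c ` (cdom c \<inter> U) \<longleftrightarrow> x \<in> cimg c \<and> cinv c x \<in> U"
proof
  assume "x \<in> cmap c ` (cdom c \<inter> U)"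
  then obtain p where "x = cmap c p" "p \<in> cdom c" "p \<in> U" by blast
  then show "x \<in> cimg c \<and> cinv c x \<in> U"
    using assms cinv_cmap[of c p] by (simp add: cimg_def chart_around_def)
next
  assume "x \<in> cimg c \<and> cinv c x \<in> U"
  then show "x \<in> cmap c ` (cdom c \<inter> U)"
    using cmap_cinv[of x c] chart_around_cinv[OF assms, of x]
    by (metis IntI chart_around_def imageI)
qed

text \<open>Curves solved for in coordinates are carried to the manifold by \<open>cinv c\<close>,
  and trajectories are required to be continuous for the topology of \<open>N\<close>.\<close>

lemma continuous_cinv:
  assumes "c \<in> atlas N"
  shows "continuous_map (top_of_set (cimg c)) (mtop N) (cinv c)"
  unfolding continuous_map_def
proof (intro conjI allI impI)
  show "cinv c \<in> topspace (top_of_set (cimg c)) \<rightarrow> points N"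
    using chart_around_cinv[OF assms] chart_around_points by fastforce
  fix U assume "openin (mtop N) U"
  then have "open (cmap c ` (cdom c \<inter> U))"
    using open_cmap_image[OF assms] openin_cdom[OF assms] by blast
  moreover have "{x \<in> topspace (top_of_set (cimg c)). cinv c x \<in> U} = cmap c ` (cdom c \<inter> U)"
    using cinv_image_overlap[OF assms] by auto
  ultimately show "openin (top_of_set (cimg c)) {x \<in> topspace (top_of_set (cimg c)). cinv c x \<in> U}"
    by (metis (no_types, lifting) assms inf.cobounded1 image_mono cimg_def openin_open_eq open_cimg)
qed

abbreviation transition :: "('a, 'e) chart \<Rightarrow> ('a, 'e) chart \<Rightarrow> 'e \<Rightarrow> 'e" where
  "transition c d \<equiv> cmap d \<circ> cinv c"

abbreviation jacobian :: "('a, 'e) chart \<Rightarrow> ('a, 'e) chart \<Rightarrow> 'a \<Rightarrow> 'e \<Rightarrow> 'e" where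
  "jacobian c d p \<equiv> frechet_derivative (transition c d) (at (cmap c p))"

lemma transition_has_derivative:
  "chart_around N c p \<Longrightarrow> chart_around N d p \<Longrightarrow>
    (transition c d has_derivative jacobian c d p) (at (cmap c p))"
  using smooth_on_has_derivative[OF smooth_transition] unfolding chart_around_def by blast

lemma linear_jacobian: "chart_around N c p \<Longrightarrow> chart_around N d p \<Longrightarrow> linear (jacobian c d p)"
  using transition_has_derivative has_derivative_linear by blast

text \<open>This is the chain rule, since \<open>cinv d\<close> undoes \<open>cmap d\<close> on the
  overlap of \<open>c\<close> and \<open>d\<close>. It makes \<open>tangent_of\<close> obey the
  transformation law and, together with \<open>jacobian_self\<close>, makes Jacobians
  invertible.\<close>

lemma jacobian_chain:
  assumes "chart_around N c p" "chart_around N d p" "chart_around N e p"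
  shows "jacobian d e p (jacobian c d p v) = jacobian c e p v"
proof -
  have "(transition d e has_derivative jacobian d e p) (at (transition c d (cmap c p)))"
    using transition_has_derivative[OF assms(2,3)] by (simp add: cinv_cmap[OF assms(1)])
  from diff_chain_at[OF transition_has_derivative[OF assms(1,2)] this]
  have "(transition c e has_derivative jacobian d e p \<circ> jacobian c d p) (at (cmap c p))"
  proof (rule has_derivative_transform_within_open)
    show "open (cmap c ` (cdom c \<inter> cdom d))"
      using assms open_overlap chart_around_atlas by blast
    show "(transition d e \<circ> transition c d) x = transition c e x"
      if "x \<in> cmap c ` (cdom c \<inter> cdom d)" for x
    proof -
      obtain q where "x = cmap c q" "chart_around N c q" "chart_around N d q"
        using \<open>x \<in> cmap c ` (cdom c \<inter> cdom d)\<close> assms by (auto simp: chart_around_def)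
      then show ?thesis by (simp add: cinv_cmap)
    qed
  qed (use assms in \<open>auto simp: chart_around_def\<close>)
  then show ?thesis using frechet_derivative_eqI by fastforce
qed

lemma jacobian_self:
  assumes "chart_around N c p"
  shows "jacobian c c p v = v"
proof -
  have "(transition c c has_derivative id) (at (cmap c p))"
  proof (rule has_derivative_transform_within_open[OF has_derivative_id])
    show "open (cimg c)" using assms open_cimg chart_around_atlas by blast
    show "id x = transition c c x" if "x \<in> cimg c" for x
      using cmap_cinv[OF that] by simp
  qed (rule cmap_in_cimg[OF assms])
  then show ?thesis using frechet_derivative_eqI by fastforce
qed

lemma tangent_of_in_tangent_space: "chart_around N c p \<Longrightarrow> tangent_of N c p v \<in> tangent_space N p"
  unfolding tangent_space_def tangent_of_def by (simp add: jacobian_chain del: split_paired_All)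

lemma tangent_of_component [simp]: "chart_around N c p \<Longrightarrow> tangent_of N c p v c = v"
  by (simp add: tangent_of_def jacobian_self)

lemma tangent_spaceD:
  assumes "v \<in> tangent_space N p"
  shows "\<not> chart_around N c p \<Longrightarrow> v c = 0"
    "chart_around N c p \<Longrightarrow> chart_around N d p \<Longrightarrow> v d = jacobian c d p (v c)"
  using assms unfolding tangent_space_def by blast+

lemma tangent_eqI:
  assumes "v \<in> tangent_space N p" "w \<in> tangent_space N p" "chart_around N c p" "v c = w c"
  shows "v = w"
  using assms tangent_spaceD by (metis ext)

lemma tangent_of_eq:
  "v \<in> tangent_space N p \<Longrightarrow> chart_around N c p \<Longrightarrow> tangent_of N c p (v c) = v"
  by (rule tangent_eqI[OF tangent_of_in_tangent_space]) auto

lemma tangent_space_add: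
  assumes "v \<in> tangent_space N p" "w \<in> tangent_space N p"
  shows "(\<lambda>c. v c + w c) \<in> tangent_space N p"
  unfolding tangent_space_def
proof (intro CollectI conjI allI impI)
  fix c d assume *: "chart_around N c p \<and> chart_around N d p"
  then show "v d + w d = jacobian c d p (v c + w c)"
    using tangent_spaceD(2)[OF assms(1), of c d] tangent_spaceD(2)[OF assms(2), of c d]
      linear_add[OF linear_jacobian] by simp
qed (use tangent_spaceD(1)[OF assms(1)] tangent_spaceD(1)[OF assms(2)] in simp)

lemma tangent_space_scale:
  assumes "v \<in> tangent_space N p"
  shows "(\<lambda>c. a *\<^sub>R v c) \<in> tangent_space N p"
  unfolding tangent_space_def
proof (intro CollectI conjI allI impI)
  fix c d assume *: "chart_around N c p \<and> chart_around N d p"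
  then show "a *\<^sub>R v d = jacobian c d p (a *\<^sub>R v c)"
    using tangent_spaceD(2)[OF assms, of c d] linear_scale[OF linear_jacobian] by simp
qed (use tangent_spaceD(1)[OF assms] in simp)

lemma tangent_space_zero: "(\<lambda>c. 0) \<in> tangent_space N p"
  using linear_0[OF linear_jacobian] unfolding tangent_space_def by (simp del: split_paired_All)

lemma strongly_adapted_if_invariant:
  assumes "one_form N \<theta>" "\<And>p. p \<in> points N \<Longrightarrow> \<theta> p (Y p) > 0"
    "\<And>p v. p \<in> points N \<Longrightarrow> v \<in> tangent_space N p \<Longrightarrow> lie_form N Y \<theta> p v = 0"
  shows "strongly_adapted N Y \<theta>"
  unfolding strongly_adapted_def
proof (intro conjI exI[of _ "\<lambda>_. 0"] ballI)
  show "smooth_fun N (\<lambda>_. 0)" by (simp add: smooth_fun_def o_def smooth_on_const)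
qed (use assms in \<open>auto simp: differential_def o_def Let_def\<close>)

end


section \<open>Products of manifolds\<close>

lemma second_countable_prod_topology:
  assumes "second_countable X" "second_countable Y"
  shows "second_countable (prod_topology X Y)"
proof -
  obtain A where A: "countable A" "\<And>V. V \<in> A \<Longrightarrow> openin X V"
    "\<And>U x. openin X U \<and> x \<in> U \<longrightarrow> (\<exists>V\<in>A. x \<in> V \<and> V \<subseteq> U)"
    using assms(1) by (auto simp: second_countable_def)
  obtain B where B: "countable B" "\<And>V. V \<in> B \<Longrightarrow> openin Y V"
    "\<And>U x. openin Y U \<and> x \<in> U \<longrightarrow> (\<exists>V\<in>B. x \<in> V \<and> V \<subseteq> U)"
    using assms(2) by (auto simp: second_countable_def)
  show ?thesis
    unfolding second_countable_def
  proof (intro exI[of _ "(\<lambda>(U, V). U \<times> V) ` (A \<times> B)"] conjI ballI allI impI)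
    show "countable ((\<lambda>(U, V). U \<times> V) ` (A \<times> B))" using A B by simp
    show "openin (prod_topology X Y) W" if "W \<in> (\<lambda>(U, V). U \<times> V) ` (A \<times> B)" for W
      using that A B by (auto simp: openin_prod_Times_iff)
    fix W z assume W: "openin (prod_topology X Y) W \<and> z \<in> W"
    then have "(fst z, snd z) \<in> W" by simp
    with W obtain U V where UV: "openin X U" "openin Y V" "fst z \<in> U" "snd z \<in> V" "U \<times> V \<subseteq> W"
      unfolding openin_prod_topology_alt by blast
    obtain U' where U': "U' \<in> A" "fst z \<in> U'" "U' \<subseteq> U" using A(3) UV(1,3) by blast
    obtain V' where V': "V' \<in> B" "snd z \<in> V'" "V' \<subseteq> V" using B(3) UV(2,4) by blast
    show "\<exists>V\<in>(\<lambda>(U, V). U \<times> V) ` (A \<times> B). z \<in> V \<and> V \<subseteq> W"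
    proof (intro bexI conjI)
      show "z \<in> U' \<times> V'" "U' \<times> V' \<subseteq> W" using U' V' UV by (auto simp: mem_Times_iff)
      show "U' \<times> V' \<in> (\<lambda>(U, V). U \<times> V) ` (A \<times> B)" using U' V' by auto
    qed
  qed
qed

lemma finite_spanning_set_Times:
  assumes "finite A" "span A = (UNIV :: 'e::real_vector set)"
    and "finite B" "span B = (UNIV :: 'f::real_vector set)"
  shows "\<exists>C::('e \<times> 'f) set. finite C \<and> span C = UNIV"
proof (intro exI conjI)
  let ?C = "(\<lambda>b. (b, 0)) ` A \<union> (\<lambda>b. (0, b)) ` B"
  show "finite ?C" using assms by simp
  have "linear (\<lambda>b::'e. (b, 0::'f))" "linear (\<lambda>b::'f. (0::'e, b))"
    by (auto intro!: linearI)
  then have sp: "span ((\<lambda>b::'e. (b, 0::'f)) ` A) = range (\<lambda>b. (b, 0))"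
    "span ((\<lambda>b::'f. (0::'e, b)) ` B) = range (\<lambda>b. (0, b))"
    using assms by (metis linear_span_image)+
  have "z \<in> span ?C" for z :: "'e \<times> 'f"
  proof -
    have "(fst z, 0) \<in> span ?C" "(0, snd z) \<in> span ?C"
      using sp span_mono[of "(\<lambda>b. (b, 0)) ` A" ?C] span_mono[of "(\<lambda>b. (0, b)) ` B" ?C] by blast+
    from span_add[OF this] show ?thesis by simp
  qed
  then show "span ?C = UNIV" by blast
qed

lemma cdom_prod_chart [simp]: "cdom (prod_chart c d) = cdom c \<times> cdom d"
  and cmap_prod_chart [simp]: "cmap (prod_chart c d) = map_prod (cmap c) (cmap d)"
  and cimg_prod_chart [simp]: "cimg (prod_chart c d) = cimg c \<times> cimg d"
  by (auto simp: prod_chart_def cimg_def)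

lemma points_prod_manifold [simp]: "points (prod_manifold M N) = points M \<times> points N"
  by (simp add: prod_manifold_def)

lemma homeomorphic_map_prod:
  assumes "homeomorphic_map X X' f" "homeomorphic_map Y Y' g"
  shows "homeomorphic_map (prod_topology X Y) (prod_topology X' Y') (map_prod f g)"
proof -
  obtain f' g' where "homeomorphic_maps X X' f f'" "homeomorphic_maps Y Y' g g'"
    using assms by (auto simp: homeomorphic_map_maps)
  then have "homeomorphic_maps (prod_topology X Y) (prod_topology X' Y')
      (\<lambda>(x, y). (f x, g y)) (\<lambda>(x, y). (f' x, g' y))"
    by (simp add: homeomorphic_maps_prod)
  then show ?thesis
    using homeomorphic_map_maps unfolding map_prod_def by blast
qed

text \<open>\<open>cinv\<close> is a choice of preimage, determined by injectivity on the image of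
  the chart; the factorwise formula is therefore restricted to images.\<close>

lemma cinv_prod_chart:
  assumes "smooth_manifold M" "smooth_manifold N" "c \<in> atlas M" "d \<in> atlas N"
    "x \<in> cimg c" "y \<in> cimg d"
  shows "cinv (prod_chart c d) (x, y) = (cinv c x, cinv d y)"
proof -
  interpret M: smooth_mfd M by unfold_locales fact
  interpret N: smooth_mfd N by unfold_locales fact
  have "inj_on (map_prod (cmap c) (cmap d)) (cdom c \<times> cdom d)"
    using M.inj_on_cmap N.inj_on_cmap assms by (intro map_prod_inj_on)
  moreover have "(cinv c x, cinv d y) \<in> cdom c \<times> cdom d"
    using M.chart_around_cinv N.chart_around_cinv assms by (auto simp: chart_around_def)
  moreover have "(x, y) = map_prod (cmap c) (cmap d) (cinv c x, cinv d y)"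
    using M.cmap_cinv[OF assms(5)] N.cmap_cinv[OF assms(6)] by simp
  ultimately show ?thesis
    by (metis cdom_prod_chart cinv_def cmap_prod_chart inv_into_f_f)
qed

lemma prod_chart_in_atlas:
  "c \<in> atlas M \<Longrightarrow> d \<in> atlas N \<Longrightarrow> prod_chart c d \<in> atlas (prod_manifold M N)"
  unfolding prod_manifold_def by (simp del: split_paired_Ex) blast

lemma prod_atlasE:
  assumes "C \<in> atlas (prod_manifold M N)"
  obtains c d where "C = prod_chart c d" "c \<in> atlas M" "d \<in> atlas N"
  using assms by (auto simp: prod_manifold_def)

lemma smooth_prod_manifold:
  fixes M :: "('a, 'e::real_normed_vector) manifold" and N :: "('b, 'f::real_normed_vector) manifold"
  assumes "smooth_manifold M" "smooth_manifold N"
  shows "smooth_manifold (prod_manifold M N)"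
proof -
  interpret M: smooth_mfd M by unfold_locales fact
  interpret N: smooth_mfd N by unfold_locales fact
  show ?thesis
    unfolding smooth_manifold_def
  proof (intro conjI ballI)
    show "\<exists>B::('e \<times> 'f) set. finite B \<and> span B = UNIV"
      using assms unfolding smooth_manifold_def by (elim conjE exE) (rule finite_spanning_set_Times)
    show "Hausdorff_space (mtop (prod_manifold M N))" "second_countable (mtop (prod_manifold M N))"
      using assms unfolding smooth_manifold_def prod_manifold_def
      by (simp_all add: Hausdorff_space_prod_topology second_countable_prod_topology)
    show "points (prod_manifold M N) = (\<Union>C\<in>atlas (prod_manifold M N). cdom C)"
    proof (intro equalityI subsetI)
      fix z assume "z \<in> points (prod_manifold M N)"
      then have "chart_around M (chart_at M (fst z)) (fst z)" "chart_around N (chart_at N (snd z)) (snd z)"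
        using M.chart_at N.chart_at by auto
      then have "prod_chart (chart_at M (fst z)) (chart_at N (snd z)) \<in> atlas (prod_manifold M N)"
        "z \<in> cdom (prod_chart (chart_at M (fst z)) (chart_at N (snd z)))"
        by (simp_all add: chart_around_def prod_chart_in_atlas mem_Times_iff)
      then show "z \<in> (\<Union>C\<in>atlas (prod_manifold M N). cdom C)" by blast
    next
      fix z assume "z \<in> (\<Union>C\<in>atlas (prod_manifold M N). cdom C)"
      then obtain c d where "c \<in> atlas M" "d \<in> atlas N" "z \<in> cdom c \<times> cdom d"
        by (metis UN_E cdom_prod_chart prod_atlasE)
      then show "z \<in> points (prod_manifold M N)"
        using M.cdom_subset[of c] N.cdom_subset[of d] by auto
    qed
    fix C assume "C \<in> atlas (prod_manifold M N)"
    then obtain c d where C: "C = prod_chart c d" "c \<in> atlas M" "d \<in> atlas N"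
      by (rule prod_atlasE)
    show "openin (mtop (prod_manifold M N)) (cdom C)"
      using C M.openin_cdom N.openin_cdom by (simp add: prod_manifold_def openin_prod_Times_iff)
    show "open (cimg C)"
      using C M.open_cimg N.open_cimg by (simp add: open_Times)
    have "prod_topology (top_of_set (cimg c)) (top_of_set (cimg d)) = top_of_set (cimg c \<times> cimg d)"
      by simp
    then show "homeomorphic_map (subtopology (mtop (prod_manifold M N)) (cdom C))
        (top_of_set (cimg C)) (cmap C)"
      using homeomorphic_map_prod[OF M.homeomorphic_cmap[OF C(2)] N.homeomorphic_cmap[OF C(3)]]
      by (simp add: C prod_manifold_def subtopology_Times)
    fix C' assume "C' \<in> atlas (prod_manifold M N)"
    then obtain c' d' where C': "C' = prod_chart c' d'" "c' \<in> atlas M" "d' \<in> atlas N"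
      by (rule prod_atlasE)
    have *: "cmap C ` (cdom C \<inter> cdom C') =
        cmap c ` (cdom c \<inter> cdom c') \<times> cmap d ` (cdom d \<inter> cdom d')"
      unfolding C C' cdom_prod_chart cmap_prod_chart Times_Int_Times by (rule map_prod_surj_on) simp_all
    show "smooth_on (cmap C ` (cdom C \<inter> cdom C')) (cmap C' \<circ> cinv C)"
      unfolding *
    proof (rule smooth_on_cong)
      show "smooth_on (cmap c ` (cdom c \<inter> cdom c') \<times> cmap d ` (cdom d \<inter> cdom d'))
          (map_prod (cmap c' \<circ> cinv c) (cmap d' \<circ> cinv d))"
        using C C' by (intro smooth_on_map_prod M.open_overlap N.open_overlap M.smooth_transition
            N.smooth_transition)
      show "open (cmap c ` (cdom c \<inter> cdom c') \<times> cmap d ` (cdom d \<inter> cdom d'))"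
        using C C' by (intro open_Times M.open_overlap N.open_overlap)
      show "map_prod (cmap c' \<circ> cinv c) (cmap d' \<circ> cinv d) z = (cmap C' \<circ> cinv C) z"
        if "z \<in> cmap c ` (cdom c \<inter> cdom c') \<times> cmap d ` (cdom d \<inter> cdom d')" for z
      proof -
        have "fst z \<in> cimg c" "snd z \<in> cimg d" using that by (auto simp: cimg_def)
        then show ?thesis using cinv_prod_chart[OF assms C(2,3)] by (cases z) (simp add: C C')
      qed
    qed
  qed
qed

section \<open>Lie derivatives in coordinates\<close>

context smooth_mfd
begin

lemma vector_field_smooth: "vector_field N Y \<Longrightarrow> c \<in> atlas N \<Longrightarrow> smooth_on (cimg c) (field_in Y c)"
  by (simp add: vector_field_def)

lemma vector_field_tangent: "vector_field N Y \<Longrightarrow> p \<in> points N \<Longrightarrow> Y p \<in> tangent_space N p"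
  by (simp add: vector_field_def)

lemma field_in_cmap: "chart_around N c p \<Longrightarrow> field_in Y c (cmap c p) = Y p c"
  by (simp add: field_in_def cinv_cmap)

lemma tangent_of_field_in:
  assumes "vector_field N Y" "c \<in> atlas N" "x \<in> cimg c"
  shows "tangent_of N c (cinv c x) (field_in Y c x) = Y (cinv c x)"
  using tangent_of_eq vector_field_tangent[OF assms(1)] chart_around_cinv[OF assms(2,3)]
    chart_around_points by (simp add: field_in_def)

lemma form_in_dual:
  assumes "vector_field N Y" "c \<in> atlas N" "x \<in> cimg c"
  shows "form_in N (dual_form g Y) c x v = metric_in N g c x (field_in Y c x) v"
  by (simp add: form_in_def dual_form_def metric_in_def tangent_of_field_in[OF assms])

lemma metric_in_symmetric:
  assumes "riemannian_metric N g" "c \<in> atlas N" "x \<in> cimg c"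
  shows "metric_in N g c x v w = metric_in N g c x w v"
  using assms chart_around_cinv[OF assms(2,3)] tangent_of_in_tangent_space chart_around_points
  unfolding riemannian_metric_def metric_in_def by blast

lemma metric_in_pos:
  assumes "riemannian_metric N g" "c \<in> atlas N" "x \<in> cimg c" "v \<noteq> 0"
  shows "metric_in N g c x v v > 0"
proof -
  have a: "chart_around N c (cinv c x)" using assms chart_around_cinv by blast
  then have "tangent_of N c (cinv c x) v \<noteq> (\<lambda>_. 0)"
    using tangent_of_component[OF a, of v] assms(4) by metis
  then show ?thesis
    using assms(1) tangent_of_in_tangent_space[OF a] chart_around_points[OF a]
    unfolding riemannian_metric_def metric_in_def by blast
qed

lemma metric_in_linear:
  assumes "riemannian_metric N g" "c \<in> atlas N" "x \<in> cimg c"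
  shows "linear (metric_in N g c x v)" "linear (\<lambda>w. metric_in N g c x w v)"
  using assms unfolding riemannian_metric_def by blast+

lemma metric_in_smooth:
  assumes "riemannian_metric N g" "c \<in> atlas N"
  shows "smooth_on (cimg c) (\<lambda>x. metric_in N g c x v w)"
  using assms unfolding riemannian_metric_def by blast

end

text \<open>Bases and inner products of the model space are used in charts. The class excludes
  dimension zero, which costs only the empty manifold: in dimension zero every tangent vector
  vanishes.\<close>

locale euclidean_flow = smooth_mfd N
  for N :: "('a, 'e::euclidean_space) manifold" +
  fixes Y :: "('a, 'e) field"
  assumes vector_field: "vector_field N Y" and nonzero: "\<And>p. p \<in> points N \<Longrightarrow> Y p \<noteq> (\<lambda>_. 0)"
begin

lemma one_form_dual:
  assumes "riemannian_metric N g"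
  shows "one_form N (dual_form g Y)"
  unfolding one_form_def
proof (intro ballI conjI allI)
  fix c assume c: "c \<in> atlas N"
  show "linear (form_in N (dual_form g Y) c x)" if "x \<in> cimg c" for x
  proof -
    have "form_in N (dual_form g Y) c x = metric_in N g c x (field_in Y c x)"
      by (rule ext) (rule form_in_dual[OF vector_field c that])
    then show ?thesis using metric_in_linear(1)[OF assms c that] by simp
  qed
  show "smooth_on (cimg c) (\<lambda>x. form_in N (dual_form g Y) c x v)" for v
  proof (rule smooth_on_cong[OF open_cimg[OF c]])
    show "smooth_on (cimg c) (\<lambda>x. metric_in N g c x (field_in Y c x) v)"
      by (rule smooth_on_linear_apply[OF open_cimg[OF c]])
        (use assms c metric_in_linear metric_in_smooth vector_field_smooth[OF vector_field] in auto)
  qed (simp add: form_in_dual[OF vector_field c])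
qed

lemma dual_form_pos:
  "riemannian_metric N g \<Longrightarrow> p \<in> points N \<Longrightarrow> dual_form g Y p (Y p) > 0"
  using nonzero vector_field_tangent[OF vector_field]
  unfolding riemannian_metric_def dual_form_def by blast

lemma metric_field_has_derivative:
  assumes "riemannian_metric N g" "c \<in> atlas N" "x \<in> cimg c"
  shows "((\<lambda>y. metric_in N g c y (field_in Y c y) v) has_derivative
    (\<lambda>u. fderiv (\<lambda>y. metric_in N g c y (field_in Y c x) v) x u
      + metric_in N g c x (fderiv (field_in Y c) x u) v)) (at x)"
  by (rule has_derivative_linear_apply[OF open_cimg[OF assms(2)] assms(3)])
    (use assms metric_in_linear metric_in_smooth
      smooth_on_has_derivative[OF vector_field_smooth[OF vector_field]] in auto)

text \<open>The Leibniz rule applied to the pairing of \<open>g\<close> with \<open>Y\<close>. Since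
  the bracket of \<open>Y\<close> with itself vanishes, the three terms are those of the Lie
  derivative of \<open>g\<close>, evaluated on \<open>Y\<close> and \<open>v\<close>.\<close>

lemma lie_form_dual:
  assumes "riemannian_metric N g" "p \<in> points N"
  defines "c \<equiv> chart_at N p"
  defines "x \<equiv> cmap c p"
  shows "lie_form N Y (dual_form g Y) p v =
    fderiv (\<lambda>y. metric_in N g c y (field_in Y c x) (v c)) x (field_in Y c x)
    + metric_in N g c x (fderiv (field_in Y c) x (field_in Y c x)) (v c)
    + metric_in N g c x (field_in Y c x) (fderiv (field_in Y c) x (v c))"
proof -
  have a: "chart_around N c p" using chart_at assms by simp
  then have c: "c \<in> atlas N" "x \<in> cimg c" using chart_around_atlas cmap_in_cimg by (auto simp: x_def)
  have "fderiv (\<lambda>y. form_in N (dual_form g Y) c y (v c)) x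
      = fderiv (\<lambda>y. metric_in N g c y (field_in Y c y) (v c)) x"
    by (rule frechet_derivative_cong_open[OF open_cimg[OF c(1)] c(2)])
      (rule form_in_dual[OF vector_field c(1)])
  then show ?thesis
    unfolding lie_form_def Let_def c_def[symmetric] x_def[symmetric]
    by (simp add: form_in_dual[OF vector_field c]
        frechet_derivative_eqI[OF metric_field_has_derivative[OF assms(1) c]])
qed

lemma isometric_strongly_adapted:
  assumes "riemannian_metric N g" "preserves_metric N Y g"
  shows "strongly_adapted N Y (dual_form g Y)"
proof (rule strongly_adapted_if_invariant)
  fix p v assume p: "p \<in> points N" "v \<in> tangent_space N p"
  have "Y p (chart_at N p) = field_in Y (chart_at N p) (cmap (chart_at N p) p)"
    using field_in_cmap chart_at p by simp
  then have "lie_form N Y (dual_form g Y) p v = lie_metric N Y g p (Y p) v"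
    unfolding lie_form_dual[OF assms(1) p(1)] lie_metric_def Let_def by simp
  then show "lie_form N Y (dual_form g Y) p v = 0"
    using assms(2) p vector_field_tangent[OF vector_field] by (simp add: preserves_metric_def)
qed (use assms one_form_dual dual_form_pos in auto)

text \<open>Conditions imposed on trajectories become pointwise conditions on \<open>Y\<close> once
  a trajectory passes through every point. A solution in the chart \<open>c\<close> is transported
  to the manifold, and it stays in that chart by construction.\<close>

lemma local_trajectory:
  assumes "p \<in> points N" "chart_around N c p"
  obtains d u where "d > 0" "trajectory N Y {-d<..<d} u" "u 0 = p"
    "\<And>t. t \<in> {-d<..<d} \<Longrightarrow> chart_around N c (u t)"
proof -
  have c: "c \<in> atlas N" "cmap c p \<in> cimg c"
    using assms chart_around_atlas cmap_in_cimg by auto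
  obtain d \<xi> where d: "d > 0" and \<xi>: "\<xi> 0 = cmap c p" "\<And>t. t \<in> {-d<..<d} \<Longrightarrow> \<xi> t \<in> cimg c"
    "\<And>t. t \<in> {-d<..<d} \<Longrightarrow> (\<xi> has_vector_derivative field_in Y c (\<xi> t)) (at t)"
    using smooth_local_solution[OF open_cimg[OF c(1)] c(2) vector_field_smooth[OF vector_field c(1)]]
    by blast
  let ?u = "cinv c \<circ> \<xi>"
  have around: "chart_around N c (?u t)" if "t \<in> {-d<..<d}" for t
    using chart_around_cinv[OF c(1) \<xi>(2)[OF that]] by simp
  have "trajectory N Y {-d<..<d} ?u"
    unfolding trajectory_def
  proof (intro conjI ballI allI impI)
    have "continuous_on {-d<..<d} \<xi>"
      using \<xi>(3) by (meson continuous_at_imp_continuous_on has_vector_derivative_continuous)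
    then have "continuous_map (top_of_set {-d<..<d}) (top_of_set (cimg c)) \<xi>"
      using \<xi>(2) by (auto simp: continuous_map_in_subtopology)
    then show "continuous_map (top_of_set {-d<..<d}) (mtop N) ?u"
      using continuous_map_compose continuous_cinv[OF c(1)] by blast
    \<comment> \<open>The equation must hold in every chart \<open>e\<close> met by the curve. By
      the chain rule the velocity in \<open>e\<close> is the Jacobian image of the velocity in
      \<open>c\<close>, and by the transformation law this image is the component of
      \<open>Y\<close> in \<open>e\<close>.\<close>
    fix t e assume t: "t \<in> {-d<..<d}" and e: "chart_around N e (?u t)"
    have x: "cmap c (?u t) = \<xi> t" using cmap_cinv[OF \<xi>(2)[OF t]] by simp
    have "(transition c e has_derivative jacobian c e (?u t)) (at (\<xi> t) within range \<xi>)"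
      using transition_has_derivative[OF around[OF t] e] has_derivative_at_withinI unfolding x by blast
    from vector_derivative_diff_chain_within[OF \<xi>(3)[OF t] this]
    have "(transition c e \<circ> \<xi> has_vector_derivative jacobian c e (?u t) (field_in Y c (\<xi> t))) (at t)" .
    moreover have "jacobian c e (?u t) (field_in Y c (\<xi> t)) = Y (?u t) e"
      using tangent_spaceD(2)[OF vector_field_tangent[OF vector_field] around[OF t] e]
        chart_around_points[OF e] by (simp add: field_in_def)
    ultimately show "(cmap e \<circ> ?u has_vector_derivative Y (?u t) e) (at t)"
      by (simp add: o_assoc)
  qed (simp_all add: is_interval_convex)
  moreover have "?u 0 = p" using \<xi>(1) cinv_cmap[OF assms(2)] by simp
  ultimately show thesis using that[OF d, of ?u] around by blast
qed

lemma velocity_trajectory: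
  assumes "trajectory N Y I u" "t \<in> I"
  shows "velocity N u t = Y (u t)"
proof
  fix c
  have "u t \<in> points N" using assms by (auto simp: trajectory_def continuous_map_def)
  then have "\<not> chart_around N c (u t) \<Longrightarrow> Y (u t) c = 0"
    using tangent_spaceD(1)[OF vector_field_tangent[OF vector_field]] by blast
  moreover have "chart_around N c (u t) \<Longrightarrow> vector_derivative (cmap c \<circ> u) (at t) = Y (u t) c"
    using assms unfolding trajectory_def by (blast intro: vector_derivative_at)
  ultimately show "velocity N u t c = Y (u t) c" by (simp add: velocity_def)
qed

text \<open>\<open>christoffel\<close> is a definite description. It denotes the vector representing
  the linear functional on the right with respect to the metric, which exists and is unique because
  the metric is positive definite and the dimension is finite.\<close>

lemma christoffel_eq:
  assumes "riemannian_metric N g" "c \<in> atlas N" "x \<in> cimg c"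
  shows "metric_in N g c x (christoffel N g c x v w) z =
    (fderiv (\<lambda>y. metric_in N g c y w z) x v
     + fderiv (\<lambda>y. metric_in N g c y v z) x w
     - fderiv (\<lambda>y. metric_in N g c y v w) x z) / 2"
proof -
  let ?G = "metric_in N g c"
  define \<phi> where "\<phi> z = (fderiv (\<lambda>y. ?G y w z) x v
     + fderiv (\<lambda>y. ?G y v z) x w
     - fderiv (\<lambda>y. ?G y v w) x z) / 2" for z
  have lin1: "linear (\<lambda>z. fderiv (\<lambda>y. ?G y a z) x b)" for a b
    by (rule linear_fderiv_parameter[OF open_cimg[OF assms(2)] assms(3)])
      (use assms metric_in_linear metric_in_smooth in auto)
  have lin2: "linear (fderiv (\<lambda>y. ?G y v w) x)"
    by (rule smooth_on_linear_derivative[OF metric_in_smooth[OF assms(1,2)] assms(3)])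
  have "linear \<phi>"
    unfolding \<phi>_def
    by (rule linearI)
      (simp_all add: linear_add[OF lin1] linear_add[OF lin2] linear_scale[OF lin1]
        linear_scale[OF lin2] field_simps)
  \<comment> \<open>\<open>T\<close> represents the metric at \<open>x\<close> through the Euclidean
    inner product. Positive definiteness makes it injective, hence surjective.\<close>
  define T where "T a = (\<Sum>b\<in>Basis. ?G x a b *\<^sub>R b)" for a
  have T: "T a \<bullet> z = ?G x a z" for a z
    using linear_euclidean_expand[OF metric_in_linear(1)[OF assms], of a z]
    by (simp add: T_def inner_sum_left inner_sum_right inner_commute mult.commute)
  have "linear T"
    by (rule linearI; rule euclidean_eqI)
      (simp_all add: inner_add_left T linear_add[OF metric_in_linear(2)[OF assms]]
        linear_scale[OF metric_in_linear(2)[OF assms]])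
  have "inj T"
    unfolding linear_injective_0[OF \<open>linear T\<close>]
    using metric_in_pos[OF assms] T by (metis inner_zero_left less_irrefl)
  then have "surj T" using linear_injective_imp_surjective \<open>linear T\<close> by blast
  then obtain a where a: "T a = (\<Sum>b\<in>Basis. \<phi> b *\<^sub>R b)" by (metis surjD)
  have *: "?G x a z = \<phi> z" for z
    using linear_euclidean_expand[OF \<open>linear \<phi>\<close>, of z]
    by (simp add: T[symmetric] a inner_sum_left inner_sum_right inner_commute mult.commute)
  have "(THE a. \<forall>z. ?G x a z = \<phi> z) = a"
  proof (rule the_equality)
    show "\<forall>z. ?G x a z = \<phi> z" using * by simp
    fix a' assume a': "\<forall>z. ?G x a' z = \<phi> z"
    have "T a' = T a" by (rule euclidean_eqI) (simp only: T * a')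
    then show "a' = a" using \<open>inj T\<close> by (simp add: inj_eq)
  qed
  then show ?thesis using * by (simp add: christoffel_def \<phi>_def)
qed

text \<open>This says in coordinates that the covariant derivative of \<open>Y\<close> along itself
  vanishes. Along a trajectory the velocity is \<open>Y\<close>, so differentiating it once by the
  geodesic equation and once by the chain rule gives the two sides.\<close>

lemma geodesic_field_equation:
  assumes "geodesible_with N Y g" "p \<in> points N" "chart_around N c p"
  defines "x \<equiv> cmap c p"
  shows "fderiv (field_in Y c) x (field_in Y c x) =
    - christoffel N g c x (field_in Y c x) (field_in Y c x)"
proof -
  have c: "c \<in> atlas N" "x \<in> cimg c"
    using assms(3) chart_around_atlas cmap_in_cimg by (auto simp: x_def)
  obtain d u where d: "d > 0" and u: "trajectory N Y {-d<..<d} u" "u 0 = p"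
    "\<And>t. t \<in> {-d<..<d} \<Longrightarrow> chart_around N c (u t)"
    using local_trajectory assms(2,3) by metis
  have "geodesic N g {-d<..<d} u" using assms(1) u(1) by (simp add: geodesible_with_def)
  then obtain a where a: "\<And>t. t \<in> {-d<..<d} \<Longrightarrow> ((cmap c \<circ> u) has_vector_derivative a t) (at t) \<and>
      (a has_vector_derivative - christoffel N g c (cmap c (u t)) (a t) (a t)) (at t)"
    using c(1) u(3) unfolding geodesic_def chart_around_def by meson
  have Z: "((cmap c \<circ> u) has_vector_derivative field_in Y c (cmap c (u t))) (at t)"
    if "t \<in> {-d<..<d}" for t
    using u(1) u(3)[OF that] that unfolding trajectory_def field_in_cmap[OF u(3)[OF that]] by blast
  \<comment> \<open>The velocity \<open>a\<close> supplied by the geodesic property is that of the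
    trajectory, by uniqueness of derivatives.\<close>
  have aZ: "a t = field_in Y c (cmap c (u t))" if "t \<in> {-d<..<d}" for t
    using a Z that vector_derivative_unique_at by blast
  have 0: "0 \<in> {-d<..<d}" using d by simp
  have "(a has_vector_derivative - christoffel N g c x (field_in Y c x) (field_in Y c x)) (at 0)"
    using a[OF 0] aZ[OF 0] u(2) by (simp add: x_def)
  then have "((field_in Y c \<circ> (cmap c \<circ> u)) has_vector_derivative
      - christoffel N g c x (field_in Y c x) (field_in Y c x)) (at 0)"
    by (rule has_vector_derivative_transform_within_open[OF _ open_greaterThanLessThan 0])
      (simp add: aZ)
  moreover have "(field_in Y c has_derivative fderiv (field_in Y c) x)
      (at ((cmap c \<circ> u) 0) within range (cmap c \<circ> u))"
    using smooth_on_has_derivative[OF vector_field_smooth[OF vector_field c(1)] c(2)]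
    by (simp add: u(2) x_def has_derivative_at_withinI)
  then have "((field_in Y c \<circ> (cmap c \<circ> u)) has_vector_derivative
      fderiv (field_in Y c) x (field_in Y c x)) (at 0)"
    using vector_derivative_diff_chain_within[OF Z[OF 0]] by (simp add: u(2) x_def)
  ultimately show ?thesis using vector_derivative_unique_at by blast
qed

lemma geodesible_unit_length:
  assumes "geodesible_with N Y g" "c \<in> atlas N" "x \<in> cimg c"
  shows "metric_in N g c x (field_in Y c x) (field_in Y c x) = 1"
proof -
  have a: "chart_around N c (cinv c x)" using assms chart_around_cinv by blast
  obtain d u where d: "d > 0" and u: "trajectory N Y {-d<..<d} u" "u 0 = cinv c x"
    using local_trajectory a chart_around_points by metis
  have "arclength_parameterised N g {-d<..<d} u" using assms(1) u(1) by (simp add: geodesible_with_def)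
  then have "sqrt (g (u 0) (velocity N u 0) (velocity N u 0)) = 1"
    using d by (simp add: arclength_parameterised_def)
  then have "g (cinv c x) (Y (cinv c x)) (Y (cinv c x)) = 1"
    using velocity_trajectory[OF u(1), of 0] d u(2) by simp
  then show ?thesis
    by (simp add: metric_in_def tangent_of_field_in[OF vector_field assms(2,3)])
qed

lemma geodesible_strongly_adapted:
  assumes "riemannian_metric N g" "geodesible_with N Y g"
  shows "strongly_adapted N Y (dual_form g Y)"
proof (rule strongly_adapted_if_invariant)
  fix p v assume p: "p \<in> points N" "v \<in> tangent_space N p"
  define c where "c = chart_at N p"
  define x where "x = cmap c p"
  define G where "G = metric_in N g c"
  define Z where "Z = field_in Y c"
  define w where "w = v c"
  have a: "chart_around N c p" using chart_at p by (simp add: c_def)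
  then have c: "c \<in> atlas N" "x \<in> cimg c" using chart_around_atlas cmap_in_cimg by (auto simp: x_def)
  have sym: "G x v w = G x w v" for v w
    using metric_in_symmetric[OF assms(1) c] by (simp add: G_def)
  \<comment> \<open>The geodesic equation turns the acceleration term of the Lie derivative into
    derivatives of the metric. Two of the three Christoffel terms coincide because both arguments
    are \<open>Z x\<close>, which removes the factor one half in front of them.\<close>
  have "G x (fderiv Z x (Z x)) w = - G x (christoffel N g c x (Z x) (Z x)) w"
    using geodesic_field_equation[OF assms(2) p(1) a]
      linear_neg[OF metric_in_linear(2)[OF assms(1) c]]
    by (simp add: G_def Z_def x_def)
  also have "\<dots> = - fderiv (\<lambda>y. G y (Z x) w) x (Z x)
      + fderiv (\<lambda>y. G y (Z x) (Z x)) x w / 2"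
    unfolding G_def christoffel_eq[OF assms(1) c] by (simp add: field_simps)
  finally have geo: "G x (fderiv Z x (Z x)) w =
      - fderiv (\<lambda>y. G y (Z x) w) x (Z x)
      + fderiv (\<lambda>y. G y (Z x) (Z x)) x w / 2" .
  \<comment> \<open>The function \<open>g(Y, Y)\<close> is constant.
    \<open>has_derivative_linear_apply\<close> lets one vector move at a time, so it is applied to
    the first slot here and to the second slot below.\<close>
  have "((\<lambda>y. G y (Z y) (Z y)) has_derivative
      (\<lambda>u. fderiv (\<lambda>y. G y (Z x) (Z y)) x u
        + G x (fderiv Z x u) (Z x))) (at x)"
  proof (rule has_derivative_linear_apply[OF open_cimg[OF c(1)] c(2)])
    show "linear (\<lambda>v. G y v (Z y))" if "y \<in> cimg c" for y
      using metric_in_linear(2)[OF assms(1) c(1) that] by (simp add: G_def)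
    show "smooth_on (cimg c) (\<lambda>y. G y v (Z y))" for v
      unfolding G_def Z_def
      by (rule smooth_on_linear_apply[OF open_cimg[OF c(1)]])
        (use assms c metric_in_linear metric_in_smooth vector_field_smooth[OF vector_field] in auto)
    show "(Z has_derivative fderiv Z x) (at x)"
      using smooth_on_has_derivative[OF vector_field_smooth[OF vector_field c(1)] c(2)]
      by (simp add: Z_def)
  qed
  moreover have "((\<lambda>y. G y (Z y) (Z y)) has_derivative (\<lambda>u. 0)) (at x)"
    by (rule has_derivative_transform_within_open[OF has_derivative_const[of 1] open_cimg[OF c(1)] c(2)])
      (simp add: G_def Z_def geodesible_unit_length[OF assms(2) c(1)])
  ultimately have "0 = fderiv (\<lambda>y. G y (Z x) (Z y)) x w
        + G x (fderiv Z x w) (Z x)"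
    using has_derivative_unique by (metis (no_types, lifting))
  moreover have "fderiv (\<lambda>y. G y (Z x) (Z y)) x w =
      fderiv (\<lambda>y. G y (Z x) (Z x)) x w + G x (Z x) (fderiv Z x w)"
  proof -
    have "((\<lambda>y. G y (Z x) (Z y)) has_derivative
      (\<lambda>u. fderiv (\<lambda>y. G y (Z x) (Z x)) x u
        + G x (Z x) (fderiv Z x u))) (at x)"
      unfolding G_def Z_def
      by (rule has_derivative_linear_apply[OF open_cimg[OF c(1)] c(2)])
        (use assms c metric_in_linear metric_in_smooth
          smooth_on_has_derivative[OF vector_field_smooth[OF vector_field]] in auto)
    then show ?thesis by (simp add: frechet_derivative_eqI)
  qed
  ultimately have unit: "fderiv (\<lambda>y. G y (Z x) (Z x)) x w =
      - 2 * G x (Z x) (fderiv Z x w)"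
    using sym[of "fderiv Z x w" "Z x"] by simp
  \<comment> \<open>By \<open>geo\<close> the derivative of the metric along \<open>Z\<close>
    cancels, leaving half its derivative along \<open>w\<close> plus
    \<open>G x (Z x) (fderiv Z x w)\<close>; by \<open>unit\<close> these two cancel.\<close>
  show "lie_form N Y (dual_form g Y) p v = 0"
    using lie_form_dual[OF assms(1) p(1), of v] geo unit
    by (simp add: G_def Z_def c_def x_def w_def)
qed (use assms one_form_dual dual_form_pos in auto)

end

section \<open>Anosov flows with smooth splitting\<close>

lemma second_countable_euclidean:
  "second_countable (euclidean :: 'a::second_countable_topology topology)"
proof -
  obtain B :: "'a set set" where B: "countable B" "topological_basis B"
    using ex_countable_basis by blast
  then show ?thesis
    unfolding second_countable_def
    using topological_basis_open[OF B(2)] topological_basisE[OF B(2)]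
    by (intro exI[of _ B]) (simp, metis)
qed

lemma smooth_real_line: "smooth_manifold real_line"
  unfolding smooth_manifold_def
proof (intro conjI)
  show "\<exists>B::real set. finite B \<and> span B = UNIV"
    by (intro exI[of _ Basis] conjI finite_Basis span_Basis)
  have [simp]: "cimg (UNIV, id) = UNIV" by (auto simp: cimg_def)
  show "\<forall>c\<in>atlas real_line. openin (mtop real_line) (cdom c) \<and> open (cimg c) \<and>
      homeomorphic_map (subtopology (mtop real_line) (cdom c)) (top_of_set (cimg c)) (cmap c)"
    by (simp add: real_line_def)
  have "id \<circ> cinv (UNIV, id) = (\<lambda>x::real. x)"
    by (auto simp: cinv_def fun_eq_iff intro: inv_into_f_f)
  then show "\<forall>c\<in>atlas real_line. \<forall>d\<in>atlas real_line.
      smooth_on (cmap c ` (cdom c \<inter> cdom d)) (cmap d \<circ> cinv c)"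
    by (simp add: real_line_def smooth_on_ident)
qed (simp_all add: real_line_def second_countable_euclidean)

text \<open>The assumption on \<open>A\<close> is differentiated at \<open>t = 0\<close>; the mixed derivative of \<open>\<psi>\<close> is \<open>DZ(x)(v)\<close>
  because second derivatives are symmetric.\<close>

lemma lie_derivative_flow_zero:
  fixes \<psi> :: "real \<times> 'e::euclidean_space \<Rightarrow> 'e"
  assumes "open S" "open T" "smooth_on S \<psi>" "\<psi> ` S \<subseteq> T" "x \<in> T"
    and \<psi>0: "\<And>y. y \<in> T \<Longrightarrow> (0, y) \<in> S" "\<And>y. y \<in> T \<Longrightarrow> \<psi> (0, y) = y"
    and dt: "\<And>r. r \<in> S \<Longrightarrow> fderiv \<psi> r (1, 0) = Z (\<psi> r)"
    and Z: "smooth_on T Z"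
    and A: "\<And>y. y \<in> T \<Longrightarrow> linear (A y)" "\<And>v. smooth_on T (\<lambda>y. A y v :: real)"
    and ann: "\<And>t. (t, x) \<in> S \<Longrightarrow> A (\<psi> (t, x)) (fderiv \<psi> (t, x) (0, v)) = 0"
  shows "fderiv (\<lambda>y. A y v) x (Z x) + A x (fderiv Z x v) = 0"
proof -
  define w where "w r = fderiv \<psi> r (0, v)" for r
  have 0: "(0, x) \<in> S" "\<psi> (0, x) = x" using \<psi>0 assms(5) by auto
  note D\<psi> = smooth_on_has_derivative[OF assms(3)]
  \<comment> \<open>At time 0 the flow is the identity in space, hence so is its spatial
    derivative.\<close>
  have Dv: "fderiv \<psi> (0, y) (0, u) = u" if "y \<in> T" for y u
  proof -
    have h1: "((\<lambda>y. \<psi> (0, y)) has_derivative (\<lambda>u. fderiv \<psi> (0, y) (0, u))) (at y)"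
      by (rule has_derivative_compose[where f = "\<lambda>y. (0, y)" and f' = "\<lambda>u. (0, u)", OF _
            D\<psi>[OF \<psi>0(1)[OF that]]]) (auto intro!: derivative_eq_intros)
    have h2: "((\<lambda>y. \<psi> (0, y)) has_derivative (\<lambda>u. u)) (at y)"
      by (rule has_derivative_transform_within_open[OF has_derivative_ident assms(2) that])
        (simp add: \<psi>0)
    show ?thesis using fun_cong[OF has_derivative_unique[OF h1 h2], of u] .
  qed
  have w: "smooth_on S w" unfolding w_def by (rule smooth_on_frechet_derivative[OF assms(3)])
  have w0: "w (0, x) = v" using Dv assms(5) by (simp add: w_def)
  have D: "((\<lambda>r. A (\<psi> r) (w r)) has_derivative
      (\<lambda>u. fderiv (\<lambda>r. A (\<psi> r) (w (0, x))) (0, x) u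
        + A (\<psi> (0, x)) (fderiv w (0, x) u))) (at (0, x))"
  proof (rule has_derivative_linear_apply[OF assms(1) 0(1)])
    show "linear (A (\<psi> r))" if "r \<in> S" for r using A(1) assms(4) that by blast
    show "smooth_on S (\<lambda>r. A (\<psi> r) u)" for u
      by (rule smooth_on_compose[OF assms(1,2,4,3) A(2)])
  qed (rule smooth_on_has_derivative[OF w 0(1)])
  have h1: "((\<lambda>t. A (\<psi> (t, x)) (w (t, x))) has_derivative
      (\<lambda>s. fderiv (\<lambda>r. A (\<psi> r) v) (0, x) (s, 0)
        + A x (fderiv w (0, x) (s, 0)))) (at 0)"
    by (rule has_derivative_compose[where f = "\<lambda>t. (t, x)" and f' = "\<lambda>s. (s, 0)", OF _
          D[unfolded 0 w0]]) (auto intro!: derivative_eq_intros)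
  have h2: "((\<lambda>t. A (\<psi> (t, x)) (w (t, x))) has_derivative (\<lambda>s. 0)) (at 0)"
  proof (rule has_derivative_transform_within_open[OF has_derivative_const])
    show "open ((\<lambda>t. (t, x)) -` S)"
      by (intro continuous_open_vimage assms(1)) (auto intro!: continuous_intros)
  qed (use ann 0 in \<open>auto simp: w_def\<close>)
  have sum0: "fderiv (\<lambda>r. A (\<psi> r) v) (0, x) (1, 0)
        + A x (fderiv w (0, x) (1, 0)) = 0"
    using fun_cong[OF has_derivative_unique[OF h1 h2], of 1] .
  have "((\<lambda>r. A (\<psi> r) v) has_derivative
      (\<lambda>u. fderiv (\<lambda>y. A y v) x (fderiv \<psi> (0, x) u))) (at (0, x))"
    by (rule has_derivative_compose[where g = "\<lambda>y. A y v" and f = \<psi>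
          and g' = "fderiv (\<lambda>y. A y v) x", OF D\<psi>[OF 0(1)]])
      (simp only: 0(2) smooth_on_has_derivative[OF A(2) assms(5)])
  then have 1: "fderiv (\<lambda>r. A (\<psi> r) v) (0, x) (1, 0) =
      fderiv (\<lambda>y. A y v) x (Z x)"
    using dt[OF 0(1)] 0(2) by (simp add: frechet_derivative_eqI)
  \<comment> \<open>The time derivative of the spatial derivative is exchanged for the spatial
    derivative of the time derivative, which is \<open>Z\<close> along the flow by
    \<open>dt\<close>.\<close>
  have "fderiv w (0, x) (1, 0) =
      fderiv (\<lambda>r. fderiv \<psi> r (1, 0)) (0, x) (0, v)"
    unfolding w_def by (rule second_derivative_symmetric[OF assms(1,3) 0(1)])
  also have "\<dots> = fderiv (\<lambda>r. Z (\<psi> r)) (0, x) (0, v)"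
    using frechet_derivative_cong_open[OF assms(1) 0(1) dt] by simp
  also have "\<dots> = fderiv Z x v"
  proof -
    have "((\<lambda>r. Z (\<psi> r)) has_derivative
        (\<lambda>u. fderiv Z x (fderiv \<psi> (0, x) u))) (at (0, x))"
      by (rule has_derivative_compose[where g = Z and f = \<psi>
            and g' = "fderiv Z x", OF D\<psi>[OF 0(1)]])
        (simp only: 0(2) smooth_on_has_derivative[OF Z assms(5)])
    then show ?thesis using Dv[OF assms(5)] by (simp add: frechet_derivative_eqI)
  qed
  finally show ?thesis using sum0 1 by simp
qed

section \<open>Smooth subbundles and their local frames\<close>

context smooth_mfd
begin

lemma smooth_subbundleE:
  assumes "smooth_subbundle N E" "p \<in> points N"
  obtains c W k b where "chart_around N c p" "open W" "cmap c p \<in> W" "W \<subseteq> cimg c"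
    "\<And>i::nat. i < k \<Longrightarrow> smooth_on W (b i)"
    "\<And>x. x \<in> W \<Longrightarrow> inj_on (\<lambda>i. b i x) {..<k} \<and> independent (frame b k x) \<and>
      (\<lambda>v. v c) ` E (cinv c x) = span (frame b k x)"
  using conjunct2[OF bspec[OF assms(1)[unfolded smooth_subbundle_def] assms(2)]]
proof (elim exE conjE)
  fix c W and k :: nat and b
  assume *: "chart_around N c p" "open W" "cmap c p \<in> W" "W \<subseteq> cimg c" "\<forall>i<k. smooth_on W (b i)"
    "\<forall>x\<in>W. inj_on (\<lambda>i. b i x) {..<k} \<and> independent (frame b k x) \<and>
      (\<lambda>v. v c) ` E (cinv c x) = span (frame b k x)"
  show thesis by (rule that[OF *(1-4) *(5)[rule_format] *(6)[rule_format]])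
qed

lemma smooth_subbundle_tangent:
  "smooth_subbundle N E \<Longrightarrow> p \<in> points N \<Longrightarrow> v \<in> E p \<Longrightarrow> v \<in> tangent_space N p"
  by (auto simp: smooth_subbundle_def)

lemma smooth_subbundle_components:
  assumes "smooth_subbundle N E" "p \<in> points N"
  obtains c B where "chart_around N c p" "(\<lambda>v. v c) ` E p = span B"
proof -
  obtain c W k b where c: "chart_around N c p" "cmap c p \<in> W"
    "\<And>x. x \<in> W \<Longrightarrow> inj_on (\<lambda>i. b i x) {..<k} \<and> independent (frame b k x) \<and>
      (\<lambda>v. v c) ` E (cinv c x) = span (frame b k x)"
    by (rule smooth_subbundleE[OF assms]) blast
  show thesis using that[OF c(1)] c(3)[OF c(2)] by (simp add: cinv_cmap[OF c(1)])
qed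

lemma smooth_subbundle_zero:
  assumes "smooth_subbundle N E" "p \<in> points N"
  shows "(\<lambda>_. 0) \<in> E p"
proof -
  obtain c B where c: "chart_around N c p" "(\<lambda>v. v c) ` E p = span B"
    using smooth_subbundle_components[OF assms] .
  then have "0 \<in> (\<lambda>v. v c) ` E p" by (simp only: span_zero)
  then obtain v where v: "0 = v c" "v \<in> E p" by (rule imageE)
  have "v = (\<lambda>_. 0)"
    using tangent_eqI[OF smooth_subbundle_tangent[OF assms v(2)] tangent_space_zero c(1)] v by simp
  then show ?thesis using v by simp
qed

end

text \<open>A smooth subbundle comes with a frame near \<open>p\<close> in some chart
  \<open>d\<close>, whereas smoothness of a form has to be checked in every chart. The Jacobian of
  the change from \<open>d\<close> to \<open>c\<close> depends smoothly on the point and is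
  invertible, so it carries the frame to \<open>c\<close> and preserves independence.\<close>

lemma (in euclidean_flow) smooth_frame_in_chart:
  assumes "smooth_subbundle N E" "chart_around N c p"
  obtains W k b where "open W" "cmap c p \<in> W" "W \<subseteq> cimg c"
    "\<And>i::nat. i < k \<Longrightarrow> smooth_on W (b i)"
    "\<And>x i. x \<in> W \<Longrightarrow> i < k \<Longrightarrow> b i x \<notin> span (frame b i x)"
    "\<And>x. x \<in> W \<Longrightarrow> (\<lambda>v. v c) ` E (cinv c x) = span (frame b k x)"
proof -
  have p: "p \<in> points N" using assms chart_around_points by blast
  obtain d V k f where d: "chart_around N d p" "open V" "cmap d p \<in> V" "V \<subseteq> cimg d"
    "\<And>i::nat. i < k \<Longrightarrow> smooth_on V (f i)"
    "\<And>x. x \<in> V \<Longrightarrow> inj_on (\<lambda>i. f i x) {..<k} \<and> independent (frame f k x) \<and>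
      (\<lambda>v. v d) ` E (cinv d x) = span (frame f k x)"
    by (rule smooth_subbundleE[OF assms(1) p]) blast
  have at: "c \<in> atlas N" "d \<in> atlas N" using assms(2) d(1) chart_around_atlas by auto
  define O1 where "O1 = cmap c ` (cdom c \<inter> cdom d)"
  define O2 where "O2 = cmap d ` (cdom d \<inter> cdom c)"
  define \<tau> where "\<tau> = transition c d"
  define W where "W = O1 \<inter> \<tau> -` V"
  define D where "D x = fderiv (transition d c) (\<tau> x)" for x
  define b where "b i x = D x (f i (\<tau> x))" for i x
  have sm\<tau>: "smooth_on O1 \<tau>" using at smooth_transition by (simp add: O1_def \<tau>_def)
  have opO: "open O1" "open O2" using at open_overlap by (auto simp: O1_def O2_def)
  have opW: "open W"
    unfolding W_def using smooth_on_imp_continuous_on[OF sm\<tau>] d(2) opO(1)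
    by (simp add: continuous_on_open_vimage Int_commute)
  have sm\<tau>W: "smooth_on W \<tau>" using smooth_on_subset[OF _ sm\<tau>] by (simp add: W_def)
  have q: "chart_around N c (cinv c x)" "chart_around N d (cinv c x)" "cmap c (cinv c x) = x"
    "cmap d (cinv c x) = \<tau> x" "cinv d (\<tau> x) = cinv c x" "\<tau> x \<in> V" "x \<in> cimg c" if "x \<in> W" for x
  proof -
    have x: "x \<in> cimg c" "cinv c x \<in> cdom d"
      using that cinv_image_overlap[OF at(1)] by (auto simp: W_def O1_def)
    show a: "chart_around N c (cinv c x)" "chart_around N d (cinv c x)"
      using chart_around_cinv[OF at(1) x(1)] x(2) at(2) by (auto simp: chart_around_def)
    show "cmap c (cinv c x) = x" "x \<in> cimg c" using cmap_cinv[OF x(1)] x(1) by simp_all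
    show "cmap d (cinv c x) = \<tau> x" by (simp add: \<tau>_def)
    then show "cinv d (\<tau> x) = cinv c x" using cinv_cmap[OF a(2)] by simp
    show "\<tau> x \<in> V" using that by (simp add: W_def)
  qed
  have Djac: "D x = jacobian d c (cinv c x)" if "x \<in> W" for x
    using q(4)[OF that] by (simp add: D_def)
  have linD: "linear (D x)" if "x \<in> W" for x
    using Djac[OF that] linear_jacobian[OF q(2)[OF that] q(1)[OF that]] by simp
  \<comment> \<open>By the chain rule, the Jacobian of the opposite change of charts is a left
    inverse.\<close>
  have injD: "inj (D x)" if "x \<in> W" for x
    using jacobian_chain[OF q(2)[OF that] q(1)[OF that] q(2)[OF that]]
      jacobian_self[OF q(2)[OF that]] Djac[OF that] by (metis injI)
  show thesis
  proof (rule that[OF opW])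
    have "cmap c p \<in> O1" "\<tau> (cmap c p) = cmap d p"
      using assms(2) d(1) cinv_cmap[OF assms(2)] by (simp_all add: O1_def \<tau>_def chart_around_def)
    then show "cmap c p \<in> W" using d(3) by (simp add: W_def)
    show "W \<subseteq> cimg c" using q(7) by blast
    show "smooth_on W (b i)" if "i < k" for i
      unfolding b_def
    proof (rule smooth_on_linear_apply[OF opW linD])
      have "\<tau> ` W \<subseteq> O2"
      proof
        fix y assume "y \<in> \<tau> ` W"
        then obtain x where x: "x \<in> W" "y = \<tau> x" by blast
        then have "y = cmap d (cinv c x)" using q(4) by simp
        then show "y \<in> O2" using q(1,2)[OF x(1)] by (auto simp: O2_def chart_around_def)
      qed
      then show "smooth_on W (\<lambda>x. D x v)" for v
        unfolding D_def
        using smooth_on_compose[OF opW opO(2) _ sm\<tau>W smooth_on_frechet_derivative[OF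
              smooth_transition[OF at(2,1), folded O2_def]]] by blast
      show "smooth_on W (\<lambda>x. f i (\<tau> x))"
        by (rule smooth_on_compose[OF opW d(2) _ sm\<tau>W d(5)[OF that]]) (use q(6) in blast)
    qed
    show "b i x \<notin> span (frame b i x)" if x: "x \<in> W" and i: "i < k" for x i
    proof
      assume "b i x \<in> span (frame b i x)"
      moreover have "frame b i x = D x ` (frame f i (\<tau> x))"
        by (auto simp: b_def)
      ultimately have "D x (f i (\<tau> x)) \<in> D x ` span (frame f i (\<tau> x))"
        using linear_span_image[OF linD[OF x]] by (simp add: b_def)
      then have "f i (\<tau> x) \<in> span (frame f i (\<tau> x))"
        using injD[OF x] by (simp add: inj_image_mem_iff)
      moreover have "frame f i (\<tau> x) \<subseteq> frame f k (\<tau> x) - {f i (\<tau> x)}"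
      proof -
        have "inj_on (\<lambda>j. f j (\<tau> x)) {..<k}" using d(6) q(6)[OF x] by blast
        then show ?thesis using i by (auto dest: inj_onD)
      qed
      ultimately have "f i (\<tau> x) \<in> span (frame f k (\<tau> x) - {f i (\<tau> x)})"
        using span_mono by blast
      then show False using d(6)[OF q(6)[OF x]] i unfolding dependent_def by blast
    qed
    show "(\<lambda>v. v c) ` E (cinv c x) = span (frame b k x)" if x: "x \<in> W" for x
    proof -
      have *: "v c = D x (v d)" if "v \<in> E (cinv c x)" for v
        using tangent_spaceD(2)[OF smooth_subbundle_tangent[OF assms(1) _ that] q(2)[OF x] q(1)[OF x]]
          chart_around_points[OF q(1)[OF x]] Djac[OF x] by simp
      have "(\<lambda>v. v c) ` E (cinv c x) = (\<lambda>v. D x (v d)) ` E (cinv c x)"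
        by (rule image_cong[OF refl *])
      also have "\<dots> = D x ` (\<lambda>v. v d) ` E (cinv d (\<tau> x))"
        by (simp add: image_image q(5)[OF x])
      also have "\<dots> = span (D x ` frame f k (\<tau> x))"
        using d(6)[OF q(6)[OF x]] linear_span_image[OF linD[OF x]] by simp
      finally show ?thesis by (simp add: b_def image_image)
    qed
  qed
qed

section \<open>Lie derivatives along an invariant bundle and along the flow direction\<close>

context euclidean_flow
begin

text \<open>The derivative of the flow carries a vector of \<open>E\<close> at \<open>p\<close> to
  vectors of \<open>E\<close>, which \<open>\<theta>\<close> annihilates. Hence the pullback of
  \<open>\<theta>\<close> under the flow maps vanishes on that vector for all times at which the
  orbit is in the chart, and so does its derivative at time 0.\<close>

lemma lie_form_zero_of_invariant_bundle:
  assumes flow: "flow_maps N Y \<Psi>" and \<theta>: "one_form N \<theta>"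
    and E: "\<And>q. q \<in> points N \<Longrightarrow> E q \<subseteq> tangent_space N q" "\<And>q u. q \<in> points N \<Longrightarrow> u \<in> E q \<Longrightarrow> \<theta> q u = 0"
    and inv: "\<And>t. tangent_map N N (\<Psi> t) p ` E p = E (\<Psi> t p)"
    and p: "p \<in> points N" and v: "v \<in> E p"
  shows "lie_form N Y \<theta> p v = 0"
proof -
  define c where "c = chart_at N p"
  define x where "x = cmap c p"
  define F where "F = (\<lambda>(t, q). \<Psi> t q)"
  define C where "C = prod_chart (UNIV, id :: real \<Rightarrow> real) c"
  \<comment> \<open>\<open>\<psi>\<close> is the flow in coordinates. Its domain \<open>S\<close>
    collects the times and starting points in the chart for which the flow ends in the chart again;
    it is open by continuity of the flow but need not be a product, so
    \<open>lie_derivative_flow_zero\<close> is stated for a general open set.\<close>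
  define \<psi> where "\<psi> = cmap c \<circ> F \<circ> cinv C"
  define S where "S = cmap C ` (cdom C \<inter> {r. F r \<in> cdom c})"
  have a: "chart_around N c p" using chart_at p by (simp add: c_def)
  then have c: "c \<in> atlas N" "x \<in> cimg c" using chart_around_atlas cmap_in_cimg by (auto simp: x_def)
  have cinv_x: "cinv c x = p" using cinv_cmap[OF a] by (simp add: x_def)
  have P: "smooth_manifold (prod_manifold real_line N)"
    by (rule smooth_prod_manifold[OF smooth_real_line smooth_manifold])
  interpret P: smooth_mfd "prod_manifold real_line N" by unfold_locales fact
  have line: "(UNIV, id) \<in> atlas real_line" by (simp add: real_line_def)
  have C: "C \<in> atlas (prod_manifold real_line N)"
    unfolding C_def by (rule prod_chart_in_atlas[OF line c(1)])
  have cimg_line: "cimg (UNIV, id :: real \<Rightarrow> real) = UNIV" by (simp add: cimg_def)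
  have cinv_line: "cinv (UNIV, id :: real \<Rightarrow> real) t = t" for t
    using cmap_cinv[of t "(UNIV, id)"] by (simp add: cimg_line cinv_def inv_into_f_f[of id UNIV, simplified])
  have cinvC: "cinv C (t, y) = (t, cinv c y)" if "y \<in> cimg c" for t y
    using cinv_prod_chart[OF smooth_real_line smooth_manifold line c(1) _ that, of t]
    by (simp add: C_def cimg_line cinv_line)
  have smooth: "continuous_map (mtop (prod_manifold real_line N)) (mtop N) F"
    "smooth_on (cmap C ` {r \<in> cdom C. F r \<in> cdom c}) \<psi>"
    using flow C c(1) unfolding flow_maps_def smooth_map_def F_def[symmetric] \<psi>_def by blast+
  have S_eq: "S = cmap C ` {r \<in> cdom C. F r \<in> cdom c}" unfolding S_def by (rule arg_cong) blast
  have smS: "smooth_on S \<psi>" using smooth(2) S_eq by simp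
  have opS: "open S"
    unfolding S_eq
  proof (rule P.open_cmap_image[OF C])
    have "{r \<in> cdom C. F r \<in> cdom c} = cdom C \<inter> {r \<in> points (prod_manifold real_line N). F r \<in> cdom c}"
      using P.cdom_subset[OF C] by blast
    then show "openin (mtop (prod_manifold real_line N)) {r \<in> cdom C. F r \<in> cdom c}"
      using openin_continuous_map_preimage[OF smooth(1) openin_cdom[OF c(1)]] P.openin_cdom[OF C]
      by (simp add: openin_Int)
  qed blast
  have S_iff: "(t, y) \<in> S \<longleftrightarrow> y \<in> cimg c \<and> Fs t (cinv c y)" if "Fs = (\<lambda>t q. \<Psi> t q \<in> cdom c)" for t y Fs
  proof -
    have "(t, y) \<in> S \<longleftrightarrow> (t, y) \<in> cimg C \<and> cinv C (t, y) \<in> {r. F r \<in> cdom c}"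
      unfolding S_def by (rule P.cinv_image_overlap[OF C])
    moreover have "(t, y) \<in> cimg C \<longleftrightarrow> y \<in> cimg c" by (simp add: C_def cimg_line)
    ultimately show ?thesis using cinvC[of y t] by (auto simp: that F_def)
  qed
  note S_iff = S_iff[OF refl]
  have \<psi>: "\<psi> (t, y) = cmap c (\<Psi> t (cinv c y))" if "y \<in> cimg c" for t y
    using cinvC[OF that] by (simp add: \<psi>_def F_def)
  have around: "chart_around N c (\<Psi> t (cinv c y))" "cinv c y \<in> points N" if "(t, y) \<in> S" for t y
    using that c(1) chart_around_cinv[OF c(1), of y] chart_around_points
    by (auto simp: S_iff chart_around_def)
  have flow0: "\<Psi> 0 q = q" "trajectory N Y UNIV (\<lambda>t. \<Psi> t q)" if "q \<in> points N" for q
    using flow that by (auto simp: flow_maps_def)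
  have "fderiv (\<lambda>y. form_in N \<theta> c y (v c)) x (field_in Y c x)
      + form_in N \<theta> c x (fderiv (field_in Y c) x (v c)) = 0"
  proof (rule lie_derivative_flow_zero[OF opS open_cimg[OF c(1)] smS _ c(2)])
    show "\<psi> ` S \<subseteq> cimg c"
    proof
      fix z assume "z \<in> \<psi> ` S"
      then obtain t y where "(t, y) \<in> S" "z = \<psi> (t, y)" by auto
      then show "z \<in> cimg c"
        using cmap_in_cimg[OF around(1)] by (simp add: \<psi> S_iff)
    qed
    fix y assume y: "y \<in> cimg c"
    then have q: "\<Psi> 0 (cinv c y) = cinv c y"
      using flow0(1) chart_around_points[OF chart_around_cinv[OF c(1) y]] by blast
    then show "(0, y) \<in> S" "\<psi> (0, y) = y"
      using y chart_around_cinv[OF c(1) y] cmap_cinv[OF y]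
      by (simp_all add: S_iff \<psi> chart_around_def)
  next
    fix r assume r: "r \<in> S"
    obtain t y where [simp]: "r = (t, y)" by (cases r)
    have ty: "(t, y) \<in> S" "y \<in> cimg c" using r by (auto simp: S_iff)
    have "((\<lambda>s. \<psi> (s, y)) has_derivative (\<lambda>s. fderiv \<psi> (t, y) (s, 0))) (at t)"
      by (rule has_derivative_compose[where f = "\<lambda>s. (s, y)" and f' = "\<lambda>s. (s, 0)", OF _
            smooth_on_has_derivative[OF smS ty(1)]]) (auto intro!: derivative_eq_intros)
    moreover have "((cmap c \<circ> (\<lambda>t. \<Psi> t (cinv c y))) has_vector_derivative Y (\<Psi> t (cinv c y)) c) (at t)"
      using flow0(2)[OF around(2)[OF ty(1)]] around(1)[OF ty(1)] unfolding trajectory_def by blast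
    then have "((\<lambda>s. \<psi> (s, y)) has_derivative (\<lambda>s. s *\<^sub>R Y (\<Psi> t (cinv c y)) c)) (at t)"
      by (simp add: \<psi>[OF ty(2)] o_def has_vector_derivative_def)
    ultimately have "fderiv \<psi> (t, y) (1, 0) = 1 *\<^sub>R Y (\<Psi> t (cinv c y)) c"
      by (rule fun_cong[OF has_derivative_unique])
    then show "fderiv \<psi> r (1, 0) = field_in Y c (\<psi> r)"
      by (simp add: \<psi>[OF ty(2)] field_in_cmap[OF around(1)[OF ty(1)]])
  next
    show "smooth_on (cimg c) (field_in Y c)" by (rule vector_field_smooth[OF vector_field c(1)])
    show "linear (form_in N \<theta> c y)" if "y \<in> cimg c" for y using \<theta> c(1) that by (simp add: one_form_def)
    show "smooth_on (cimg c) (\<lambda>y. form_in N \<theta> c y u)" for u using \<theta> c(1) by (simp add: one_form_def)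
  next
    fix t assume t: "(t, x) \<in> S"
    define W where "W = tangent_map N N (\<Psi> t) p v"
    have q: "chart_around N c (\<Psi> t p)" "\<Psi> t p \<in> points N"
      using around(1)[OF t] chart_around_points by (auto simp: cinv_x)
    have W: "W \<in> E (\<Psi> t p)" using inv v by (auto simp: W_def)
    have "((\<lambda>y. \<psi> (t, y)) has_derivative (\<lambda>u. fderiv \<psi> (t, x) (0, u))) (at x)"
      by (rule has_derivative_compose[where f = "\<lambda>y. (t, y)" and f' = "\<lambda>u. (0, u)", OF _
            smooth_on_has_derivative[OF smS t]]) (auto intro!: derivative_eq_intros)
    then have "((cmap c \<circ> \<Psi> t \<circ> cinv c) has_derivative
        (\<lambda>u. fderiv \<psi> (t, x) (0, u))) (at x)"
      by (rule has_derivative_transform_within_open[OF _ open_cimg[OF c(1)] c(2)]) (simp add: \<psi>)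
    \<comment> \<open>\<open>tangent_map\<close> differentiates through \<open>chart_at N p\<close>,
      which is \<open>c\<close>; its component in \<open>c\<close> is therefore the spatial
      derivative of \<open>\<psi>\<close>.\<close>
    then have "W c = fderiv \<psi> (t, x) (0, v c)"
      using q(1) by (simp add: W_def tangent_map_def Let_def frechet_derivative_eqI
          flip: c_def x_def)
    moreover have "form_in N \<theta> c (\<psi> (t, x)) (W c) = \<theta> (\<Psi> t p) W"
      using tangent_of_eq[of W "\<Psi> t p" c] E(1)[OF q(2)] W q(1)
      by (auto simp: form_in_def \<psi>[OF c(2)] cinv_x cinv_cmap[OF q(1)])
    ultimately show "form_in N \<theta> c (\<psi> (t, x)) (fderiv \<psi> (t, x) (0, v c)) = 0"
      using E(2)[OF q(2) W] by simp
  qed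
  then show ?thesis by (simp add: lie_form_def Let_def flip: c_def x_def)
qed

text \<open>Linearity is expressed through components in \<open>chart_at N p\<close>, since
  decompositions of tangent vectors are given as componentwise sums.\<close>

lemma linear_lie_form:
  assumes \<theta>: "one_form N \<theta>" and p: "p \<in> points N"
  shows "\<exists>l. linear l \<and> (\<forall>v. lie_form N Y \<theta> p v = l (v (chart_at N p)))"
proof (intro exI conjI allI)
  let ?c = "chart_at N p"
  let ?x = "cmap ?c p"
  let ?A = "form_in N \<theta> ?c"
  have a: "chart_around N ?c p" using chart_at p .
  then have c: "?c \<in> atlas N" "?x \<in> cimg ?c" using chart_around_atlas cmap_in_cimg by auto
  have A: "\<And>y. y \<in> cimg ?c \<Longrightarrow> linear (?A y)" "\<And>v. smooth_on (cimg ?c) (\<lambda>y. ?A y v)"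
    using \<theta> c(1) by (simp_all add: one_form_def)
  have "linear (fderiv (field_in Y ?c) ?x)"
    by (rule smooth_on_linear_derivative[OF vector_field_smooth[OF vector_field c(1)] c(2)])
  then have "linear (\<lambda>u. ?A ?x (fderiv (field_in Y ?c) ?x u))"
    using linear_compose[OF _ A(1)[OF c(2)]] by (simp add: o_def)
  then show "linear (\<lambda>u. fderiv (\<lambda>y. ?A y u) ?x (field_in Y ?c ?x)
      + ?A ?x (fderiv (field_in Y ?c) ?x u))"
    by (intro linear_compose_add linear_fderiv_parameter[OF open_cimg[OF c(1)] c(2) A])
qed (simp add: lie_form_def Let_def)

text \<open>On \<open>Y\<close> itself the Lie derivative of \<open>\<theta>\<close> is the
  derivative of \<open>\<theta>(Y)\<close> along \<open>Y\<close>, because the bracket of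
  \<open>Y\<close> with itself vanishes; in coordinates this is the product rule in direction
  \<open>Z x\<close>. The function differentiated is constant.\<close>

lemma lie_form_field_zero:
  assumes \<theta>: "one_form N \<theta>" and one: "\<And>q. q \<in> points N \<Longrightarrow> \<theta> q (Y q) = 1" and p: "p \<in> points N"
  shows "lie_form N Y \<theta> p (Y p) = 0"
proof -
  define c where "c = chart_at N p"
  define x where "x = cmap c p"
  define Z where "Z = field_in Y c"
  define A where "A = form_in N \<theta> c"
  have a: "chart_around N c p" using chart_at p by (simp add: c_def)
  then have c: "c \<in> atlas N" "x \<in> cimg c" using chart_around_atlas cmap_in_cimg by (auto simp: x_def)
  have A: "\<And>y. y \<in> cimg c \<Longrightarrow> linear (A y)" "\<And>v. smooth_on (cimg c) (\<lambda>y. A y v)"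
    using \<theta> c(1) by (simp_all add: one_form_def A_def)
  have Z: "smooth_on (cimg c) Z" unfolding Z_def by (rule vector_field_smooth[OF vector_field c(1)])
  have AZ: "A y (Z y) = 1" if "y \<in> cimg c" for y
    using one chart_around_points[OF chart_around_cinv[OF c(1) that]]
    by (simp add: A_def Z_def form_in_def tangent_of_field_in[OF vector_field c(1) that])
  have h1: "((\<lambda>y. A y (Z y)) has_derivative (\<lambda>u. fderiv (\<lambda>y. A y (Z x)) x u
      + A x (fderiv Z x u))) (at x)"
    by (rule has_derivative_linear_apply[OF open_cimg[OF c(1)] c(2) A
          smooth_on_has_derivative[OF Z c(2)]])
  have h2: "((\<lambda>y. A y (Z y)) has_derivative (\<lambda>u. 0)) (at x)"
    by (rule has_derivative_transform_within_open[OF has_derivative_const[of 1] open_cimg[OF c(1)] c(2)])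
      (simp add: AZ)
  have "Y p c = Z x" using field_in_cmap[OF a] by (simp add: Z_def x_def)
  then show ?thesis
    using fun_cong[OF has_derivative_unique[OF h1 h2], of "Z x"]
    by (simp add: lie_form_def Let_def Z_def A_def flip: c_def x_def)
qed

end

section \<open>The canonical form of a smooth splitting\<close>

locale smooth_splitting = euclidean_flow N Y
  for N :: "('a, 'e::euclidean_space) manifold" and Y :: "('a, 'e) field" +
  fixes Ep Em :: "'a \<Rightarrow> ('a, 'e) tangent set"
  assumes Ep: "smooth_subbundle N Ep" and Em: "smooth_subbundle N Em"
    and splits: "splitting N Y Ep Em"
begin

abbreviation combination ::
  "'a \<Rightarrow> real \<times> ('a, 'e) tangent \<times> ('a, 'e) tangent \<Rightarrow> ('a, 'e) tangent" where
  "combination p \<equiv> \<lambda>(a, v1, v2) c. a *\<^sub>R Y p c + v1 c + v2 c"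

lemma decomposition:
  assumes "p \<in> points N" "v \<in> tangent_space N p"
  obtains a v1 v2 where "v1 \<in> Ep p" "v2 \<in> Em p" "v = combination p (a, v1, v2)"
proof -
  have "\<exists>!(a, v1, v2). v1 \<in> Ep p \<and> v2 \<in> Em p \<and> v = (\<lambda>c. a *\<^sub>R Y p c + v1 c + v2 c)"
    using splits assms unfolding splitting_def by blast
  then show thesis using that by (auto elim!: ex1E)
qed

lemma combination_tangent:
  assumes "p \<in> points N" "v1 \<in> Ep p" "v2 \<in> Em p"
  shows "combination p (a, v1, v2) \<in> tangent_space N p"
  using tangent_space_add[OF tangent_space_add[OF tangent_space_scale[OF
        vector_field_tangent[OF vector_field assms(1)]]]]
    smooth_subbundle_tangent[OF Ep assms(1,2)] smooth_subbundle_tangent[OF Em assms(1,3)] by simp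

lemma combination_unique:
  assumes "p \<in> points N" "v1 \<in> Ep p" "v2 \<in> Em p" "w1 \<in> Ep p" "w2 \<in> Em p"
    "combination p (a, v1, v2) = combination p (b, w1, w2)"
  shows "a = b \<and> v1 = w1 \<and> v2 = w2"
proof -
  let ?P = "\<lambda>(b, w1, w2). w1 \<in> Ep p \<and> w2 \<in> Em p \<and>
    combination p (a, v1, v2) = (\<lambda>c. b *\<^sub>R Y p c + w1 c + w2 c)"
  have "\<exists>!z. ?P z"
    using bspec[OF bspec[OF splits[unfolded splitting_def] assms(1)]
        combination_tangent[OF assms(1-3)]] .
  moreover have "?P (a, v1, v2)" "?P (b, w1, w2)" using assms by auto
  ultimately have "(a, v1, v2) = (b, w1, w2)" by (metis (no_types, lifting))
  then show ?thesis by simp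
qed

abbreviation \<theta> :: "('a, 'e) form" where "\<theta> \<equiv> canonical_form Y Ep Em"

lemma canonical_form_combination:
  assumes "p \<in> points N" "v1 \<in> Ep p" "v2 \<in> Em p"
  shows "\<theta> p (combination p (a, v1, v2)) = a"
  unfolding canonical_form_def
proof (rule the_equality)
  show "\<exists>w1\<in>Ep p. \<exists>w2\<in>Em p. combination p (a, v1, v2) = (\<lambda>c. a *\<^sub>R Y p c + w1 c + w2 c)"
    using assms by auto
  fix b assume "\<exists>w1\<in>Ep p. \<exists>w2\<in>Em p. combination p (a, v1, v2) = (\<lambda>c. b *\<^sub>R Y p c + w1 c + w2 c)"
  then obtain w1 w2 where w: "w1 \<in> Ep p" "w2 \<in> Em p"
    "combination p (a, v1, v2) = (\<lambda>c. b *\<^sub>R Y p c + w1 c + w2 c)"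
    by blast
  show "b = a" using combination_unique[OF assms w(1,2), of a b] w(3) by simp
qed

lemma zero_in_Ep: "p \<in> points N \<Longrightarrow> (\<lambda>_. 0) \<in> Ep p"
  and zero_in_Em: "p \<in> points N \<Longrightarrow> (\<lambda>_. 0) \<in> Em p"
  using smooth_subbundle_zero Ep Em by auto

lemma canonical_form_field: "p \<in> points N \<Longrightarrow> \<theta> p (Y p) = 1"
  using canonical_form_combination[OF _ zero_in_Ep zero_in_Em, of p 1] by simp

lemma canonical_form_Ep: "p \<in> points N \<Longrightarrow> v \<in> Ep p \<Longrightarrow> \<theta> p v = 0"
  using canonical_form_combination[OF _ _ zero_in_Em, of p v 0] by simp

lemma canonical_form_Em: "p \<in> points N \<Longrightarrow> v \<in> Em p \<Longrightarrow> \<theta> p v = 0"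
  using canonical_form_combination[OF _ zero_in_Ep, of p v 0] by simp

lemma Ep_Int_Em:
  assumes "p \<in> points N" "v \<in> Ep p" "v \<in> Em p"
  shows "v = (\<lambda>_. 0)"
proof -
  have "combination p (0, v, \<lambda>_. 0) = combination p (0, \<lambda>_. 0, v)" by simp
  from combination_unique[OF assms(1,2) zero_in_Em[OF assms(1)] zero_in_Ep[OF assms(1)] assms(3) this]
  show ?thesis by blast
qed

text \<open>Let \<open>w0\<close> be the component of \<open>Y\<close> orthogonal in the chart to
  \<open>E\<^sup>+ \<oplus> E\<^sup>-\<close>. Its inner product with \<open>a Y + v1 + v2\<close>
  is \<open>a\<close> times its inner product with \<open>Y\<close>, so dividing by the latter
  recovers the coefficient \<open>a\<close>. Smoothness of \<open>w0\<close> comes from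
  \<open>smooth_orthogonal_component\<close>, applied to a joint frame \<open>f\<close> of the two
  bundles.\<close>

lemma canonical_form_local:
  assumes "chart_around N c p"
  obtains W w where "open W" "cmap c p \<in> W" "W \<subseteq> cimg c" "smooth_on W w"
    "\<And>x v. x \<in> W \<Longrightarrow> form_in N \<theta> c x v = w x \<bullet> v"
proof -
  have c: "c \<in> atlas N" using assms chart_around_atlas by blast
  obtain W1 k b where b: "open W1" "cmap c p \<in> W1" "W1 \<subseteq> cimg c"
    "\<And>i::nat. i < k \<Longrightarrow> smooth_on W1 (b i)"
    "\<And>x i. x \<in> W1 \<Longrightarrow> i < k \<Longrightarrow> b i x \<notin> span (frame b i x)"
    "\<And>x. x \<in> W1 \<Longrightarrow> (\<lambda>v. v c) ` Ep (cinv c x) = span (frame b k x)"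
    by (rule smooth_frame_in_chart[OF Ep assms]) blast
  obtain W2 l b' where b': "open W2" "cmap c p \<in> W2" "W2 \<subseteq> cimg c"
    "\<And>i::nat. i < l \<Longrightarrow> smooth_on W2 (b' i)"
    "\<And>x i. x \<in> W2 \<Longrightarrow> i < l \<Longrightarrow> b' i x \<notin> span (frame b' i x)"
    "\<And>x. x \<in> W2 \<Longrightarrow> (\<lambda>v. v c) ` Em (cinv c x) = span (frame b' l x)"
    by (rule smooth_frame_in_chart[OF Em assms]) blast
  define W where "W = W1 \<inter> W2"
  define f where "f i = (if i < k then b i else b' (i - k))" for i
  define Z where "Z = field_in Y c"
  have opW: "open W" using b b' by (simp add: W_def open_Int)
  have Wc: "x \<in> cimg c" if "x \<in> W" for x using that b(3) by (auto simp: W_def)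
  have q: "chart_around N c (cinv c x)" "cinv c x \<in> points N" if "x \<in> W" for x
    using chart_around_cinv[OF c Wc[OF that]] chart_around_points by auto
  have img: "frame f (k + m) x = frame b k x \<union> frame b' m x" for m x
  proof -
    have "{..<k + m} = {..<k} \<union> (\<lambda>j. j + k) ` {..<m}"
    proof (intro equalityI subsetI)
      fix j assume "j \<in> {..<k + m}"
      then have "j < k \<or> j = (j - k) + k \<and> j - k < m" by auto
      then show "j \<in> {..<k} \<union> (\<lambda>j. j + k) ` {..<m}" by blast
    qed auto
    then show ?thesis by (simp add: image_Un image_image f_def)
  qed
  \<comment> \<open>A vector \<open>b' m x\<close> in the span of its predecessors in the joint
    frame splits as \<open>s + s'\<close> with \<open>s\<close> from the first bundle and
    \<open>s'\<close> from the earlier vectors \<open>b'\<close>. Then \<open>s\<close> lies in both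
    bundles, hence is zero, which contradicts independence within the second frame.\<close>
  have indep: "f i x \<notin> span (frame f i x)" if x: "x \<in> W" and i: "i < k + l" for i x
  proof (cases "i < k")
    case True
    then have "frame f i x = frame b i x" by (intro image_cong) (auto simp: f_def)
    then show ?thesis using b(5)[of x i] x True by (simp add: f_def W_def)
  next
    case False
    define m where "m = i - k"
    have m: "i = k + m" "m < l" using False i by (auto simp: m_def)
    show ?thesis
    proof
      assume "f i x \<in> span (frame f i x)"
      then have "b' m x \<in> span (frame b k x \<union> frame b' m x)"
        unfolding m(1) img by (simp add: f_def)
      then obtain s s' where s: "b' m x = s + s'" "s \<in> span (frame b k x)"
        "s' \<in> span (frame b' m x)"
        unfolding span_Un by blast
      have "b' m x \<in> span (frame b' l x)" using m(2) by (intro span_base) auto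
      moreover have "s' \<in> span (frame b' l x)"
      proof -
        have "frame b' m x \<subseteq> frame b' l x"
          using m(2) by (intro image_mono) auto
        from span_mono[OF this] s(3) show ?thesis by blast
      qed
      ultimately have "s \<in> span (frame b' l x)"
        using span_diff[of "b' m x" _ s'] s(1) by simp
      then have sE: "s \<in> (\<lambda>v. v c) ` Ep (cinv c x)" "s \<in> (\<lambda>v. v c) ` Em (cinv c x)"
        using b(6)[of x] b'(6)[of x] s(2) x by (simp_all add: W_def)
      obtain u u' where u: "u \<in> Ep (cinv c x)" "u' \<in> Em (cinv c x)" "s = u c" "s = u' c"
        using imageE[OF sE(1)] imageE[OF sE(2)] by metis
      have "u = u'"
        by (rule tangent_eqI[OF smooth_subbundle_tangent[OF Ep q(2)[OF x] u(1)]
            smooth_subbundle_tangent[OF Em q(2)[OF x] u(2)] q(1)[OF x] trans[OF u(3)[symmetric] u(4)]])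
      then have "u = (\<lambda>_. 0)" using Ep_Int_Em[OF q(2)[OF x] u(1)] u(2) by simp
      then have "b' m x = s'" using u(3) s(1) by simp
      then show False using b'(5)[of x m] s(3) x m(2) by (simp add: W_def)
    qed
  qed
  have fs: "smooth_on W (f i)" if "i < k + l" for i
    using that smooth_on_subset[OF _ b(4), of W i] smooth_on_subset[OF _ b'(4), of W "i - k"]
    by (auto simp: f_def W_def)
  have Zs: "smooth_on W Z"
    unfolding Z_def using smooth_on_subset[OF _ vector_field_smooth[OF vector_field c]] Wc by blast
  have "\<exists>w. smooth_on W w \<and> (\<forall>x\<in>W. (\<forall>i<k + l. w x \<bullet> f i x = 0) \<and>
      Z x - w x \<in> span (frame f (k + l) x))"
    by (rule smooth_orthogonal_component[OF opW fs indep Zs])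
  then obtain w0 where w0: "smooth_on W w0"
    "\<forall>x\<in>W. (\<forall>i<k + l. w0 x \<bullet> f i x = 0) \<and> Z x - w0 x \<in> span (frame f (k + l) x)"
    by (elim exE conjE)
  note w0 = w0(1) bspec[OF w0(2)]
  have perp: "w0 x \<bullet> z = 0" if "x \<in> W" "z \<in> span (frame f (k + l) x)" for x z
  proof -
    have "span (frame f (k + l) x) \<subseteq> {z. w0 x \<bullet> z = 0}"
      using w0(2)[OF that(1)] by (intro span_minimal subspace_hyperplane) auto
    then show ?thesis using that(2) by blast
  qed
  have inspan: "v1 c \<in> span (frame f (k + l) x)" "v2 c \<in> span (frame f (k + l) x)"
    if "x \<in> W" "v1 \<in> Ep (cinv c x)" "v2 \<in> Em (cinv c x)" for x v1 v2
  proof -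
    have "v1 c \<in> span (frame b k x)" "v2 c \<in> span (frame b' l x)"
      using b(6)[of x] b'(6)[of x] that by (auto simp: W_def)
    then show "v1 c \<in> span (frame f (k + l) x)" "v2 c \<in> span (frame f (k + l) x)"
      unfolding img
      using span_mono[of "frame b k x" "frame b k x \<union> frame b' l x"]
        span_mono[of "frame b' l x" "frame b k x \<union> frame b' l x"]
      by blast+
  qed
  \<comment> \<open>Otherwise \<open>w0 x\<close> would be orthogonal to \<open>Z x\<close> and to
    \<open>Z x - w0 x\<close>, hence zero. Then \<open>Y\<close> would lie in the sum of the two
    bundles and have two decompositions, with coefficients 1 and 0.\<close>
  have wZ: "w0 x \<bullet> Z x \<noteq> 0" if x: "x \<in> W" for x
  proof
    assume "w0 x \<bullet> Z x = 0"
    moreover have "w0 x \<bullet> (Z x - w0 x) = 0" using perp w0(2) x by blast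
    ultimately have "w0 x = 0" by (simp add: inner_diff_right)
    then have "Z x \<in> span (frame b k x \<union> frame b' l x)"
      using w0(2)[OF x] by (simp add: img)
    then obtain s s' where s: "Z x = s + s'" "s \<in> span (frame b k x)"
      "s' \<in> span (frame b' l x)"
      unfolding span_Un by blast
    then have sE: "s \<in> (\<lambda>v. v c) ` Ep (cinv c x)" "s' \<in> (\<lambda>v. v c) ` Em (cinv c x)"
      using b(6)[of x] b'(6)[of x] x by (simp_all add: W_def)
    obtain u u' where u: "u \<in> Ep (cinv c x)" "u' \<in> Em (cinv c x)" "s = u c" "s' = u' c"
      using imageE[OF sE(1)] imageE[OF sE(2)] by metis
    have "Y (cinv c x) c = u c + u' c" using s(1) u(3,4) by (simp add: Z_def field_in_def)
    then have "combination (cinv c x) (1, \<lambda>_. 0, \<lambda>_. 0) = combination (cinv c x) (0, u, u')"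
      using u(1,2) zero_in_Ep[OF q(2)[OF x]] zero_in_Em[OF q(2)[OF x]]
      by (intro tangent_eqI[OF combination_tangent combination_tangent q(1)[OF x]] q(2)[OF x]) simp_all
    from combination_unique[OF q(2)[OF x] zero_in_Ep[OF q(2)[OF x]] zero_in_Em[OF q(2)[OF x]] u(1,2) this]
    show False by simp
  qed
  show thesis
  proof (rule that[OF opW])
    show "cmap c p \<in> W" "W \<subseteq> cimg c" using b b' by (auto simp: W_def)
    show "smooth_on W (\<lambda>x. inverse (w0 x \<bullet> Z x) *\<^sub>R w0 x)"
      by (intro smooth_on_scaleR smooth_on_inverse smooth_on_inner opW w0 Zs wZ)
    fix x v assume x: "x \<in> W"
    obtain a v1 v2 where v: "v1 \<in> Ep (cinv c x)" "v2 \<in> Em (cinv c x)"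
      "tangent_of N c (cinv c x) v = combination (cinv c x) (a, v1, v2)"
      using decomposition[OF q(2)[OF x] tangent_of_in_tangent_space[OF q(1)[OF x]]] .
    have "v = a *\<^sub>R Z x + v1 c + v2 c"
      using fun_cong[OF v(3), of c] tangent_of_component[OF q(1)[OF x], of v]
      by (simp add: Z_def field_in_def)
    then have "w0 x \<bullet> v = a * (w0 x \<bullet> Z x)"
      using perp[OF x inspan(1)[OF x v(1,2)]] perp[OF x inspan(2)[OF x v(1,2)]]
      by (simp add: inner_add_right)
    moreover have "form_in N \<theta> c x v = a"
      using canonical_form_combination[OF q(2)[OF x] v(1,2), of a] v(3) by (simp add: form_in_def)
    ultimately show "form_in N \<theta> c x v = (inverse (w0 x \<bullet> Z x) *\<^sub>R w0 x) \<bullet> v"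
      using wZ[OF x] by simp
  qed
qed

lemma one_form_canonical_form: "one_form N \<theta>"
  unfolding one_form_def
proof (intro ballI conjI allI)
  fix c assume c: "c \<in> atlas N"
  have loc: "\<exists>W w. open W \<and> x \<in> W \<and> smooth_on W w \<and>
      (\<forall>y\<in>W. \<forall>v. form_in N \<theta> c y v = w y \<bullet> v)" if "x \<in> cimg c" for x
    using canonical_form_local[OF chart_around_cinv[OF c that]] cmap_cinv[OF that] by metis
  show "linear (form_in N \<theta> c x)" if x: "x \<in> cimg c" for x
  proof -
    obtain W and w :: "'e \<Rightarrow> 'e" where
      "x \<in> W" "\<forall>y\<in>W. \<forall>v. form_in N \<theta> c y v = w y \<bullet> v"
      using loc[OF x] by blast
    then have "form_in N \<theta> c x = (\<bullet>) (w x)" by (intro ext) blast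
    then show ?thesis by (simp add: bounded_linear.linear[OF bounded_linear_inner_right])
  qed
  show "smooth_on (cimg c) (\<lambda>x. form_in N \<theta> c x v)" for v
  proof (rule smooth_on_local)
    fix x assume "x \<in> cimg c"
    then obtain W and w :: "'e \<Rightarrow> 'e" where w: "open W" "x \<in> W" "smooth_on W w"
      "\<forall>y\<in>W. \<forall>v. form_in N \<theta> c y v = w y \<bullet> v"
      using loc by blast
    have "smooth_on W (\<lambda>y. form_in N \<theta> c y v)"
      by (rule smooth_on_cong[OF w(1) _ smooth_on_inner[OF w(1,3) smooth_on_const]])
        (use w(4) in simp)
    then show "\<exists>U. open U \<and> x \<in> U \<and> smooth_on U (\<lambda>x. form_in N \<theta> c x v)"
      using w by blast
  qed
qed

end

lemma (in euclidean_flow) anosov_strongly_adapted: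
  assumes "smooth_anosov_splitting N Y Ep Em"
  shows "strongly_adapted N Y (canonical_form Y Ep Em)"
proof -
  note * = assms[unfolded smooth_anosov_splitting_def]
  interpret smooth_splitting N Y Ep Em
    by unfold_locales (rule conjunct1[OF *] conjunct1[OF conjunct2[OF *]]
        conjunct1[OF conjunct2[OF conjunct2[OF *]]])+
  obtain \<Psi> where flow: "flow_maps N Y \<Psi>" and "\<forall>t. \<forall>p\<in>points N.
      tangent_map N N (\<Psi> t) p ` Ep p = Ep (\<Psi> t p) \<and> tangent_map N N (\<Psi> t) p ` Em p = Em (\<Psi> t p)"
    using conjunct2[OF conjunct2[OF conjunct2[OF *]]] by (elim exE conjE)
  then have inv: "tangent_map N N (\<Psi> t) p ` Ep p = Ep (\<Psi> t p)"
    "tangent_map N N (\<Psi> t) p ` Em p = Em (\<Psi> t p)" if "p \<in> points N" for t p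
    using that by auto
  show ?thesis
  proof (rule strongly_adapted_if_invariant[OF one_form_canonical_form])
    show "\<theta> p (Y p) > 0" if "p \<in> points N" for p using canonical_form_field[OF that] by simp
    fix p v assume p: "p \<in> points N" and v: "v \<in> tangent_space N p"
    obtain a v1 v2 where d: "v1 \<in> Ep p" "v2 \<in> Em p" "v = combination p (a, v1, v2)"
      using decomposition[OF p v] .
    obtain l where l: "linear l" "\<forall>v. lie_form N Y \<theta> p v = l (v (chart_at N p))"
      using linear_lie_form[OF one_form_canonical_form p] by (elim exE conjE)
    note l = l(1) spec[OF l(2)]
    have "lie_form N Y \<theta> p v = a * lie_form N Y \<theta> p (Y p) + lie_form N Y \<theta> p v1
        + lie_form N Y \<theta> p v2"
      unfolding l(2) d(3) by (simp add: linear_add[OF l(1)] linear_scale[OF l(1)])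
    moreover have "lie_form N Y \<theta> p (Y p) = 0"
      by (rule lie_form_field_zero[OF one_form_canonical_form canonical_form_field p])
    moreover have "lie_form N Y \<theta> p v1 = 0"
      by (rule lie_form_zero_of_invariant_bundle[OF flow one_form_canonical_form _
            canonical_form_Ep inv(1)[OF p] p d(1)])
        (use smooth_subbundle_tangent[OF Ep] in auto)
    moreover have "lie_form N Y \<theta> p v2 = 0"
      by (rule lie_form_zero_of_invariant_bundle[OF flow one_form_canonical_form _
            canonical_form_Em inv(2)[OF p] p d(2)])
        (use smooth_subbundle_tangent[OF Em] in auto)
    ultimately show "lie_form N Y \<theta> p v = 0" by simp
  qed
qed

section \<open>Flows with a global time coordinate\<close>

text \<open>By \<open>jac\<close> the form is represented by \<open>snd\<close> in every chart. Its
  coefficients are constant, so the first term of the Lie derivative vanishes; by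
  \<open>time\<close> the last component of \<open>Y\<close> is constant, so the second vanishes
  too. Only constants are differentiated, hence no basis is involved.\<close>

lemma dt_form_strongly_adapted:
  fixes N :: "('a, 'm::real_normed_vector \<times> real) manifold"
  assumes N: "smooth_manifold N" and Y: "vector_field N Y"
    and jac: "\<And>c d p v. chart_around N c p \<Longrightarrow> chart_around N d p \<Longrightarrow>
      snd (fderiv (cmap d \<circ> cinv c) (cmap c p) v) = snd v"
    and time: "\<And>c p. chart_around N c p \<Longrightarrow> snd (Y p c) = 1"
  shows "nonsingular_flow N Y \<and> strongly_adapted N Y (dt_form N)"
proof
  interpret smooth_mfd N by unfold_locales fact
  have "Y p \<noteq> (\<lambda>_. 0)" if "p \<in> points N" for p
    using time[OF chart_at[OF that]] by force
  then show "nonsingular_flow N Y"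
    using N Y by (simp add: nonsingular_flow_def smooth_flow_def)
  have form: "form_in N (dt_form N) c x = snd" if "c \<in> atlas N" "x \<in> cimg c" for c x
  proof
    fix v
    have a: "chart_around N c (cinv c x)" by (rule chart_around_cinv[OF that])
    note b = chart_at[OF chart_around_points[OF a]]
    show "form_in N (dt_form N) c x v = snd v"
      using jac[OF a b, of v] b by (simp add: form_in_def dt_form_def tangent_of_def)
  qed
  show "strongly_adapted N Y (dt_form N)"
  proof (rule strongly_adapted_if_invariant)
    show "one_form N (dt_form N)"
      unfolding one_form_def
    proof (intro ballI conjI allI)
      fix c assume c: "c \<in> atlas N"
      show "linear (form_in N (dt_form N) c x)" if "x \<in> cimg c" for x
        by (simp add: form[OF c that] bounded_linear.linear[OF bounded_linear_snd])
      show "smooth_on (cimg c) (\<lambda>x. form_in N (dt_form N) c x v)" for v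
        by (rule smooth_on_cong[OF open_cimg[OF c] _ smooth_on_const[of _ "snd v"]]) (simp add: form[OF c])
    qed
    show "dt_form N p (Y p) > 0" if "p \<in> points N" for p
      using time[OF chart_at[OF that]] by (simp add: dt_form_def)
    fix p v assume p: "p \<in> points N" "v \<in> tangent_space N p"
    define c where "c = chart_at N p"
    define x where "x = cmap c p"
    define Z where "Z = field_in Y c"
    have a: "chart_around N c p" using chart_at[OF p(1)] by (simp add: c_def)
    have c: "c \<in> atlas N" "x \<in> cimg c"
      using chart_around_atlas[OF a] cmap_in_cimg[OF a] by (auto simp: x_def)
    have 1: "fderiv (\<lambda>y. form_in N (dt_form N) c y (v c)) x = (\<lambda>u. 0)"
      by (rule frechet_derivative_eqI,
          rule has_derivative_transform_within_open[OF has_derivative_const[of "snd (v c)"] open_cimg[OF c(1)] c(2)])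
        (simp add: form[OF c(1)])
    have Z: "(Z has_derivative fderiv Z x) (at x)"
      unfolding Z_def by (rule smooth_on_has_derivative[OF _ c(2)]) (use Y c in \<open>simp add: vector_field_def\<close>)
    have h2: "((\<lambda>y. snd (Z y)) has_derivative (\<lambda>u. 0)) (at x)"
      by (rule has_derivative_transform_within_open[OF has_derivative_const[of 1] open_cimg[OF c(1)] c(2)])
        (simp add: Z_def field_in_def time[OF chart_around_cinv[OF c(1)]])
    have 2: "snd (fderiv Z x (v c)) = 0"
      using fun_cong[OF has_derivative_unique[OF has_derivative_snd[OF Z] h2]] .
    show "lie_form N Y (dt_form N) p v = 0"
      using 1 2 form[OF c] by (simp add: lie_form_def Let_def Z_def flip: c_def x_def)
  qed
qed

text \<open>Near each point a change of charts of a suspension has this form. The derivative formula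
  shows that such maps preserve \<open>dt\<close> and, by linearity of the derivative of
  \<open>f\<close>, the vector \<open>(0, 1)\<close>.\<close>

lemma shear_transition:
  fixes f :: "'m::real_normed_vector \<Rightarrow> 'n::real_normed_vector" and \<tau> :: "'m \<times> real \<Rightarrow> 'n \<times> real"
  assumes "open U" "open I" "smooth_on U f"
    and \<tau>: "\<And>w. w \<in> U \<times> I \<Longrightarrow> \<tau> w = (f (fst w), snd w + k)"
  shows "smooth_on (U \<times> I) \<tau>"
    and "z \<in> U \<times> I \<Longrightarrow>
      fderiv \<tau> z v = (fderiv f (fst z) (fst v), snd v)"
proof -
  have op: "open (U \<times> I)" using assms by (simp add: open_Times)
  have "smooth_on I (\<lambda>t. t + k)" by (intro smooth_on_add assms smooth_on_ident smooth_on_const)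
  note * = smooth_on_map_prod[OF assms(1-3) this]
  show "smooth_on (U \<times> I) \<tau>"
    by (rule smooth_on_cong[OF op _ *]) (simp add: \<tau> map_prod_def split_def)
  assume z: "z \<in> U \<times> I"
  have f: "(f has_derivative fderiv f (fst z)) (at (fst z))"
    using smooth_on_has_derivative[OF assms(3)] z by auto
  have "((\<lambda>w. (f (fst w), snd w + k)) has_derivative
      (\<lambda>v. (fderiv f (fst z) (fst v), snd v))) (at z)"
    by (intro has_derivative_Pair has_derivative_compose[OF has_derivative_fst[OF has_derivative_ident] f])
      (auto intro!: derivative_eq_intros)
  then have "(\<tau> has_derivative (\<lambda>v. (fderiv f (fst z) (fst v), snd v))) (at z)"
    by (rule has_derivative_transform_within_open[OF _ op z]) (simp add: \<tau>)
  then show "fderiv \<tau> z v = (fderiv f (fst z) (fst v), snd v)"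
    by (simp add: frechet_derivative_eqI)
qed


section \<open>Quotient topologies\<close>

lemma topspace_quotient_topology [simp]: "topspace (quotient_topology X q) = q ` topspace X"
proof
  show "topspace (quotient_topology X q) \<subseteq> q ` topspace X"
    by (metis openin_quotient_topology openin_topspace)
  have "{x \<in> topspace X. q x \<in> q ` topspace X} = topspace X" by auto
  then have "openin (quotient_topology X q) (q ` topspace X)"
    by (simp add: openin_quotient_topology)
  then show "q ` topspace X \<subseteq> topspace (quotient_topology X q)" by (rule openin_subset)
qed

lemma quotient_map_quotient_topology: "quotient_map X (quotient_topology X q) q"
  by (auto simp: quotient_map_def openin_quotient_topology)

text \<open>A continuous open map that is injective on an open set is a homeomorphism onto the
  image, so a chart \<open>h\<close> upstairs descends along its inverse. This yields the charts of
  both the circle and the suspension.\<close>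

lemma open_map_chart:
  assumes "continuous_map X Y q" "open_map X Y q" "openin X U" "inj_on q U"
    "homeomorphic_map (subtopology X U) (top_of_set T) h" "\<And>x. x \<in> U \<Longrightarrow> m (q x) = h x"
  shows "openin Y (q ` U)" "m ` q ` U = T"
    "homeomorphic_map (subtopology Y (q ` U)) (top_of_set T) m"
proof -
  have U: "U \<subseteq> topspace X" using assms(3) openin_subset by blast
  show op: "openin Y (q ` U)" using assms(2,3) by (simp add: open_map_def)
  have "h ` U = T"
    using homeomorphic_imp_surjective_map[OF assms(5)] U by (simp add: Int_absorb1)
  then show "m ` q ` U = T" using assms(6) by (force simp: image_image)
  have "homeomorphic_map (subtopology X U) (subtopology Y (q ` U)) q"
  proof (rule bijective_open_imp_homeomorphic_map)
    show "continuous_map (subtopology X U) (subtopology Y (q ` U)) q"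
      using assms(1) by (intro continuous_map_into_subtopology continuous_map_from_subtopology) auto
    show "open_map (subtopology X U) (subtopology Y (q ` U)) q"
      using assms(2,3) by (intro open_map_into_subtopology open_map_from_subtopology) auto
    show "q ` topspace (subtopology X U) = topspace (subtopology Y (q ` U))"
      using U op openin_subset by fastforce
    show "inj_on q (topspace (subtopology X U))"
      using assms(4) by (auto intro: inj_on_subset)
  qed
  then obtain g where g: "homeomorphic_maps (subtopology X U) (subtopology Y (q ` U)) q g"
    by (auto simp: homeomorphic_map_maps)
  then have "homeomorphic_map (subtopology Y (q ` U)) (subtopology X U) g"
    using homeomorphic_maps_map by blast
  from homeomorphic_map_compose[OF this assms(5)]
  have "homeomorphic_map (subtopology Y (q ` U)) (top_of_set T) (h \<circ> g)" .
  then show "homeomorphic_map (subtopology Y (q ` U)) (top_of_set T) m"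
  proof (rule homeomorphic_map_eq)
    fix y assume "y \<in> topspace (subtopology Y (q ` U))"
    then obtain x where x: "x \<in> U" "y = q x" by auto
    then have "g y = x" using g U by (auto simp: homeomorphic_maps_def)
    then show "(h \<circ> g) y = m y" using assms(6) x by simp
  qed
qed


section \<open>The circle and products with it\<close>

lemma circle_proj_eq_iff: "circle_proj s = circle_proj t \<longleftrightarrow> s - t \<in> \<int>"
proof
  assume "circle_proj s = circle_proj t"
  moreover have "s \<in> circle_proj s" by (simp add: circle_proj_def)
  ultimately show "s - t \<in> \<int>" by (auto simp: circle_proj_def)
next
  assume st: "s - t \<in> \<int>"
  have "u - s \<in> \<int> \<longleftrightarrow> u - t \<in> \<int>" for u
    using Ints_add[OF _ st, of "u - s"] Ints_diff[OF _ st, of "u - t"] by auto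
  then show "circle_proj s = circle_proj t" by (simp add: circle_proj_def)
qed

lemma Ints_abs_less_1: "(x::real) \<in> \<int> \<Longrightarrow> \<bar>x\<bar> < 1 \<Longrightarrow> x = 0"
  using Ints_nonzero_abs_ge1 by fastforce

lemma continuous_circle_proj: "continuous_map euclideanreal (mtop circle) circle_proj"
  using quotient_imp_continuous_map[OF quotient_map_quotient_topology] by (simp add: circle_def)

lemma points_circle: "points circle = range circle_proj"
  by (simp add: circle_def)

text \<open>The saturation of an open set is the union of its translates by integers.\<close>

lemma open_circle_proj: "open_map euclideanreal (mtop circle) circle_proj"
  unfolding open_map_def
proof (intro allI impI)
  fix U :: "real set" assume "openin euclidean U"
  then have U: "open U" by simp
  have "{x. circle_proj x \<in> circle_proj ` U} = (\<Union>n\<in>\<int>. (\<lambda>x. x + n) -` U)"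
  proof (intro equalityI subsetI)
    fix x assume "x \<in> {x. circle_proj x \<in> circle_proj ` U}"
    then obtain u where u: "u \<in> U" "x - u \<in> \<int>" by (auto simp: circle_proj_eq_iff)
    then have "u - x \<in> \<int>" using Ints_minus[of "x - u"] by simp
    then show "x \<in> (\<Union>n\<in>\<int>. (\<lambda>x. x + n) -` U)" using u by (auto intro!: bexI[of _ "u - x"])
  next
    fix x assume "x \<in> (\<Union>n\<in>\<int>. (\<lambda>x. x + n) -` U)"
    then obtain n where n: "n \<in> \<int>" "x + n \<in> U" by blast
    then have "circle_proj x = circle_proj (x + n)" by (simp add: circle_proj_eq_iff)
    then show "x \<in> {x. circle_proj x \<in> circle_proj ` U}" using n by auto
  qed
  moreover have "open (\<Union>n\<in>\<int>. (\<lambda>x. x + n) -` U)"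
    using U by (intro open_UN ballI continuous_open_vimage) (auto intro!: continuous_intros)
  ultimately show "openin (mtop circle) (circle_proj ` U)"
    by (auto simp: circle_def openin_quotient_topology)
qed

lemma inj_on_circle_proj: "inj_on circle_proj {a<..<a + 1}"
proof (rule inj_onI)
  fix x y assume "x \<in> {a<..<a + 1}" "y \<in> {a<..<a + 1}" "circle_proj x = circle_proj y"
  then have "x - y \<in> \<int>" "\<bar>x - y\<bar> < 1" by (auto simp: circle_proj_eq_iff)
  then show "x = y" using Ints_abs_less_1 by fastforce
qed

lemma circle_chart:
  assumes "c \<in> atlas circle"
  obtains a where "cdom c = circle_proj ` {a<..<a + 1}"
    "\<forall>s\<in>{a<..<a + 1}. cmap c (circle_proj s) = s"
proof -
  obtain a where c: "c = (circle_proj ` {a<..<a + 1}, \<lambda>z. the_elem (z \<inter> {a<..<a + 1}))"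
    using assms by (auto simp: circle_def)
  have "circle_proj s \<inter> {a<..<a + 1} = {s}" if s: "s \<in> {a<..<a + 1}" for s
  proof (intro equalityI subsetI)
    fix t assume t: "t \<in> circle_proj s \<inter> {a<..<a + 1}"
    then have "t - s \<in> \<int>" "\<bar>t - s\<bar> < 1" using s by (auto simp: circle_proj_def)
    then show "t \<in> {s}" using Ints_abs_less_1 by fastforce
  qed (use s in \<open>auto simp: circle_proj_def\<close>)
  then show thesis using that[of a] c by simp
qed

lemma circle_chart_properties:
  assumes "c \<in> atlas circle"
  shows "openin (mtop circle) (cdom c)" "open (cimg c)"
    "homeomorphic_map (subtopology (mtop circle) (cdom c)) (top_of_set (cimg c)) (cmap c)"
proof -
  obtain a where a: "cdom c = circle_proj ` {a<..<a + 1}"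
    "\<forall>s\<in>{a<..<a + 1}. cmap c (circle_proj s) = s"
    by (rule circle_chart[OF assms])
  note a = a(1) bspec[OF a(2)]
  have h: "homeomorphic_map (top_of_set {a<..<a + 1}) (top_of_set {a<..<a + 1}) (\<lambda>s. s)"
    unfolding id_def[symmetric] homeomorphic_map_id by (rule refl)
  note * = open_map_chart[OF continuous_circle_proj open_circle_proj _ inj_on_circle_proj h a(2)]
  show "openin (mtop circle) (cdom c)" using *(1) a(1) by simp
  have "cimg c = {a<..<a + 1}" using *(2) a(1) by (simp add: cimg_def)
  then show "open (cimg c)"
    "homeomorphic_map (subtopology (mtop circle) (cdom c)) (top_of_set (cimg c)) (cmap c)"
    using *(3) a(1) by simp_all
qed

text \<open>The statement is local because two arcs may overlap in two pieces on which the change of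
  charts is translation by different integers.\<close>

lemma circle_transition_local:
  assumes "c \<in> atlas circle" "d \<in> atlas circle" "x \<in> cmap c ` (cdom c \<inter> cdom d)"
  obtains V n where "open V" "x \<in> V" "\<And>y. y \<in> V \<Longrightarrow> (cmap d \<circ> cinv c) y = y + n"
proof -
  obtain a where a: "cdom c = circle_proj ` {a<..<a + 1}"
    "\<forall>s\<in>{a<..<a + 1}. cmap c (circle_proj s) = s"
    by (rule circle_chart[OF assms(1)])
  note a = a(1) bspec[OF a(2)]
  obtain b where b: "cdom d = circle_proj ` {b<..<b + 1}"
    "\<forall>s\<in>{b<..<b + 1}. cmap d (circle_proj s) = s"
    by (rule circle_chart[OF assms(2)])
  note b = b(1) bspec[OF b(2)]
  have inj: "inj_on (cmap c) (cdom c)"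
    unfolding a(1) by (rule inj_onI) (use a(2) in auto)
  obtain z where z: "z \<in> cdom c" "z \<in> cdom d" "x = cmap c z" using assms(3) by blast
  obtain s where s: "s \<in> {a<..<a + 1}" "z = circle_proj s" using z(1) a(1) by blast
  obtain t where t: "t \<in> {b<..<b + 1}" "z = circle_proj t" using z(2) b(1) by blast
  have x: "x = s" using z(3) s a(2) by simp
  define n where "n = t - s"
  have n: "n \<in> \<int>" using s(2) t(2) circle_proj_eq_iff[of t s] by (simp add: n_def)
  show thesis
  proof (rule that)
    show "open ({a<..<a + 1} \<inter> {b - n<..<b + 1 - n})" by (intro open_Int) auto
    show "x \<in> {a<..<a + 1} \<inter> {b - n<..<b + 1 - n}" using s t x by (auto simp: n_def)
    fix y assume y: "y \<in> {a<..<a + 1} \<inter> {b - n<..<b + 1 - n}"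
    have "cinv c y = circle_proj y"
      unfolding cinv_def using y a inv_into_f_f[OF inj, of "circle_proj y"] by auto
    moreover have "circle_proj y = circle_proj (y + n)"
      using n by (simp add: circle_proj_eq_iff)
    moreover have "y + n \<in> {b<..<b + 1}" using y by auto
    ultimately show "(cmap d \<circ> cinv c) y = y + n" using b(2) by simp
  qed
qed

lemma smooth_circle: "smooth_manifold circle"
  unfolding smooth_manifold_def
proof (intro conjI ballI)
  show "\<exists>B::real set. finite B \<and> span B = UNIV"
    by (intro exI[of _ Basis] conjI finite_Basis span_Basis)
  show "second_countable (mtop circle)"
    by (rule second_countable_open_map_image[OF continuous_circle_proj open_circle_proj _
          second_countable_euclidean]) (simp add: points_circle)
  show "points circle = (\<Union>c\<in>atlas circle. cdom c)"
  proof (intro equalityI subsetI)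
    fix z assume "z \<in> points circle"
    then obtain s where s: "z = circle_proj s" by (auto simp: points_circle)
    then have "z \<in> circle_proj ` {s - 1/2<..<s - 1/2 + 1}" by auto
    moreover have "(circle_proj ` {s - 1/2<..<s - 1/2 + 1},
        \<lambda>z. the_elem (z \<inter> {s - 1/2<..<s - 1/2 + 1})) \<in> atlas circle"
      unfolding circle_def manifold.select_convs by (rule CollectI, rule exI[of _ "s - 1/2"]) simp
    ultimately show "z \<in> (\<Union>c\<in>atlas circle. cdom c)" by (metis UN_I fst_conv)
  qed (auto simp: points_circle elim!: circle_chart)
  show "Hausdorff_space (mtop circle)"
  proof (rule Hausdorff_space_injective_preimage)
    \<comment> \<open>The exponential winding of the line around the unit circle does not depend on
      the chosen representative. It descends to a continuous injection into the complex plane, whose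
      Hausdorff property is pulled back.\<close>
    let ?f = "\<lambda>z. cis (2 * pi * (SOME s. s \<in> z))"
    have f: "?f (circle_proj s) = cis (2 * pi * s)" for s
    proof -
      have "(SOME t. t \<in> circle_proj s) \<in> circle_proj s"
        by (rule someI[of _ s]) (simp add: circle_proj_def)
      then obtain n where n: "(SOME t. t \<in> circle_proj s) = s + of_int n"
        by (auto simp: circle_proj_def elim!: Ints_cases) (metis add_diff_cancel_left' diff_add_cancel)
      show ?thesis
        unfolding n by (simp add: cis_mult[symmetric] distrib_left cis_multiple_2pi)
    qed
    have "continuous_map euclideanreal euclidean (?f \<circ> circle_proj)"
      unfolding o_def f by (auto intro!: continuous_intros simp: cis_conv_exp)
    then show "continuous_map (mtop circle) euclidean ?f"
      unfolding circle_def manifold.select_convs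
      by (rule continuous_compose_quotient_map[OF quotient_map_quotient_topology])
    show "inj_on ?f (points circle)"
    proof (rule inj_onI)
      fix y z assume "y \<in> points circle" "z \<in> points circle" and eq: "?f y = ?f z"
      then obtain s t where st: "y = circle_proj s" "z = circle_proj t" by (auto simp: points_circle)
      then have "cis (2 * pi * s) / cis (2 * pi * t) = 1" using eq by (simp only: f) simp
      then have "cis (2 * pi * (s - t)) = 1" by (simp add: cis_divide right_diff_distrib)
      then have "cos (2 * pi * (s - t)) = 1" by (metis Re_complex_of_real cis.simps(1) of_real_1)
      then obtain n :: int where "2 * pi * (s - t) = of_int n * 2 * pi" by (auto simp: cos_one_2pi_int)
      then have "(2 * pi) * (s - t) = (2 * pi) * of_int n" by (simp add: ac_simps)
      then have "s - t = of_int n" using pi_neq_zero by (simp only: mult_cancel_left) simp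
      then show "y = z" by (simp add: st circle_proj_eq_iff)
    qed
  qed simp
  fix c d assume c: "c \<in> atlas circle" and d: "d \<in> atlas circle"
  show "smooth_on (cmap c ` (cdom c \<inter> cdom d)) (cmap d \<circ> cinv c)"
  proof (rule smooth_on_local)
    fix x assume "x \<in> cmap c ` (cdom c \<inter> cdom d)"
    then obtain V n where V: "open V" "x \<in> V" "\<And>y. y \<in> V \<Longrightarrow> (cmap d \<circ> cinv c) y = y + n"
      using circle_transition_local[OF c d] by blast
    have "smooth_on V (cmap d \<circ> cinv c)"
      by (rule smooth_on_cong[OF V(1) _ smooth_on_add[OF V(1) smooth_on_ident smooth_on_const[of _ n]]])
        (simp add: V(3) del: o_apply)
    then show "\<exists>U. open U \<and> x \<in> U \<and> smooth_on U (cmap d \<circ> cinv c)" using V by blast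
  qed
qed (use circle_chart_properties in auto)

lemma circle_jacobian:
  assumes "chart_around circle c q" "chart_around circle d q"
  shows "fderiv (cmap d \<circ> cinv c) (cmap c q) w = w"
proof -
  have "c \<in> atlas circle" "d \<in> atlas circle" "cmap c q \<in> cmap c ` (cdom c \<inter> cdom d)"
    using assms by (auto simp: chart_around_def)
  from circle_transition_local[OF this]
  obtain V n where V: "open V" "cmap c q \<in> V" "\<And>y. y \<in> V \<Longrightarrow> (cmap d \<circ> cinv c) y = y + n"
    by blast
  have "((\<lambda>y. y + n) has_derivative (\<lambda>w. w)) (at (cmap c q))"
    by (auto intro!: derivative_eq_intros)
  then have "((cmap d \<circ> cinv c) has_derivative (\<lambda>w. w)) (at (cmap c q))"
    by (rule has_derivative_transform_within_open[OF _ V(1,2)]) (simp add: V(3) del: o_apply)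
  then show ?thesis by (simp add: frechet_derivative_eqI)
qed

lemma vector_field_circle: "vector_field circle (const_field circle 1)"
  unfolding vector_field_def
proof (intro conjI ballI)
  interpret smooth_mfd circle by unfold_locales (rule smooth_circle)
  show "const_field circle 1 q \<in> tangent_space circle q" for q
    unfolding tangent_space_def const_field_def by (simp add: circle_jacobian del: split_paired_All)
  fix c assume c: "c \<in> atlas circle"
  show "smooth_on (cimg c) (field_in (const_field circle 1) c)"
    by (rule smooth_on_cong[OF open_cimg[OF c] _ smooth_on_const[of _ 1]])
      (simp add: field_in_def const_field_def chart_around_cinv[OF c])
qed

lemma chart_around_prod:
  "chart_around (prod_manifold M N) (prod_chart c d) (p, q)" if "chart_around M c p" "chart_around N d q"
  using that by (simp add: chart_around_def prod_chart_in_atlas)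

lemma chart_around_prodE:
  assumes "chart_around (prod_manifold M N) C (p, q)"
  obtains c d where "C = prod_chart c d" "chart_around M c p" "chart_around N d q"
proof -
  obtain c d where "C = prod_chart c d" "c \<in> atlas M" "d \<in> atlas N"
    using assms unfolding chart_around_def by (blast elim: prod_atlasE)
  then show thesis using that assms by (simp add: chart_around_def)
qed

lemma prod_jacobian:
  fixes M :: "('a, 'e::real_normed_vector) manifold" and N :: "('b, 'f::real_normed_vector) manifold"
  assumes "smooth_manifold M" "smooth_manifold N" "chart_around M c p" "chart_around N d q"
    "chart_around M c' p" "chart_around N d' q"
  shows "fderiv (cmap (prod_chart c' d') \<circ> cinv (prod_chart c d))
      (cmap (prod_chart c d) (p, q)) (v, w) =
    (fderiv (cmap c' \<circ> cinv c) (cmap c p) v,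
     fderiv (cmap d' \<circ> cinv d) (cmap d q) w)"
proof -
  interpret M: smooth_mfd M by unfold_locales fact
  interpret N: smooth_mfd N by unfold_locales fact
  have at: "c \<in> atlas M" "d \<in> atlas N" using assms by (simp_all add: chart_around_def)
  note D1 = M.transition_has_derivative[OF assms(3,5)] and D2 = N.transition_has_derivative[OF assms(4,6)]
  have "((\<lambda>z. (M.transition c c' (fst z), N.transition d d' (snd z))) has_derivative
      (\<lambda>z. (M.jacobian c c' p (fst z), N.jacobian d d' q (snd z)))) (at (cmap c p, cmap d q))"
    using D1 D2
    by (intro has_derivative_Pair
        has_derivative_compose[where f = fst and f' = fst and g = "M.transition c c'" and g' = "M.jacobian c c' p"]
        has_derivative_compose[where f = snd and f' = snd and g = "N.transition d d'" and g' = "N.jacobian d d' q"])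
      (auto intro!: bounded_linear_imp_has_derivative bounded_linear_fst bounded_linear_snd simp del: o_apply)
  then have "((cmap (prod_chart c' d') \<circ> cinv (prod_chart c d)) has_derivative
      (\<lambda>z. (M.jacobian c c' p (fst z), N.jacobian d d' q (snd z)))) (at (cmap c p, cmap d q))"
  proof (rule has_derivative_transform_within_open[of _ _ _ _ "cimg c \<times> cimg d"])
    show "open (cimg c \<times> cimg d)" using M.open_cimg N.open_cimg at by (simp add: open_Times)
    show "(cmap c p, cmap d q) \<in> cimg c \<times> cimg d" using M.cmap_in_cimg N.cmap_in_cimg assms by simp
    show "(M.transition c c' (fst z), N.transition d d' (snd z))
        = (cmap (prod_chart c' d') \<circ> cinv (prod_chart c d)) z" if "z \<in> cimg c \<times> cimg d" for z
      using that cinv_prod_chart[OF assms(1,2) at] by (cases z) simp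
  qed
  then show ?thesis by (simp add: frechet_derivative_eqI)
qed

text \<open>\<open>prod_field\<close> is defined by the preferred charts of the factors; the
  transformation law in each factor extends its formula to all product charts.\<close>

lemma prod_field_component:
  fixes M :: "('a, 'e::real_normed_vector) manifold" and N :: "('b, 'f::real_normed_vector) manifold"
  assumes "smooth_flow M X" "smooth_flow N Z" "chart_around M c p" "chart_around N d q"
  shows "prod_field M N X Z (p, q) (prod_chart c d) = (X p c, Z q d)"
proof -
  interpret M: smooth_mfd M using assms(1) by unfold_locales (simp add: smooth_flow_def)
  interpret N: smooth_mfd N using assms(2) by unfold_locales (simp add: smooth_flow_def)
  have pq: "p \<in> points M" "q \<in> points N"
    using M.chart_around_points N.chart_around_points assms by auto
  note at = M.chart_at[OF pq(1)] N.chart_at[OF pq(2)]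
  have "X p c = M.jacobian (chart_at M p) c p (X p (chart_at M p))"
    using M.tangent_spaceD(2)[OF _ at(1) assms(3)] assms(1) pq
    by (simp add: smooth_flow_def vector_field_def)
  moreover have "Z q d = N.jacobian (chart_at N q) d q (Z q (chart_at N q))"
    using N.tangent_spaceD(2)[OF _ at(2) assms(4)] assms(2) pq
    by (simp add: smooth_flow_def vector_field_def)
  ultimately show ?thesis
    using prod_jacobian[OF M.smooth_manifold N.smooth_manifold at assms(3,4)]
      chart_around_prod[OF assms(3,4)]
    by (simp add: prod_field_def Let_def tangent_of_def)
qed

lemma smooth_flow_prod_field:
  fixes M :: "('a, 'e::real_normed_vector) manifold" and N :: "('b, 'f::real_normed_vector) manifold"
  assumes "smooth_flow M X" "smooth_flow N Z"
  shows "smooth_flow (prod_manifold M N) (prod_field M N X Z)"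
  unfolding smooth_flow_def
proof
  interpret M: smooth_mfd M using assms(1) by unfold_locales (simp add: smooth_flow_def)
  interpret N: smooth_mfd N using assms(2) by unfold_locales (simp add: smooth_flow_def)
  show P: "smooth_manifold (prod_manifold M N)"
    by (rule smooth_prod_manifold[OF M.smooth_manifold N.smooth_manifold])
  interpret P: smooth_mfd "prod_manifold M N" by unfold_locales fact
  show "vector_field (prod_manifold M N) (prod_field M N X Z)"
    unfolding vector_field_def
  proof (intro conjI ballI)
    fix z assume "z \<in> points (prod_manifold M N)"
    then obtain p q where z: "z = (p, q)" "p \<in> points M" "q \<in> points N" by auto
    show "prod_field M N X Z z \<in> tangent_space (prod_manifold M N) z"
      using P.tangent_of_in_tangent_space[OF chart_around_prod[OF M.chart_at[OF z(2)] N.chart_at[OF z(3)]]]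
      by (simp add: z prod_field_def Let_def)
  next
    fix C assume "C \<in> atlas (prod_manifold M N)"
    then obtain c d where C: "C = prod_chart c d" "c \<in> atlas M" "d \<in> atlas N" by (rule prod_atlasE)
    have "smooth_on (cimg c \<times> cimg d) (map_prod (field_in X c) (field_in Z d))"
      using assms C(2,3)
      by (intro smooth_on_map_prod M.open_cimg N.open_cimg) (auto simp: smooth_flow_def vector_field_def)
    then have "smooth_on (cimg c \<times> cimg d) (field_in (prod_field M N X Z) C)"
    proof (rule smooth_on_cong[rotated 2])
      show "open (cimg c \<times> cimg d)" using M.open_cimg N.open_cimg C by (simp add: open_Times)
      fix z assume z: "z \<in> cimg c \<times> cimg d"
      then have "chart_around M c (cinv c (fst z))" "chart_around N d (cinv d (snd z))"
        using M.chart_around_cinv[OF C(2)] N.chart_around_cinv[OF C(3)] by auto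
      from prod_field_component[OF assms this]
      show "map_prod (field_in X c) (field_in Z d) z = field_in (prod_field M N X Z) C z"
        using z cinv_prod_chart[OF M.smooth_manifold N.smooth_manifold C(2,3)]
        by (cases z) (simp add: field_in_def C(1))
    qed
    then show "smooth_on (cimg C) (field_in (prod_field M N X Z) C)" by (simp add: C(1))
  qed
qed

lemma circle_product_strongly_adapted:
  fixes M :: "('b, 'm::real_normed_vector) manifold"
  assumes "smooth_flow M X"
  shows "nonsingular_flow (prod_manifold M circle) (prod_field M circle X (const_field circle 1)) \<and>
    strongly_adapted (prod_manifold M circle) (prod_field M circle X (const_field circle 1))
      (dt_form (prod_manifold M circle))"
proof (rule dt_form_strongly_adapted)
  have circle: "smooth_flow circle (const_field circle 1)"
    using smooth_circle vector_field_circle by (simp add: smooth_flow_def)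
  show "smooth_manifold (prod_manifold M circle)"
    "vector_field (prod_manifold M circle) (prod_field M circle X (const_field circle 1))"
    using smooth_flow_prod_field[OF assms circle] by (simp_all add: smooth_flow_def)
  have M: "smooth_manifold M" using assms by (simp add: smooth_flow_def)
  fix C z assume C: "chart_around (prod_manifold M circle) C z"
  obtain p q where z: "z = (p, q)" by (cases z)
  obtain c d where c: "C = prod_chart c d" "chart_around M c p" "chart_around circle d q"
    using chart_around_prodE[OF C[unfolded z]] .
  show "snd (prod_field M circle X (const_field circle 1) z C) = 1"
    using prod_field_component[OF assms circle c(2,3)] c(3) by (simp add: z c(1) const_field_def)
  fix C' v assume C': "chart_around (prod_manifold M circle) C' z"
  obtain c' d' where c': "C' = prod_chart c' d'" "chart_around M c' p" "chart_around circle d' q"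
    using chart_around_prodE[OF C'[unfolded z]] .
  show "snd (fderiv (cmap C' \<circ> cinv C) (cmap C z) v) = snd v"
    using prod_jacobian[OF M smooth_circle c(2,3) c'(2,3), of "fst v" "snd v"]
      circle_jacobian[OF c(3) c'(3)]
    by (simp add: z c(1) c'(1) del: cmap_prod_chart)
qed

section \<open>Suspensions\<close>

text \<open>The suspension is the image of \<open>M \<times> (-1, 1)\<close> under a continuous open map, and its charts are
  the inverses of this map on \<open>M \<times> (0, 1)\<close> and \<open>M \<times> (-1/2, 1/2)\<close>, composed with charts of \<open>M\<close>.\<close>

locale suspension_data = smooth_mfd M
  for M :: "('b, 'm::real_normed_vector) manifold" +
  fixes \<Phi> :: "'b \<Rightarrow> 'b"
  assumes compact: "compact_space (mtop M)" and diffeo: "diffeomorphism M M \<Phi>"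
begin

abbreviation \<Phi>i :: "'b \<Rightarrow> 'b" where "\<Phi>i \<equiv> inv_into (points M) \<Phi>"

abbreviation proj :: "'b \<times> real \<Rightarrow> ('b \<times> real) set" where "proj \<equiv> susp_proj M \<Phi>"

abbreviation S :: "(('b \<times> real) set, 'm \<times> real) manifold" where "S \<equiv> suspension M \<Phi>"

abbreviation cylinder :: "('b \<times> real) topology" where
  "cylinder \<equiv> subtopology (prod_topology (mtop M) euclideanreal) (points M \<times> {0..1})"

abbreviation strip :: "('b \<times> real) topology" where
  "strip \<equiv> subtopology (prod_topology (mtop M) euclideanreal) (points M \<times> {-1<..<1})"

text \<open>For negative times \<open>(y, t)\<close> stands for the identified point
  \<open>(\<Phi>i y, t + 1)\<close>, so the seam lies in the interior of the domain. The map
  \<open>proj\<close> could not serve for this purpose: the image of \<open>M\<close> times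
  \<open>[0, 1/2)\<close> is not open in the suspension of a nonempty \<open>M\<close>, since its
  preimage contains the face at time 1 but no times just below 1.\<close>

definition wrap :: "'b \<times> real \<Rightarrow> ('b \<times> real) set" where
  "wrap = (\<lambda>(y, t). if 0 \<le> t then proj (y, t) else proj (\<Phi>i y, t + 1))"

lemma \<Phi>_bij: "bij_betw \<Phi> (points M) (points M)"
  and smooth_\<Phi>: "smooth_map M M \<Phi>" and smooth_\<Phi>i: "smooth_map M M \<Phi>i"
  using diffeo by (simp_all add: diffeomorphism_def)

lemma \<Phi>_in: "y \<in> points M \<Longrightarrow> \<Phi> y \<in> points M"
  and \<Phi>i_in: "y \<in> points M \<Longrightarrow> \<Phi>i y \<in> points M"
  and \<Phi>_\<Phi>i: "y \<in> points M \<Longrightarrow> \<Phi> (\<Phi>i y) = y"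
  and \<Phi>i_\<Phi>: "y \<in> points M \<Longrightarrow> \<Phi>i (\<Phi> y) = y"
  using \<Phi>_bij bij_betw_inv_into[OF \<Phi>_bij]
  by (auto simp: bij_betw_def bij_betw_inv_into_left bij_betw_inv_into_right f_inv_into_f inv_into_f_f)

lemma continuous_\<Phi>: "continuous_map (mtop M) (mtop M) \<Phi>"
  and continuous_\<Phi>i: "continuous_map (mtop M) (mtop M) \<Phi>i"
  using smooth_\<Phi> smooth_\<Phi>i by (simp_all add: smooth_map_def)

lemma smooth_id: "smooth_map M M id"
  unfolding smooth_map_def
proof (intro conjI ballI)
  fix c d assume "c \<in> atlas M" "d \<in> atlas M"
  moreover have "{p \<in> cdom c. id p \<in> cdom d} = cdom c \<inter> cdom d" by auto
  ultimately show "smooth_on (cmap c ` {p \<in> cdom c. id p \<in> cdom d}) (cmap d \<circ> id \<circ> cinv c)"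
    using smooth_transition by (simp only: comp_id)
qed simp

lemma proj_inner: "y \<in> points M \<Longrightarrow> 0 < t \<Longrightarrow> t < 1 \<Longrightarrow> proj (y, t) = {(y, t)}"
  by (auto simp: susp_proj_def susp_rel_def susp_space_def)

lemma proj_0: "y \<in> points M \<Longrightarrow> proj (y, 0) = {(y, 0), (\<Phi>i y, 1)}"
  using \<Phi>i_in \<Phi>_\<Phi>i \<Phi>i_\<Phi> by (auto simp: susp_proj_def susp_rel_def susp_space_def)

lemma proj_1: "y \<in> points M \<Longrightarrow> proj (y, 1) = proj (\<Phi> y, 0)"
  unfolding proj_0[OF \<Phi>_in] using \<Phi>_in \<Phi>_\<Phi>i \<Phi>i_\<Phi>
  by (auto simp: susp_proj_def susp_rel_def susp_space_def)

lemma wrap_pos: "y \<in> points M \<Longrightarrow> 0 < t \<Longrightarrow> t < 1 \<Longrightarrow> wrap (y, t) = {(y, t)}"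
  by (simp add: wrap_def proj_inner)

lemma wrap_0: "y \<in> points M \<Longrightarrow> wrap (y, 0) = {(y, 0), (\<Phi>i y, 1)}"
  by (simp add: wrap_def proj_0)

lemma wrap_neg: "y \<in> points M \<Longrightarrow> t < 0 \<Longrightarrow> -1 < t \<Longrightarrow> wrap (y, t) = {(\<Phi>i y, t + 1)}"
  using proj_inner[OF \<Phi>i_in, of y "t + 1"] by (simp add: wrap_def)

lemma wrap_shift:
  assumes "y \<in> points M" "0 < t" "t < 1"
  shows "wrap (\<Phi> y, t - 1) = wrap (y, t)"
  using wrap_neg[OF \<Phi>_in[OF assms(1)], of "t - 1"] assms by (simp add: wrap_pos \<Phi>i_\<Phi>)

lemma wrap_mem:
  assumes "w \<in> wrap (y, t)" "y \<in> points M" "t \<in> {-1<..<1}"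
  shows "0 \<le> t \<and> w = (y, t) \<or> t = 0 \<and> w = (\<Phi>i y, 1) \<or> t < 0 \<and> w = (\<Phi>i y, t + 1)"
proof -
  consider "t > 0" | "t = 0" | "t < 0" by linarith
  then show ?thesis
    by cases (use assms wrap_pos[of y t] wrap_0[of y] wrap_neg[of y t] in auto)
qed

lemma wrap_self:
  assumes "y \<in> points M" "t \<in> {-1<..<1}"
  shows "0 \<le> t \<Longrightarrow> (y, t) \<in> wrap (y, t)" "t < 0 \<Longrightarrow> (\<Phi>i y, t + 1) \<in> wrap (y, t)"
  using assms wrap_pos[of y t] wrap_0[of y] wrap_neg[of y t] by (auto simp: le_less)

text \<open>Within the strip, a point has at most two representatives, exchanged by
  \<open>(y, t) \<mapsto> (\<Phi> y, t - 1)\<close> and its inverse. Injectivity on charts and the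
  list of possible changes of charts both follow from this.\<close>

lemma wrap_eqD:
  assumes "wrap (y, t) = wrap (z, s)" "y \<in> points M" "z \<in> points M" "t \<in> {-1<..<1}" "s \<in> {-1<..<1}"
  shows "(z, s) = (y, t) \<or> (t < 0 \<and> z = \<Phi>i y \<and> s = t + 1) \<or> (t > 0 \<and> z = \<Phi> y \<and> s = t - 1)"
proof (cases "0 \<le> s")
  case True
  then have "(z, s) \<in> wrap (y, t)" unfolding assms(1) by (rule wrap_self(1)[OF assms(3,5)])
  from wrap_mem[OF this assms(2,4)] show ?thesis using assms(5) by auto
next
  case False
  then have "(\<Phi>i z, s + 1) \<in> wrap (y, t)"
    unfolding assms(1) by (intro wrap_self(2)[OF assms(3,5)]) simp
  from wrap_mem[OF this assms(2,4)]
  consider "0 \<le> t" "\<Phi>i z = y" "s + 1 = t" | "t < 0" "\<Phi>i z = \<Phi>i y" "s = t"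
    using False by auto
  then show ?thesis
  proof cases
    case 1
    then have "z = \<Phi> y" using \<Phi>_\<Phi>i[OF assms(3)] by simp
    then show ?thesis using 1 assms(5) by auto
  next
    case 2
    then have "z = y" using \<Phi>_\<Phi>i[OF assms(3)] \<Phi>_\<Phi>i[OF assms(2)] by metis
    then show ?thesis using 2 by simp
  qed
qed

lemma topspace_cylinder: "topspace cylinder = points M \<times> {0..1}"
  and topspace_strip: "topspace strip = points M \<times> {-1<..<1}"
  by auto

lemma mtop_S: "mtop S = quotient_topology cylinder proj"
  by (simp add: suspension_def susp_space_def)

lemma continuous_proj: "continuous_map cylinder (mtop S) proj"
  unfolding mtop_S by (rule quotient_imp_continuous_map[OF quotient_map_quotient_topology])

lemma points_S: "points S = proj ` (points M \<times> {0..1})"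
  unfolding mtop_S topspace_quotient_topology topspace_cylinder ..

lemma continuous_cylinder_map:
  assumes "continuous_map (mtop M) (mtop M) F" "continuous_on UNIV h"
  shows "continuous_map (subtopology (prod_topology (mtop M) euclideanreal) A)
    (prod_topology (mtop M) euclideanreal) (\<lambda>x. (F (fst x), h (snd x)))"
proof -
  have "continuous_map euclideanreal euclideanreal h" using assms(2) by simp
  then show ?thesis
    using continuous_map_compose[OF continuous_map_fst assms(1)]
      continuous_map_compose[OF continuous_map_snd, of euclideanreal euclideanreal h]
    by (intro continuous_map_from_subtopology continuous_map_pairedI) (simp_all add: o_def)
qed

lemma wrap_image: "wrap ` (points M \<times> {-1<..<1}) = points S"
  unfolding points_S
proof (intro equalityI subsetI)
  fix z assume "z \<in> wrap ` (points M \<times> {-1<..<1})"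
  then obtain y t where yt: "z = wrap (y, t)" "y \<in> points M" "t \<in> {-1<..<1}" by auto
  show "z \<in> proj ` (points M \<times> {0..1})"
  proof (cases "0 \<le> t")
    case True
    then show ?thesis using yt by (auto simp: wrap_def)
  next
    case False
    then show ?thesis using yt \<Phi>i_in[of y] by (auto simp: wrap_def)
  qed
next
  fix z assume "z \<in> proj ` (points M \<times> {0..1})"
  then obtain y t where yt: "z = proj (y, t)" "y \<in> points M" "t \<in> {0..1}" by auto
  show "z \<in> wrap ` (points M \<times> {-1<..<1})"
  proof (cases "t = 1")
    case True
    then have "z = wrap (\<Phi> y, 0)" using yt proj_1 by (simp add: wrap_def)
    then show ?thesis using \<Phi>_in[of y] yt by auto
  next
    case False
    then have "z = wrap (y, t)" using yt by (simp add: wrap_def)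
    then show ?thesis using False yt by auto
  qed
qed

text \<open>The two formulas are continuous on the closed halves of the strip and agree at time 0
  because \<open>(\<Phi>i y, 1)\<close> is identified with \<open>(y, 0)\<close>.\<close>

lemma continuous_wrap: "continuous_map strip (mtop S) wrap"
proof -
  let ?X = "prod_topology (mtop M) euclideanreal"
  have snd: "continuous_map strip euclideanreal snd"
    by (intro continuous_map_from_subtopology continuous_map_snd)
  have "continuous_map strip (mtop S) (\<lambda>x. if 0 \<le> snd x then proj x else proj (\<Phi>i (fst x), snd x + 1))"
  proof (rule continuous_map_cases_le)
    show "continuous_map strip euclideanreal (\<lambda>x. 0)" by simp
    show "continuous_map strip euclideanreal snd" by (rule snd)
    have "continuous_map (subtopology strip {x \<in> topspace strip. 0 \<le> snd x}) cylinder (\<lambda>x. x)"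
      by (intro continuous_map_into_subtopology continuous_map_from_subtopology) auto
    from continuous_map_compose[OF this continuous_proj]
    show "continuous_map (subtopology strip {x \<in> topspace strip. 0 \<le> snd x}) (mtop S) proj"
      by (simp add: o_def)
    have shift: "continuous_map strip ?X (\<lambda>x. (\<Phi>i (fst x), snd x + 1))"
      by (intro continuous_cylinder_map continuous_\<Phi>i continuous_intros)
    have "continuous_map (subtopology strip {x \<in> topspace strip. snd x \<le> 0}) cylinder
        (\<lambda>x. (\<Phi>i (fst x), snd x + 1))"
      by (rule continuous_map_into_subtopology[OF continuous_map_from_subtopology[OF shift]])
        (auto simp: \<Phi>i_in)
    from continuous_map_compose[OF this continuous_proj]
    show "continuous_map (subtopology strip {x \<in> topspace strip. snd x \<le> 0}) (mtop S)
        (\<lambda>x. proj (\<Phi>i (fst x), snd x + 1))"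
      by (simp add: o_def)
    show "proj x = proj (\<Phi>i (fst x), snd x + 1)" if x: "x \<in> topspace strip" "0 = snd x" for x
    proof -
      have "x = (fst x, 0)" "fst x \<in> points M" using x by (auto intro: prod_eqI)
      then obtain y where "x = (y, 0)" "y \<in> points M" by blast
      then show ?thesis using proj_1[OF \<Phi>i_in] by (simp add: \<Phi>_\<Phi>i)
    qed
  qed
  moreover have "wrap = (\<lambda>x. if 0 \<le> snd x then proj x else proj (\<Phi>i (fst x), snd x + 1))"
    by (simp add: fun_eq_iff wrap_def)
  ultimately show ?thesis by simp
qed

lemma open_wrap: "open_map strip (mtop S) wrap"
  unfolding open_map_def
proof (intro allI impI)
  let ?X = "prod_topology (mtop M) euclideanreal"
  fix U assume U: "openin strip U"
  have strip_open: "openin ?X (points M \<times> {-1<..<1})" by (simp add: openin_prod_Times_iff)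
  have UX: "openin ?X U" and Us: "U \<subseteq> points M \<times> {-1<..<1}"
    using U openin_open_subtopology[OF strip_open] by auto
  have eq: "{x \<in> topspace cylinder. proj x \<in> wrap ` U} =
      {x \<in> topspace cylinder. x \<in> U} \<union> {x \<in> topspace cylinder. (\<Phi> (fst x), snd x - 1) \<in> U}"
  proof (intro equalityI subsetI)
    fix x assume "x \<in> {x \<in> topspace cylinder. proj x \<in> wrap ` U}"
    then obtain y s where x: "x = (y, s)" "y \<in> points M" "s \<in> {0..1}" "proj (y, s) \<in> wrap ` U" by auto
    then obtain z t where zt: "(z, t) \<in> U" "proj (y, s) = wrap (z, t)" by auto
    then have z: "z \<in> points M" "t \<in> {-1<..<1}" using Us by auto
    have "(y, s) \<in> U \<or> (\<Phi> y, s - 1) \<in> U"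
    proof (cases "s = 1")
      case True
      then have "wrap (\<Phi> y, 0) = wrap (z, t)" using zt x proj_1 by (simp add: wrap_def)
      from wrap_eqD[OF this \<Phi>_in z(1)] show ?thesis using x z zt True by auto
    next
      case False
      then have "wrap (y, s) = wrap (z, t)" using zt x by (simp add: wrap_def)
      from wrap_eqD[OF this x(2) z(1)] show ?thesis using x z zt False by auto
    qed
    then show "x \<in> {x \<in> topspace cylinder. x \<in> U} \<union> {x \<in> topspace cylinder. (\<Phi> (fst x), snd x - 1) \<in> U}"
      using x by auto
  next
    fix x assume x: "x \<in> {x \<in> topspace cylinder. x \<in> U} \<union> {x \<in> topspace cylinder. (\<Phi> (fst x), snd x - 1) \<in> U}"
    then obtain y s where ys: "x = (y, s)" "y \<in> points M" "s \<in> {0..1}" by auto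
    consider "(y, s) \<in> U" | "(\<Phi> y, s - 1) \<in> U" using x ys by auto
    then have "proj (y, s) \<in> wrap ` U"
    proof cases
      case 1
      have "proj (y, s) = wrap (y, s)" using ys by (simp add: wrap_def)
      then show ?thesis using 1 by simp
    next
      case 2
      have "proj (y, s) = wrap (\<Phi> y, s - 1)"
      proof (cases "s = 1")
        case True
        then show ?thesis using ys proj_1 by (simp add: wrap_def)
      next
        case False
        \<comment> \<open>At \<open>s = 0\<close> the shifted time would be -1, which lies outside
          the open strip.\<close>
        moreover have "s \<noteq> 0" using 2 Us by auto
        ultimately show ?thesis using ys wrap_shift[of y s] by (simp add: wrap_def)
      qed
      then show ?thesis using 2 by simp
    qed
    then show "x \<in> {x \<in> topspace cylinder. proj x \<in> wrap ` U}" using ys by simp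
  qed
  have "continuous_map cylinder ?X (\<lambda>x. x)"
    by (intro continuous_map_from_subtopology) simp
  from openin_continuous_map_preimage[OF this UX]
  have 1: "openin cylinder {x \<in> topspace cylinder. x \<in> U}" .
  have "continuous_map cylinder ?X (\<lambda>x. (\<Phi> (fst x), snd x - 1))"
    by (intro continuous_cylinder_map continuous_\<Phi> continuous_intros)
  from openin_continuous_map_preimage[OF this UX]
  have 2: "openin cylinder {x \<in> topspace cylinder. (\<Phi> (fst x), snd x - 1) \<in> U}" .
  have "wrap ` U \<subseteq> proj ` topspace cylinder"
    using Us wrap_image unfolding points_S topspace_cylinder by blast
  then show "openin (mtop S) (wrap ` U)"
    unfolding mtop_S openin_quotient_topology eq using openin_Un[OF 1 2] by blast
qed

section \<open>Countability and separation of the suspension\<close>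

lemma second_countable_S: "second_countable (mtop S)"
proof (rule second_countable_open_map_image[OF continuous_wrap open_wrap])
  show "wrap ` topspace strip = points S" unfolding topspace_strip by (rule wrap_image)
  show "second_countable strip"
    using smooth_manifold unfolding smooth_manifold_def
    by (intro second_countable_subtopology second_countable_prod_topology second_countable_euclidean) simp
qed

text \<open>Points are identified across the two end faces, so the saturation of a closed set adds
  to it only subsets of these faces, given by closed conditions in terms of \<open>\<Phi>\<close>
  and \<open>\<Phi>i\<close>.\<close>

lemma closed_proj: "closed_map cylinder (mtop S) proj"
  unfolding closed_map_def
proof (intro allI impI)
  fix C assume C: "closedin cylinder C"
  then have Cs: "C \<subseteq> points M \<times> {0..1}" using closedin_subset topspace_cylinder by blast
  \<comment> \<open>The reflection of time is relevant on the two faces, which it exchanges. Unlike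
    a shift by 1 it maps the whole cylinder to itself, so that preimages of closed sets can be taken
    there.\<close>
  have flip: "continuous_map cylinder cylinder (\<lambda>x. (F (fst x), 1 - snd x))"
    if "continuous_map (mtop M) (mtop M) F" for F
  proof (rule continuous_map_into_subtopology)
    show "continuous_map cylinder (prod_topology (mtop M) euclideanreal) (\<lambda>x. (F (fst x), 1 - snd x))"
      by (intro continuous_cylinder_map that continuous_intros)
    show "(\<lambda>x. (F (fst x), 1 - snd x)) \<in> topspace cylinder \<rightarrow> points M \<times> {0..1}"
      using that by (auto simp: continuous_map_def Pi_iff)
  qed
  have level: "closedin cylinder {x \<in> topspace cylinder. snd x \<in> {r}}" for r
    by (rule closedin_continuous_map_preimage[OF continuous_map_from_subtopology[OF continuous_map_snd]]) simp
  have eq: "{x \<in> topspace cylinder. proj x \<in> proj ` C} = C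
      \<union> ({x \<in> topspace cylinder. snd x \<in> {1}} \<inter> {x \<in> topspace cylinder. (\<Phi> (fst x), 1 - snd x) \<in> C})
      \<union> ({x \<in> topspace cylinder. snd x \<in> {0}} \<inter> {x \<in> topspace cylinder. (\<Phi>i (fst x), 1 - snd x) \<in> C})"
    (is "?L = ?R")
  proof (intro equalityI subsetI)
    fix x assume "x \<in> ?L"
    then obtain y s w where x: "x = (y, s)" "y \<in> points M" "s \<in> {0..1}" "w \<in> C" "proj (y, s) = proj w"
      by auto
    have "w \<in> proj w" using x(4) Cs by (auto simp: susp_proj_def susp_rel_def susp_space_def)
    then have "w \<in> proj (y, s)" unfolding x(5) .
    then have "(x, w) \<in> susp_rel M \<Phi>" unfolding susp_proj_def x(1) by (rule Image_singleton_iff[THEN iffD1])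
    then have "w = (y, s) \<or> (s = 1 \<and> w = (\<Phi> y, 0)) \<or> (s = 0 \<and> w = (\<Phi>i y, 1))"
      using \<Phi>i_\<Phi> by (auto simp: susp_rel_def susp_space_def x(1))
    then show "x \<in> ?R" using x by auto
  next
    fix x assume R: "x \<in> ?R"
    then obtain y s where x: "x = (y, s)" "y \<in> points M" "s \<in> {0..1}" using Cs by auto
    consider "(y, s) \<in> C" | "s = 1" "(\<Phi> y, 0) \<in> C" | "s = 0" "(\<Phi>i y, 1) \<in> C" using R x by auto
    then have "proj x \<in> proj ` C"
    proof cases
      case 2
      then show ?thesis using proj_1[OF x(2)] x(1) by simp
    next
      case 3
      then show ?thesis using proj_1[OF \<Phi>i_in[OF x(2)]] x(1) \<Phi>_\<Phi>i[OF x(2)] by (metis image_eqI)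
    qed (use x in auto)
    then show "x \<in> ?L" using x by simp
  qed
  have "closedin cylinder {x \<in> topspace cylinder. proj x \<in> proj ` C}"
    unfolding eq
    by (intro closedin_Un closedin_Int C level closedin_continuous_map_preimage[OF flip C]
        continuous_\<Phi> continuous_\<Phi>i)
  moreover have "proj ` C \<subseteq> points S" using Cs unfolding points_S by blast
  ultimately show "closedin (mtop S) (proj ` C)"
    using quotient_map_quotient_topology[of cylinder proj] unfolding mtop_S quotient_map_closedin by blast
qed

text \<open>Compactness of \<open>M\<close> enters here: the cylinder is compact and Hausdorff,
  hence normal, and a closed continuous image of a normal Hausdorff space is Hausdorff.\<close>

lemma Hausdorff_S: "Hausdorff_space (mtop S)"
proof -
  have cyl: "cylinder = prod_topology (mtop M) (top_of_set {0..1})"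
    by (simp add: subtopology_Times)
  have comp: "compact_space cylinder"
    unfolding cyl compact_space_prod_topology using compact
    by (simp add: compact_space_subtopology)
  have haus: "Hausdorff_space cylinder"
    using smooth_manifold unfolding smooth_manifold_def
    by (intro Hausdorff_space_subtopology) (simp add: Hausdorff_space_prod_topology)
  then have "normal_space cylinder"
    using compact_Hausdorff_or_regular_imp_normal_space[OF comp] by blast
  moreover have "proj ` topspace cylinder = points S" unfolding points_S topspace_cylinder ..
  ultimately show ?thesis
    using normal_Hausdorff_space_closed_continuous_map_image[OF _ haus closed_proj continuous_proj] by blast
qed

text \<open>Both kinds of charts invert \<open>wrap\<close> on a product with an open time interval
  \<open>J\<close>, namely \<open>(0, 1)\<close> for the inner charts and \<open>(-1/2, 1/2)\<close>
  for those at the seam. Different representatives of a point have times that differ by 1, so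
  \<open>wrap\<close> is injective over an open interval of length 1.\<close>

lemma suspension_chart:
  assumes "C \<in> atlas S"
  obtains c J where "c \<in> atlas M" "open J" "J \<subseteq> {-1<..<1}" "inj_on wrap (points M \<times> J)"
    "cdom C = wrap ` (cdom c \<times> J)" "\<forall>y\<in>cdom c. \<forall>t\<in>J. cmap C (wrap (y, t)) = (cmap c y, t)"
proof -
  from assms consider c where "c \<in> atlas M" "C = susp_chart_inner M \<Phi> c"
    | c where "c \<in> atlas M" "C = susp_chart_seam M \<Phi> c"
    unfolding suspension_def manifold.select_convs by blast
  then show thesis
  proof cases
    case 1
    then have sub: "cdom c \<subseteq> points M" using cdom_subset by blast
    show thesis
    proof (rule that[OF 1(1)])
      show "open {0::real<..<1}" "{0::real<..<1} \<subseteq> {-1<..<1}" by auto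
      show "inj_on wrap (points M \<times> {0<..<1})"
        by (rule inj_onI) (auto simp: wrap_pos)
      show "cdom C = wrap ` (cdom c \<times> {0<..<1})"
        unfolding 1(2) susp_chart_inner_def fst_conv
        by (rule image_cong) (auto simp: wrap_def)
      show "\<forall>y\<in>cdom c. \<forall>t\<in>{0<..<1}. cmap C (wrap (y, t)) = (cmap c y, t)"
        using sub by (auto simp: 1(2) susp_chart_inner_def wrap_pos subset_iff)
    qed
  next
    case 2
    then have sub: "cdom c \<subseteq> points M" using cdom_subset by blast
    let ?J = "{-1/2<..<1/2::real}"
    show thesis
    proof (rule that[OF 2(1)])
      show "open ?J" "?J \<subseteq> {-1<..<1}" by auto
      show "inj_on wrap (points M \<times> ?J)"
      proof (rule inj_onI)
        fix w w' assume "w \<in> points M \<times> ?J" "w' \<in> points M \<times> ?J" and eq: "wrap w = wrap w'"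
        then obtain y t z s where w: "w = (y, t)" "w' = (z, s)" "y \<in> points M" "z \<in> points M"
          "t \<in> ?J" "s \<in> ?J" by auto
        have "t \<in> {-1<..<1}" "s \<in> {-1<..<1}" using w by auto
        from wrap_eqD[OF eq[unfolded w(1,2)] w(3,4) this] show "w = w'" using w by auto
      qed
      show "cdom C = wrap ` (cdom c \<times> ?J)"
        unfolding 2(2) susp_chart_seam_def fst_conv
      proof (intro equalityI subsetI)
        fix z assume "z \<in> proj ` (cdom c \<times> {0..<1/2} \<union> {y \<in> points M. \<Phi> y \<in> cdom c} \<times> {1/2<..1})"
        then consider y t where "z = proj (y, t)" "y \<in> cdom c" "t \<in> {0..<1/2}"
          | y t where "z = proj (y, t)" "y \<in> points M" "\<Phi> y \<in> cdom c" "t \<in> {1/2<..1}" by auto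
        then show "z \<in> wrap ` (cdom c \<times> ?J)"
        proof cases
          case (1 y t)
          then have "z = wrap (y, t)" by (simp add: wrap_def)
          then show ?thesis using 1 by auto
        next
          case (2 y t)
          have "z = wrap (\<Phi> y, t - 1)"
          proof (cases "t = 1")
            case True
            then show ?thesis using 2 proj_1 by (simp add: wrap_def)
          next
            case False
            then show ?thesis using 2 wrap_shift[of y t] by (simp add: wrap_def)
          qed
          then show ?thesis using 2 by auto
        qed
      next
        fix z assume "z \<in> wrap ` (cdom c \<times> ?J)"
        then obtain y t where z: "z = wrap (y, t)" "y \<in> cdom c" "t \<in> ?J" by auto
        show "z \<in> proj ` (cdom c \<times> {0..<1/2} \<union> {y \<in> points M. \<Phi> y \<in> cdom c} \<times> {1/2<..1})"
        proof (cases "0 \<le> t")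
          case True
          then show ?thesis using z by (auto simp: wrap_def)
        next
          case False
          have "y \<in> points M" using z sub by blast
          then have "(\<Phi>i y, t + 1) \<in> {y \<in> points M. \<Phi> y \<in> cdom c} \<times> {1/2<..1}"
            using z False by (simp add: \<Phi>i_in \<Phi>_\<Phi>i)
          then show ?thesis using z False by (auto simp: wrap_def)
        qed
      qed
      show "\<forall>y\<in>cdom c. \<forall>t\<in>?J. cmap C (wrap (y, t)) = (cmap c y, t)"
      proof (intro ballI)
        fix y t assume y: "y \<in> cdom c" and t: "t \<in> ?J"
        have yM: "y \<in> points M" using y sub by blast
        \<comment> \<open>At time 0 the class has two members, \<open>(y, 0)\<close> and
          \<open>(\<Phi>i y, 1)\<close>; both are sent to the same coordinates, so
          \<open>the_elem\<close> is determined.\<close>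
        consider "t > 0" | "t = 0" | "t < 0" by linarith
        then show "cmap C (wrap (y, t)) = (cmap c y, t)"
          by cases (use t in \<open>simp_all add: 2(2) susp_chart_seam_def wrap_pos[OF yM] wrap_0[OF yM]
              wrap_neg[OF yM] \<Phi>_\<Phi>i[OF yM]\<close>)
      qed
    qed
  qed
qed

lemma suspension_chart_properties:
  assumes "C \<in> atlas S"
  shows "openin (mtop S) (cdom C)" "open (cimg C)"
    "homeomorphic_map (subtopology (mtop S) (cdom C)) (top_of_set (cimg C)) (cmap C)"
proof -
  obtain c J where C: "c \<in> atlas M" "open J" "J \<subseteq> {-1<..<1}" "inj_on wrap (points M \<times> J)"
    "cdom C = wrap ` (cdom c \<times> J)" "\<forall>y\<in>cdom c. \<forall>t\<in>J. cmap C (wrap (y, t)) = (cmap c y, t)"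
    by (rule suspension_chart[OF assms])
  have sub: "cdom c \<subseteq> points M" by (rule cdom_subset[OF C(1)])
  have strip_open: "openin (prod_topology (mtop M) euclideanreal) (points M \<times> {-1<..<1})"
    by (simp add: openin_prod_Times_iff)
  have U: "openin strip (cdom c \<times> J)"
    unfolding openin_open_subtopology[OF strip_open]
    using openin_cdom[OF C(1)] C(2,3) sub by (auto simp: openin_prod_Times_iff)
  have inj: "inj_on wrap (cdom c \<times> J)"
    by (rule inj_on_subset[OF C(4)]) (use sub in auto)
  have "subtopology strip (cdom c \<times> J) = prod_topology (subtopology (mtop M) (cdom c)) (top_of_set J)"
    using C(3) sub by (simp add: subtopology_subtopology Times_Int_Times Int_absorb1 subtopology_Times)
  moreover have "prod_topology (top_of_set (cimg c)) (top_of_set J) = top_of_set (cimg c \<times> J)"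
    by simp
  moreover have "homeomorphic_map (top_of_set J) (top_of_set J) id"
    unfolding homeomorphic_map_id by (rule refl)
  ultimately have h: "homeomorphic_map (subtopology strip (cdom c \<times> J)) (top_of_set (cimg c \<times> J))
      (map_prod (cmap c) id)"
    using homeomorphic_map_prod[OF homeomorphic_cmap[OF C(1)]] by metis
  have "cmap C (wrap x) = map_prod (cmap c) id x" if "x \<in> cdom c \<times> J" for x
    using that C(6) by auto
  note * = open_map_chart[OF continuous_wrap open_wrap U inj h this]
  show "openin (mtop S) (cdom C)" using *(1) C(5) by simp
  have img: "cimg C = cimg c \<times> J" using *(2) C(5) by (simp add: cimg_def)
  then show "open (cimg C)" using open_cimg[OF C(1)] C(2) by (simp add: open_Times)
  show "homeomorphic_map (subtopology (mtop S) (cdom C)) (top_of_set (cimg C)) (cmap C)"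
    using *(3) C(5) img by simp
qed

section \<open>Changes of charts of the suspension\<close>

lemma smooth_map_open_domain:
  assumes "smooth_map M M F" "c \<in> atlas M" "d \<in> atlas M"
  shows "open (cmap c ` {p \<in> cdom c. F p \<in> cdom d})"
    "smooth_on (cmap c ` {p \<in> cdom c. F p \<in> cdom d}) (cmap d \<circ> F \<circ> cinv c)"
proof -
  have "continuous_map (mtop M) (mtop M) F" using assms(1) by (simp add: smooth_map_def)
  from openin_continuous_map_preimage[OF this openin_cdom[OF assms(3)]]
  have "openin (mtop M) (cdom c \<inter> {p \<in> points M. F p \<in> cdom d})"
    using openin_cdom[OF assms(2)] by (intro openin_Int)
  moreover have "cdom c \<inter> {p \<in> points M. F p \<in> cdom d} = {p \<in> cdom c. F p \<in> cdom d}"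
    using cdom_subset[OF assms(2)] by blast
  ultimately show "open (cmap c ` {p \<in> cdom c. F p \<in> cdom d})"
    using open_cmap_image[OF assms(2)] by (metis (no_types, lifting) mem_Collect_eq subsetI)
  show "smooth_on (cmap c ` {p \<in> cdom c. F p \<in> cdom d}) (cmap d \<circ> F \<circ> cinv c)"
    using assms unfolding smooth_map_def by blast
qed

text \<open>Two representatives of a point are equal or related by \<open>\<Phi>\<close> or its
  inverse, by \<open>wrap_eqD\<close>. Accordingly, near the point the change of charts applies the
  coordinate form of the identity, \<open>\<Phi>i\<close> or \<open>\<Phi>\<close> and shifts time
  by 0, 1 or -1.\<close>

lemma suspension_transition:
  assumes "C \<in> atlas S" "D \<in> atlas S" "x \<in> cmap C ` (cdom C \<inter> cdom D)"
  obtains U I f k where "open U" "open I" "x \<in> U \<times> I" "smooth_on U f"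
    "\<forall>w\<in>U \<times> I. (cmap D \<circ> cinv C) w = (f (fst w), snd w + k)"
proof -
  note witness = that
  obtain c J where C: "c \<in> atlas M" "open J" "J \<subseteq> {-1<..<1}" "inj_on wrap (points M \<times> J)"
    "cdom C = wrap ` (cdom c \<times> J)" "\<forall>y\<in>cdom c. \<forall>t\<in>J. cmap C (wrap (y, t)) = (cmap c y, t)"
    by (rule suspension_chart[OF assms(1)])
  obtain d K where D: "d \<in> atlas M" "open K" "K \<subseteq> {-1<..<1}" "inj_on wrap (points M \<times> K)"
    "cdom D = wrap ` (cdom d \<times> K)" "\<forall>y\<in>cdom d. \<forall>t\<in>K. cmap D (wrap (y, t)) = (cmap d y, t)"
    by (rule suspension_chart[OF assms(2)])
  have sub: "cdom c \<subseteq> points M" "cdom d \<subseteq> points M" using cdom_subset C(1) D(1) by auto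
  have injC: "inj_on (cmap C) (cdom C)"
    using homeomorphic_imp_injective_map[OF suspension_chart_properties(3)[OF assms(1)]]
      openin_subset[OF suspension_chart_properties(1)[OF assms(1)]] by (simp add: Int_absorb1)
  have cinvC: "cinv C (cmap c y, t) = wrap (y, t)" if "y \<in> cdom c" "t \<in> J" for y t
  proof -
    have "wrap (y, t) \<in> cdom C" "cmap C (wrap (y, t)) = (cmap c y, t)" using that C(5,6) by auto
    then show ?thesis unfolding cinv_def using inv_into_f_f[OF injC, of "wrap (y, t)"] by simp
  qed
  obtain q where q: "q \<in> cdom C" "q \<in> cdom D" "x = cmap C q" using assms(3) by blast
  obtain y t where yt: "y \<in> cdom c" "t \<in> J" "q = wrap (y, t)" using q(1) C(5) by auto
  obtain z s where zs: "z \<in> cdom d" "s \<in> K" "q = wrap (z, s)" using q(2) D(5) by auto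
  have x: "x = (cmap c y, t)" using q(3) yt C(6) by simp
  \<comment> \<open>The three cases differ only in the map \<open>F\<close> of \<open>M\<close>, the
    time shift \<open>k\<close> and the time interval \<open>I\<close>.\<close>
  have local: thesis if F: "smooth_map M M F" and z: "z = F y" "s = t + k"
    and I: "open I" "t \<in> I" "I \<subseteq> J" "\<And>t'. t' \<in> I \<Longrightarrow> t' + k \<in> K"
    and eq: "\<And>y' t'. y' \<in> cdom c \<Longrightarrow> t' \<in> I \<Longrightarrow> wrap (y', t') = wrap (F y', t' + k)" for F k I
  proof (rule witness)
    let ?U = "cmap c ` {p \<in> cdom c. F p \<in> cdom d}"
    show "open ?U" "smooth_on ?U (cmap d \<circ> F \<circ> cinv c)"
      by (rule smooth_map_open_domain[OF F C(1) D(1)])+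
    show "open I" by (rule I(1))
    show "x \<in> ?U \<times> I" using x yt zs z I(2) by auto
    show "\<forall>w\<in>?U \<times> I. (cmap D \<circ> cinv C) w = ((cmap d \<circ> F \<circ> cinv c) (fst w), snd w + k)"
    proof
      fix w assume "w \<in> ?U \<times> I"
      then obtain y' t' where w: "w = (cmap c y', t')" "y' \<in> cdom c" "F y' \<in> cdom d" "t' \<in> I" by auto
      have "cinv C w = wrap (F y', t' + k)"
        using cinvC[of y' t'] w I(3) eq[of y' t'] by auto
      moreover have "cinv c (cmap c y') = y'"
        using cinv_cmap[of c y'] C(1) w(2) by (simp add: chart_around_def)
      ultimately show "(cmap D \<circ> cinv C) w = ((cmap d \<circ> F \<circ> cinv c) (fst w), snd w + k)"
        using D(6) w I(4)[OF w(4)] by simp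
    qed
  qed
  have "(z, s) = (y, t) \<or> (t < 0 \<and> z = \<Phi>i y \<and> s = t + 1) \<or> (t > 0 \<and> z = \<Phi> y \<and> s = t - 1)"
    by (rule wrap_eqD[OF trans[OF yt(3)[symmetric] zs(3)]]) (use yt zs sub C(3) D(3) in auto)
  then consider "z = id y" "s = t + 0" | "t < 0" "z = \<Phi>i y" "s = t + 1" | "t > 0" "z = \<Phi> y" "s = t + (- 1)"
    by auto
  then show thesis
  proof cases
    case 1
    show thesis
      by (rule local[OF smooth_id 1, of "J \<inter> K"]) (use C(2) D(2) yt zs 1 in auto)
  next
    case 2
    show thesis
    proof (rule local[OF smooth_\<Phi>i 2(2,3)])
      \<comment> \<open>Times are kept negative, so that the same identification applies throughout,
        and their shifts are kept inside \<open>K\<close>.\<close>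
      show "open (J \<inter> {..<0} \<inter> (\<lambda>t. t + 1) -` K)"
        using C(2) D(2) by (intro open_Int continuous_open_vimage) (auto intro!: continuous_intros)
      show "wrap (y', t') = wrap (\<Phi>i y', t' + 1)"
        if "y' \<in> cdom c" "t' \<in> J \<inter> {..<0} \<inter> (\<lambda>t. t + 1) -` K" for y' t'
      proof -
        have "y' \<in> points M" "t' < 0" "-1 < t'" using that sub(1) C(3) by auto
        then show ?thesis using wrap_shift[OF \<Phi>i_in, of y' "t' + 1"] by (simp add: \<Phi>_\<Phi>i)
      qed
    qed (use yt zs 2 in auto)
  next
    case 3
    show thesis
    proof (rule local[OF smooth_\<Phi> 3(2,3)])
      show "open (J \<inter> {0<..} \<inter> (\<lambda>t. t + (- 1)) -` K)"
        using C(2) D(2) by (intro open_Int continuous_open_vimage) (auto intro!: continuous_intros)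
      show "wrap (y', t') = wrap (\<Phi> y', t' + (- 1))"
        if "y' \<in> cdom c" "t' \<in> J \<inter> {0<..} \<inter> (\<lambda>t. t + (- 1)) -` K" for y' t'
      proof -
        have "y' \<in> points M" "0 < t'" "t' < 1" using that sub(1) C(3) by auto
        then show ?thesis using wrap_shift[of y' t'] by simp
      qed
    qed (use yt zs 3 in auto)
  qed
qed

lemma smooth_suspension: "smooth_manifold S"
  unfolding smooth_manifold_def
proof (intro conjI ballI)
  show "\<exists>B::('m \<times> real) set. finite B \<and> span B = UNIV"
    using smooth_manifold unfolding smooth_manifold_def
    by (elim conjE exE) (rule finite_spanning_set_Times[OF _ _ finite_Basis span_Basis])
  show "points S = (\<Union>C\<in>atlas S. cdom C)"
  proof (intro equalityI subsetI)
    fix z assume "z \<in> points S"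
    then obtain y t where z: "z = proj (y, t)" "y \<in> points M" "t \<in> {0..1}" unfolding points_S by auto
    consider "0 < t" "t < 1" | "t = 0" | "t = 1" using z(3) by force
    then obtain C where "C \<in> atlas S" "z \<in> cdom C"
    proof cases
      case 1
      have "y \<in> cdom (chart_at M y)" "chart_at M y \<in> atlas M"
        using chart_at[OF z(2)] by (auto simp: chart_around_def)
      then show thesis
        using 1 z that[of "susp_chart_inner M \<Phi> (chart_at M y)"]
        by (auto simp: suspension_def susp_chart_inner_def)
    next
      case 2
      have "y \<in> cdom (chart_at M y)" "chart_at M y \<in> atlas M"
        using chart_at[OF z(2)] by (auto simp: chart_around_def)
      then show thesis
        using 2 z that[of "susp_chart_seam M \<Phi> (chart_at M y)"]
        by (auto simp: suspension_def susp_chart_seam_def)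
    next
      case 3
      have "\<Phi> y \<in> cdom (chart_at M (\<Phi> y))" "chart_at M (\<Phi> y) \<in> atlas M"
        using chart_at[OF \<Phi>_in[OF z(2)]] by (auto simp: chart_around_def)
      then show thesis
        using 3 z that[of "susp_chart_seam M \<Phi> (chart_at M (\<Phi> y))"]
        by (auto simp: suspension_def susp_chart_seam_def)
    qed
    then show "z \<in> (\<Union>C\<in>atlas S. cdom C)" by blast
  next
    fix z assume "z \<in> (\<Union>C\<in>atlas S. cdom C)"
    then obtain C where "C \<in> atlas S" "z \<in> cdom C" by blast
    then show "z \<in> points S" using openin_subset[OF suspension_chart_properties(1)] by blast
  qed
  fix C D assume C: "C \<in> atlas S" and D: "D \<in> atlas S"
  show "smooth_on (cmap C ` (cdom C \<inter> cdom D)) (cmap D \<circ> cinv C)"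
  proof (rule smooth_on_local)
    fix x assume "x \<in> cmap C ` (cdom C \<inter> cdom D)"
    from suspension_transition[OF C D this]
    obtain U I f k where U: "open U" "open I" "x \<in> U \<times> I" "smooth_on U f"
      "\<forall>w\<in>U \<times> I. (cmap D \<circ> cinv C) w = (f (fst w), snd w + k)" .
    show "\<exists>V. open V \<and> x \<in> V \<and> smooth_on V (cmap D \<circ> cinv C)"
      using shear_transition(1)[OF U(1,2,4) bspec[OF U(5)]] open_Times[OF U(1,2)] U(3) by blast
  qed
qed (use Hausdorff_S second_countable_S suspension_chart_properties in auto)

lemma suspension_jacobian:
  assumes "chart_around S C p" "chart_around S D p"
  shows "snd (fderiv (cmap D \<circ> cinv C) (cmap C p) v) = snd v"
    "fderiv (cmap D \<circ> cinv C) (cmap C p) (0, 1) = (0, 1)"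
proof -
  have at: "C \<in> atlas S" "D \<in> atlas S" "cmap C p \<in> cmap C ` (cdom C \<inter> cdom D)"
    using assms by (auto simp: chart_around_def)
  from suspension_transition[OF this]
  obtain U I f k where U: "open U" "open I" "cmap C p \<in> U \<times> I" "smooth_on U f"
    "\<forall>w\<in>U \<times> I. (cmap D \<circ> cinv C) w = (f (fst w), snd w + k)" .
  note * = shear_transition(2)[OF U(1,2,4) bspec[OF U(5)] U(3)]
  show "snd (fderiv (cmap D \<circ> cinv C) (cmap C p) v) = snd v"
    by (simp add: *)
  have "linear (fderiv f (fst (cmap C p)))"
    using smooth_on_linear_derivative[OF U(4)] U(3) by auto
  then show "fderiv (cmap D \<circ> cinv C) (cmap C p) (0, 1) = (0, 1)"
    by (simp add: * linear_0)
qed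

lemma suspension_strongly_adapted:
  "nonsingular_flow S (suspension_field M \<Phi>) \<and>
    strongly_adapted S (suspension_field M \<Phi>) (dt_form S)"
proof (rule dt_form_strongly_adapted[OF smooth_suspension])
  interpret S: smooth_mfd S by unfold_locales (rule smooth_suspension)
  show "vector_field S (suspension_field M \<Phi>)"
    unfolding vector_field_def
  proof (intro conjI ballI)
    show "suspension_field M \<Phi> p \<in> tangent_space S p" for p
      unfolding tangent_space_def suspension_field_def const_field_def
      by (simp add: suspension_jacobian(2) del: split_paired_All)
    fix C assume C: "C \<in> atlas S"
    show "smooth_on (cimg C) (field_in (suspension_field M \<Phi>) C)"
      by (rule smooth_on_cong[OF S.open_cimg[OF C] _ smooth_on_const[of _ "(0, 1)"]])
        (simp add: field_in_def suspension_field_def const_field_def S.chart_around_cinv[OF C])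
  qed
  show "snd (suspension_field M \<Phi> p C) = 1" if "chart_around S C p" for C p
    using that by (simp add: suspension_field_def const_field_def)
qed (rule suspension_jacobian(1))

end

theorem proposition1p8:
  fixes N :: "('a, 'e::euclidean_space) manifold" and Y :: "('a, 'e) field"
    and M :: "('b, 'm::real_normed_vector) manifold" and X :: "('b, 'm) field"
    and \<Phi> :: "'b \<Rightarrow> 'b"
  shows
    "(nonsingular_flow N Y \<longrightarrow>
        (\<forall>g. riemannian_metric N g \<and> preserves_metric N Y g \<longrightarrow>
             strongly_adapted N Y (dual_form g Y)) \<and>
        (\<forall>g. riemannian_metric N g \<and> geodesible_with N Y g \<longrightarrow>
             strongly_adapted N Y (dual_form g Y)) \<and>
        (\<forall>Ep Em. smooth_anosov_splitting N Y Ep Em \<longrightarrow>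
             strongly_adapted N Y (canonical_form Y Ep Em))) \<and>
     (smooth_manifold M \<and> compact_space (mtop M) \<and> diffeomorphism M M \<Phi> \<longrightarrow>
        nonsingular_flow (suspension M \<Phi>) (suspension_field M \<Phi>) \<and>
        strongly_adapted (suspension M \<Phi>) (suspension_field M \<Phi>) (dt_form (suspension M \<Phi>))) \<and>
     (smooth_flow M X \<longrightarrow>
        nonsingular_flow (prod_manifold M circle) (prod_field M circle X (const_field circle 1)) \<and>
        strongly_adapted (prod_manifold M circle) (prod_field M circle X (const_field circle 1))
          (dt_form (prod_manifold M circle)))"
proof (intro conjI impI allI)
  assume "nonsingular_flow N Y"
  then interpret euclidean_flow N Y
    by unfold_locales (simp_all add: nonsingular_flow_def smooth_flow_def)
  show "strongly_adapted N Y (dual_form g Y)" if "riemannian_metric N g \<and> preserves_metric N Y g" for g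
    using isometric_strongly_adapted that by blast
  show "strongly_adapted N Y (dual_form g Y)" if "riemannian_metric N g \<and> geodesible_with N Y g" for g
    using geodesible_strongly_adapted that by blast
  show "strongly_adapted N Y (canonical_form Y Ep Em)" if "smooth_anosov_splitting N Y Ep Em" for Ep Em
    using anosov_strongly_adapted[OF that] .
next
  assume "smooth_manifold M \<and> compact_space (mtop M) \<and> diffeomorphism M M \<Phi>"
  then interpret suspension_data M \<Phi> by unfold_locales auto
  show "nonsingular_flow (suspension M \<Phi>) (suspension_field M \<Phi>)"
    "strongly_adapted (suspension M \<Phi>) (suspension_field M \<Phi>) (dt_form (suspension M \<Phi>))"
    using suspension_strongly_adapted by auto
next
  assume "smooth_flow M X"
  from circle_product_strongly_adapted[OF this]
  show "nonsingular_flow (prod_manifold M circle) (prod_field M circle X (const_field circle 1))"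
    "strongly_adapted (prod_manifold M circle) (prod_field M circle X (const_field circle 1))
      (dt_form (prod_manifold M circle))" by auto
qed

end
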